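(* Let $m\in(0,\infty)$, $\rho\in\mathbb{N}$ with $\rho\ge n+1$, $\omega\ge0$, $\kappa>0$, let $\mathcal A\subset P_{\omega,\kappa}S^{m,\rho}$ be bounded, and fix $R>0$ with $R\ge\omega^m$. Let $a\in\mathcal A$. Let $\varphi\in\mathscr S(\mathbb{R})$ with $\varphi(0)=1$, and for $\epsilon\in(0,1)$ set $\chi_\epsilon(\xi,\lambda):=\varphi\big(\epsilon(|\xi|^2+|\lambda|^{2/m})^{1/2}\big)$ for $\xi\in\mathbb{R}^n$, $\lambda\in\Sigma_{\pi/2,R}$. Define $$K_\epsilon(\eta,\lambda):=\sum_{\mathbf k\in\mathbb{Z}^n}e^{i\mathbf k\cdot\eta}\chi_\epsilon(\mathbf k,\lambda)(a(\mathbf k)+\lambda)^{-1}$$ for $\epsilon\in(0,1)$, $\eta\in\mathbb{T}^n$ and $\lambda\in\Sigma_{\pi/2,R}$. Let $\theta_0:=\frac12\min\{m,1\}$ and $\theta_1:=1-\theta_0$, and write $\mu:=|\lambda|^{1/m}$. Then $$|\lambda|\,\|K_\epsilon(\eta,\lambda)\|_{L(E)}\le C\,\frac{\mu^{\theta_0}|\eta|^{\theta_0}+\mu^{\theta_1}|\eta|^{\theta_1}}{|\eta|^n(1+\mu|\eta|)}\quad(\eta\in\mathbb{T}^n\setminus\{0\},\ \lambda\in\Sigma_{\pi/2,R})\qquad(1)$$ with $C$ independent of $\epsilon$ and $\lambda$. Further, $$|\lambda|\,\|K_\epsilon(\cdot,\lambda)\|_{L^1(\mathbb{T}^n,L(E))}\le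 C\quad(\lambda\in\Sigma_{\pi/2,R})\qquad(2)$$ with $C$ independent of $\epsilon$ and $\lambda$. Moreover, there exists a strongly measurable function $K\colon\mathbb{T}^n\times\Sigma_{\pi/2,R}\to L(E)$ with $K_\epsilon(\eta,\lambda)\to K(\eta,\lambda)$ as $\epsilon\searrow0$ pointwise almost everywhere, and (1) and (2) hold with $K_\epsilon$ replaced by $K$.
   Context: Fix $n\in\mathbb{N}$ and an arbitrary (complex) Banach space $E$; $L(E)$ is the space of bounded linear operators on $E$. $\langle x\rangle:=(1+|x|^2)^{1/2}$ for $x\in\mathbb{R}^n$, with $|\cdot|$ the Euclidean norm. $\mathbb{T}^n=(\mathbb{R}/2\pi\mathbb{Z})^n$ with representatives chosen in $[-\pi,\pi]^n$; for $\eta\in\mathbb{T}^n$, $|\eta|$ is the Euclidean norm of this representative. $\mathbb{T}^n$ carries the normalized measure $(2\pi)^{-n}dx$, and $L^1(\mathbb{T}^n,L(E))$ is the corresponding Bochner space. Symbol class: with $\delta_j$ the $j$-th unit vector, $\Delta_{k_j}a(\mathbf k):=a(\mathbf k+\delta_j)-a(\mathbf k)$ and $\Delta_{\mathbf k}^\alpha:=\Delta_{k_1}^{\alpha_1}\cdots\Delta_{k_n}^{\alpha_n}$. For $m\in\mathbb{R}$, $\rho\in\mathbb{N}_0$, $S^{m,\rho}$ is the space of all $a\colon\mathbb{Z}^n\to L(E)$ with $\|a\|_{S^{m,\rho}}:=\max_{|\alpha|\le\rho}\sup_{\mathbf k\in\mathbb{Z}^n}\langle\mathbf k\rangle^{|\alpha|-m}\|\Delta_{\mathbf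 k}^\alpha a(\mathbf k)\|_{L(E)}<\infty$, with this norm. Parabolicity: for $m>0$, put $\langle\mathbf k,\lambda\rangle:=(1+|\mathbf k|^2+|\lambda|^{2/m})^{1/2}$ and $|(\mathbf k,\lambda)|:=(|\mathbf k|^2+|\lambda|^{2/m})^{1/2}$. A symbol $a\in S^{m,\rho}$ is parabolic with constants $\omega\ge0$, $\kappa>0$ if for all $(\mathbf k,\lambda)\in\mathbb{Z}^n\times\mathbb{C}$ with $\operatorname{Re}\lambda\ge0$ and $|(\mathbf k,\lambda)|\ge\omega$ the operator $a(\mathbf k)+\lambda\colon E\to E$ is bijective and $\|(a(\mathbf k)+\lambda)^{-1}\|_{L(E)}\le\kappa\langle\mathbf k,\lambda\rangle^{-m}$. $P_{\omega,\kappa}S^{m,\rho}$ is the set of all symbols in $S^{m,\rho}$ that are parabolic with constants $\omega$ and $\kappa$, with the topology induced by $S^{m,\rho}$; bounded means bounded in the norm of $S^{m,\rho}$. For $R\ge0$ and $\theta\in(0,\pi]$, $\Sigma_{\theta,R}:=\{\lambda\in\mathbb{C}:|\lambda|\ge R,\ |\arg\lambda|\le\theta\}$. *)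

theory Defs
  imports "HOL-Analysis.Analysis"
begin

section \<open>Complex Banach spaces\<close>

class complex_normed_vector = real_normed_vector +
  fixes scaleC :: "complex \<Rightarrow> 'a \<Rightarrow> 'a" (infixr "*\<^sub>C" 75)
  assumes scaleC_add_right: "c *\<^sub>C (x + y) = c *\<^sub>C x + c *\<^sub>C y"
    and scaleC_add_left: "(c + d) *\<^sub>C x = c *\<^sub>C x + d *\<^sub>C x"
    and scaleC_scaleC: "c *\<^sub>C d *\<^sub>C x = (c * d) *\<^sub>C x"
    and scaleC_of_real: "complex_of_real r *\<^sub>C x = r *\<^sub>R x"
    and norm_scaleC: "norm (c *\<^sub>C x) = cmod c * norm x"

class complex_banach = complex_normed_vector + banach

instantiation complex :: complex_banach
begin

definition scaleC_complex :: "complex \<Rightarrow> complex \<Rightarrow> complex"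
  where "scaleC_complex c x = c * x"

instance
  by standard (simp_all add: scaleC_complex_def algebra_simps norm_mult scaleR_conv_of_real)

end

lemma bounded_linear_scaleC: "bounded_linear (\<lambda>x::'e::complex_normed_vector. c *\<^sub>C x)"
proof (rule bounded_linear_intro[where K = "cmod c"])
  fix x y :: 'e and r :: real
  show "c *\<^sub>C (x + y) = c *\<^sub>C x + c *\<^sub>C y" by (rule scaleC_add_right)
  show "c *\<^sub>C (r *\<^sub>R x) = r *\<^sub>R (c *\<^sub>C x)"
    unfolding scaleC_of_real[symmetric] scaleC_scaleC by (simp add: mult.commute)
  show "norm (c *\<^sub>C x) \<le> norm x * cmod c" by (simp add: norm_scaleC)
qed

lemmas scaleC_simps =
  linear_simps[OF bounded_linear_scaleC]


section \<open>The Banach space \<open>L(E)\<close> of bounded complex-linear operators\<close>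

text \<open>Realised as the closed subspace of the complex-linear elements of \<^typ>\<open>'e \<Rightarrow>\<^sub>L 'e\<close>;
  the norm is therefore the operator norm.\<close>

typedef (overloaded) 'e lop =
  "{T :: 'e::complex_banach \<Rightarrow>\<^sub>L 'e. \<forall>c x. blinfun_apply T (c *\<^sub>C x) = c *\<^sub>C blinfun_apply T x}"
  morphisms blinfun_of_lop lop_of_blinfun
proof
  show "0 \<in> {T :: 'e \<Rightarrow>\<^sub>L 'e. \<forall>c x. blinfun_apply T (c *\<^sub>C x) = c *\<^sub>C blinfun_apply T x}"
    by (simp add: scaleC_simps)
qed

setup_lifting type_definition_lop

lift_definition lop_apply :: "'e::complex_banach lop \<Rightarrow> 'e \<Rightarrow> 'e" is blinfun_apply .

instantiation lop :: (complex_banach) real_normed_vector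
begin

lift_definition norm_lop :: "'a lop \<Rightarrow> real" is norm .

lift_definition zero_lop :: "'a lop" is 0
  by (simp add: scaleC_simps)

lift_definition plus_lop :: "'a lop \<Rightarrow> 'a lop \<Rightarrow> 'a lop" is "(+)"
  by (simp add: blinfun.add_left scaleC_simps)

lift_definition minus_lop :: "'a lop \<Rightarrow> 'a lop \<Rightarrow> 'a lop" is "(-)"
  by (simp add: blinfun.diff_left scaleC_simps)

lift_definition uminus_lop :: "'a lop \<Rightarrow> 'a lop" is uminus
  by (simp add: blinfun.minus_left scaleC_simps)

lift_definition scaleR_lop :: "real \<Rightarrow> 'a lop \<Rightarrow> 'a lop" is "(*\<^sub>R)"
  by (simp add: blinfun.scaleR_left scaleC_simps)

definition dist_lop :: "'a lop \<Rightarrow> 'a lop \<Rightarrow> real"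
  where "dist_lop S T = norm (S - T)"

definition uniformity_lop :: "('a lop \<times> 'a lop) filter"
  where "uniformity_lop = (INF e\<in>{0 <..}. principal {(x, y). dist x y < e})"

definition open_lop :: "'a lop set \<Rightarrow> bool"
  where "open_lop S = (\<forall>x\<in>S. \<forall>\<^sub>F (x', y) in uniformity. x' = x \<longrightarrow> y \<in> S)"

definition sgn_lop :: "'a lop \<Rightarrow> 'a lop"
  where "sgn_lop x = scaleR (inverse (norm x)) x"

instance
proof
  fix x y z :: "'a lop" and r s :: real
  show "x + y + z = x + (y + z)" by transfer (rule add.assoc)
  show "x + y = y + x" by transfer (rule add.commute)
  show "0 + x = x" by transfer (rule add_0)
  show "- x + x = 0" by transfer (rule left_minus)
  show "x - y = x + - y" by transfer (rule diff_conv_add_uminus)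
  show "r *\<^sub>R (x + y) = r *\<^sub>R x + r *\<^sub>R y" by transfer (rule scaleR_add_right)
  show "(r + s) *\<^sub>R x = r *\<^sub>R x + s *\<^sub>R x" by transfer (rule scaleR_add_left)
  show "r *\<^sub>R s *\<^sub>R x = (r * s) *\<^sub>R x" by transfer (rule scaleR_scaleR)
  show "1 *\<^sub>R x = x" by transfer (rule scaleR_one)
  show "norm x = 0 \<longleftrightarrow> x = 0" by transfer (rule norm_eq_zero)
  show "norm (x + y) \<le> norm x + norm y" by transfer (rule norm_triangle_ineq)
  show "norm (r *\<^sub>R x) = \<bar>r\<bar> * norm x" by transfer (rule norm_scaleR)
qed (rule dist_lop_def uniformity_lop_def open_lop_def sgn_lop_def)+

end

instantiation lop :: (complex_banach) complex_normed_vector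
begin

lemma blinfun_apply_scaleC:
  fixes T :: "'b::real_normed_vector \<Rightarrow>\<^sub>L 'a"
  shows "blinfun_apply (Blinfun (\<lambda>x. c *\<^sub>C blinfun_apply T x)) x = c *\<^sub>C blinfun_apply T x"
  by (subst bounded_linear_Blinfun_apply)
    (auto intro: bounded_linear_compose[OF bounded_linear_scaleC] blinfun.bounded_linear_right)

lift_definition scaleC_lop :: "complex \<Rightarrow> 'a lop \<Rightarrow> 'a lop"
  is "\<lambda>c T. Blinfun (\<lambda>x. c *\<^sub>C blinfun_apply T x)"
  by (simp add: blinfun_apply_scaleC scaleC_scaleC mult.commute)

lemma lop_eqI: "(\<And>x. lop_apply S x = lop_apply T x) \<Longrightarrow> S = (T :: 'a lop)"
  by transfer (rule blinfun_eqI)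

lemma lop_apply_add: "lop_apply (S + T) x = lop_apply S x + lop_apply (T :: 'a lop) x"
  by (simp add: lop_apply.rep_eq plus_lop.rep_eq blinfun.add_left)

lemma lop_apply_scaleR: "lop_apply (r *\<^sub>R T) x = r *\<^sub>R lop_apply (T :: 'a lop) x"
  by (simp add: lop_apply.rep_eq scaleR_lop.rep_eq blinfun.scaleR_left)

lemma lop_apply_scaleC: "lop_apply (c *\<^sub>C T) x = c *\<^sub>C lop_apply (T :: 'a lop) x"
  by (simp add: lop_apply.rep_eq scaleC_lop.rep_eq blinfun_apply_scaleC)

lemma norm_lop_apply: "norm (lop_apply T x) \<le> norm (T :: 'a lop) * norm x"
  by transfer (rule norm_blinfun)

lemma norm_lop_bound:
  "0 \<le> b \<Longrightarrow> (\<And>x. norm (lop_apply T x) \<le> b * norm x) \<Longrightarrow> norm (T :: 'a lop) \<le> b"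
  by transfer (rule norm_blinfun_bound)

instance
proof
  fix c d :: complex and r :: real and S T :: "'a lop"
  show "c *\<^sub>C (S + T) = c *\<^sub>C S + c *\<^sub>C T"
    by (rule lop_eqI) (simp add: lop_apply_add lop_apply_scaleC scaleC_add_right)
  show "(c + d) *\<^sub>C T = c *\<^sub>C T + d *\<^sub>C T"
    by (rule lop_eqI) (simp add: lop_apply_add lop_apply_scaleC scaleC_add_left)
  show "c *\<^sub>C d *\<^sub>C T = (c * d) *\<^sub>C T"
    by (rule lop_eqI) (simp add: lop_apply_scaleC scaleC_scaleC)
  show "complex_of_real r *\<^sub>C T = r *\<^sub>R T"
    by (rule lop_eqI) (simp add: lop_apply_scaleC lop_apply_scaleR scaleC_of_real)
  have le: "norm (e *\<^sub>C U) \<le> cmod e * norm U" for e and U :: "'a lop"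
    by (rule norm_lop_bound)
      (simp_all add: lop_apply_scaleC norm_scaleC norm_lop_apply mult.assoc mult_left_mono)
  show "norm (c *\<^sub>C T) = cmod c * norm T"
  proof (cases "c = 0")
    case True
    then show ?thesis using le[of c T] by simp
  next
    case False
    have one: "1 *\<^sub>C x = x" for x :: 'a
      using scaleC_of_real[of 1 x] by simp
    have "T = inverse c *\<^sub>C c *\<^sub>C T"
      by (rule lop_eqI) (simp add: lop_apply_scaleC scaleC_scaleC False one)
    then have "norm T \<le> inverse (cmod c) * norm (c *\<^sub>C T)"
      using le[of "inverse c" "c *\<^sub>C T"] by (simp add: norm_inverse)
    then have "cmod c * norm T \<le> norm (c *\<^sub>C T)"
      using False by (simp add: field_simps)
    with le[of c T] show ?thesis by simp
  qed
qed

end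

instance lop :: (complex_banach) complex_banach
proof
  fix X :: "nat \<Rightarrow> 'a lop"
  assume X: "Cauchy X"
  have d: "dist (blinfun_of_lop S) (blinfun_of_lop T) = dist S T" for S T :: "'a lop"
    by (simp add: dist_norm norm_lop.rep_eq minus_lop.rep_eq)
  have "Cauchy (\<lambda>n. blinfun_of_lop (X n))"
    using X by (simp add: Cauchy_def d)
  then obtain U where U: "(\<lambda>n. blinfun_of_lop (X n)) \<longlonglongrightarrow> U"
    using Cauchy_convergent convergent_def by blast
  have "blinfun_apply U (c *\<^sub>C x) = c *\<^sub>C blinfun_apply U x" for c x
  proof (rule LIMSEQ_unique)
    have pt: "(\<lambda>n. blinfun_apply (blinfun_of_lop (X n)) y) \<longlonglongrightarrow> blinfun_apply U y" for y
      by (intro tendsto_intros U)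
    show "(\<lambda>n. blinfun_apply (blinfun_of_lop (X n)) (c *\<^sub>C x)) \<longlonglongrightarrow> blinfun_apply U (c *\<^sub>C x)"
      by (rule pt)
    have "blinfun_apply (blinfun_of_lop (X n)) (c *\<^sub>C x)
        = c *\<^sub>C blinfun_apply (blinfun_of_lop (X n)) x" for n
      using blinfun_of_lop[of "X n"] by simp
    then show "(\<lambda>n. blinfun_apply (blinfun_of_lop (X n)) (c *\<^sub>C x)) \<longlonglongrightarrow> c *\<^sub>C blinfun_apply U x"
      by (simp add: bounded_linear.tendsto[OF bounded_linear_scaleC pt])
  qed
  then have "blinfun_of_lop (lop_of_blinfun U) = U"
    by (intro lop_of_blinfun_inverse) simp
  then have "X \<longlonglongrightarrow> lop_of_blinfun U"
    using U by (simp add: tendsto_iff flip: d)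
  then show "convergent X" by (auto simp: convergent_def)
qed

lift_definition lop_id :: "'e::complex_banach lop" is id_blinfun
  by simp

lemma lop_apply_id: "lop_apply lop_id x = x"
  by transfer simp

definition lop_invertible :: "'e::complex_banach lop \<Rightarrow> bool"
  where \<comment> \<open>By the open mapping theorem the second conjunct follows from the first.\<close>
    "lop_invertible T \<longleftrightarrow> bij (lop_apply T) \<and> bounded_linear (inv (lop_apply T))"

definition lop_inv :: "'e::complex_banach lop \<Rightarrow> 'e lop"
  where "lop_inv T = lop_of_blinfun (Blinfun (inv (lop_apply T)))"

lemma lop_apply_inv:
  assumes "lop_invertible T"
  shows "lop_apply (lop_inv T) = inv (lop_apply T)"
proof -
  have b: "bij (lop_apply T)" and l: "bounded_linear (inv (lop_apply T))"
    using assms by (auto simp: lop_invertible_def)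
  have T: "lop_apply T (c *\<^sub>C x) = c *\<^sub>C lop_apply T x" for c x
    by transfer simp
  have "inv (lop_apply T) (c *\<^sub>C x) = c *\<^sub>C inv (lop_apply T) x" for c x
    using b by (metis T bij_inv_eq_iff)
  then have "blinfun_of_lop (lop_inv T) = Blinfun (inv (lop_apply T))"
    unfolding lop_inv_def
    by (intro lop_of_blinfun_inverse) (simp add: bounded_linear_Blinfun_apply[OF l])
  then show ?thesis
    by (simp only: lop_apply.rep_eq[of "lop_inv T"] bounded_linear_Blinfun_apply[OF l])
qed


section \<open>Symbols on \<open>\<int>\<^sup>n\<close>\<close>

definition rvec :: "int ^ 'n \<Rightarrow> real ^ 'n::finite"
  where "rvec k = (\<chi> j. real_of_int (k $ j))"

definition bracket :: "'v::real_normed_vector \<Rightarrow> real"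
  where "bracket x = (1 + (norm x)\<^sup>2) powr (1 / 2)"

definition diff_op :: "'n \<Rightarrow> (int ^ 'n::finite \<Rightarrow> 'v) \<Rightarrow> int ^ 'n \<Rightarrow> 'v::ab_group_add"
  where "diff_op j a k = a (k + axis j 1) - a k"

text \<open>\<open>\<Delta>\<^sup>\<alpha>\<close> is the composition of the powers \<open>\<Delta>\<^sub>j ^^ \<alpha>\<^sub>j\<close> over all \<open>j\<close>. The index type carries no
  order, but the \<open>\<Delta>\<^sub>j\<close> commute, so that the fold below is well defined.\<close>

definition multi_diff :: "nat ^ 'n \<Rightarrow> (int ^ 'n::finite \<Rightarrow> 'v) \<Rightarrow> int ^ 'n \<Rightarrow> 'v::ab_group_add"
  where "multi_diff \<alpha> a = Finite_Set.fold (\<lambda>j. diff_op j ^^ (\<alpha> $ j)) a UNIV"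

lemma comp_fun_commute_diff_op:
  "comp_fun_commute (diff_op :: 'n \<Rightarrow> (int ^ 'n::finite \<Rightarrow> 'v) \<Rightarrow> int ^ 'n \<Rightarrow> 'v::ab_group_add)"
  by standard (simp add: fun_eq_iff diff_op_def algebra_simps)

lemma multi_diff_foldr:
  fixes a :: "int ^ 'n::finite \<Rightarrow> 'v::ab_group_add"
  assumes "distinct js" "set js = UNIV"
  shows "multi_diff \<alpha> a = foldr (\<lambda>j. diff_op j ^^ (\<alpha> $ j)) js a"
proof -
  interpret comp_fun_commute "\<lambda>j::'n. (diff_op j :: (int ^ 'n \<Rightarrow> 'v) \<Rightarrow> _) ^^ (\<alpha> $ j)"
    by (rule comp_fun_commute.comp_fun_commute_funpow[OF comp_fun_commute_diff_op])
  have "Finite_Set.fold (\<lambda>j. diff_op j ^^ (\<alpha> $ j)) a (set js)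
      = foldr (\<lambda>j. diff_op j ^^ (\<alpha> $ j)) js a"
    using assms(1) by (induction js) simp_all
  with assms(2) show ?thesis by (simp add: multi_diff_def)
qed

definition multi_order :: "nat ^ 'n::finite \<Rightarrow> nat"
  where "multi_order \<alpha> = (\<Sum>j\<in>UNIV. \<alpha> $ j)"

text \<open>The norm is taken in the extended nonnegative reals, where every supremum exists; the outer
  supremum ranges over finitely many multiindices and hence is a maximum.\<close>

definition symbol_norm :: "real \<Rightarrow> nat \<Rightarrow> (int ^ 'n::finite \<Rightarrow> 'e::complex_banach lop) \<Rightarrow> ennreal"
  where "symbol_norm m \<rho> a =
    (SUP \<alpha>\<in>{\<alpha>. multi_order \<alpha> \<le> \<rho>}. SUP k.
      ennreal (bracket (rvec k) powr (real (multi_order \<alpha>) - m) * norm (multi_diff \<alpha> a k)))"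

definition symbol_space :: "real \<Rightarrow> nat \<Rightarrow> (int ^ 'n::finite \<Rightarrow> 'e::complex_banach lop) set"
  where "symbol_space m \<rho> = {a. symbol_norm m \<rho> a < \<infinity>}"

definition symbol_bounded :: "real \<Rightarrow> nat \<Rightarrow> (int ^ 'n::finite \<Rightarrow> 'e::complex_banach lop) set \<Rightarrow> bool"
  where "symbol_bounded m \<rho> A \<longleftrightarrow> (\<exists>M::real. \<forall>a\<in>A. symbol_norm m \<rho> a \<le> ennreal M)"


section \<open>Parabolicity\<close>

text \<open>The spectral parameter \<open>\<lambda>\<close> is called \<open>z\<close>, as \<open>\<lambda>\<close> is not available as a variable name.\<close>

definition param_abs :: "real \<Rightarrow> 'v::real_normed_vector \<Rightarrow> complex \<Rightarrow> real"
  where "param_abs m x z = ((norm x)\<^sup>2 + cmod z powr (2 / m)) powr (1 / 2)"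

definition param_bracket :: "real \<Rightarrow> 'v::real_normed_vector \<Rightarrow> complex \<Rightarrow> real"
  where "param_bracket m x z = (1 + (norm x)\<^sup>2 + cmod z powr (2 / m)) powr (1 / 2)"

definition parabolic ::
    "real \<Rightarrow> real \<Rightarrow> real \<Rightarrow> (int ^ 'n::finite \<Rightarrow> 'e::complex_banach lop) \<Rightarrow> bool"
  where "parabolic m \<omega> \<kappa> a \<longleftrightarrow>
    (\<forall>k z. 0 \<le> Re z \<longrightarrow> \<omega> \<le> param_abs m (rvec k) z \<longrightarrow>
      lop_invertible (a k + z *\<^sub>C lop_id) \<and>
      norm (lop_inv (a k + z *\<^sub>C lop_id)) \<le> \<kappa> * param_bracket m (rvec k) z powr (- m))"

definition parabolic_symbols ::
    "real \<Rightarrow> real \<Rightarrow> real \<Rightarrow> nat \<Rightarrow> (int ^ 'n::finite \<Rightarrow> 'e::complex_banach lop) set"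
  where "parabolic_symbols \<omega> \<kappa> m \<rho> = {a \<in> symbol_space m \<rho>. parabolic m \<omega> \<kappa> a}"

definition sector :: "real \<Rightarrow> real \<Rightarrow> complex set"
  where "sector \<theta> R = {z. R \<le> cmod z \<and> \<bar>Arg z\<bar> \<le> \<theta>}"


section \<open>The torus, measurability and kernel estimates\<close>

text \<open>Every class in \<open>(\<real>/2\<pi>\<int>)\<^sup>n\<close> has exactly one representative in the half-open cube, and this
  representative has the same Euclidean norm as any other one in the closed cube \<open>[-\<pi>, \<pi>]\<^sup>n\<close>.\<close>

definition torus :: "(real ^ 'n::finite) set"
  where "torus = {\<eta>. \<forall>j. - pi \<le> \<eta> $ j \<and> \<eta> $ j < pi}"

definition torus_measure :: "(real ^ 'n::finite) measure"
  where "torus_measure =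
    scale_measure (ennreal (1 / (2 * pi) ^ CARD('n))) (restrict_space lborel torus)"

text \<open>Strong (Bochner) measurability. The notion \<^term>\<open>borel_measurable\<close> is not appropriate here,
  since \<open>L(E)\<close> is in general not separable.\<close>

definition strongly_measurable :: "'a measure \<Rightarrow> ('a \<Rightarrow> 'v::topological_space) \<Rightarrow> bool"
  where "strongly_measurable M f \<longleftrightarrow>
    (\<exists>s. (\<forall>i. simple_function M (s i)) \<and> (\<forall>x\<in>space M. (\<lambda>i::nat. s i x) \<longlonglongrightarrow> f x))"

definition L1_norm :: "'a measure \<Rightarrow> ('a \<Rightarrow> 'v::real_normed_vector) \<Rightarrow> ennreal"
  where "L1_norm M f = (\<integral>\<^sup>+ x. ennreal (norm (f x)) \<partial>M)"

definition schwartz :: "(real \<Rightarrow> complex) \<Rightarrow> bool"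
  where "schwartz \<phi> \<longleftrightarrow>
    (\<exists>D :: nat \<Rightarrow> real \<Rightarrow> complex. D 0 = \<phi> \<and>
      (\<forall>i x. (D i has_vector_derivative D (Suc i) x) (at x)) \<and>
      (\<forall>i j. bounded (range (\<lambda>x. x ^ j *\<^sub>R D i x))))"

definition cutoff :: "real \<Rightarrow> (real \<Rightarrow> complex) \<Rightarrow> real \<Rightarrow> 'v::real_normed_vector \<Rightarrow> complex \<Rightarrow> complex"
  where "cutoff m \<phi> \<epsilon> \<xi> z = \<phi> (\<epsilon> * param_abs m \<xi> z)"

text \<open>For a parabolic symbol, a Schwartz function \<open>\<phi>\<close>, \<open>\<epsilon> > 0\<close> and admissible \<open>z\<close> the series
  converges absolutely, so the unordered sum is never the default value of a divergent one.\<close>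

definition regularized_kernel :: "real \<Rightarrow> (int ^ 'n::finite \<Rightarrow> 'e::complex_banach lop) \<Rightarrow> (real \<Rightarrow> complex) \<Rightarrow>
    real \<Rightarrow> real ^ 'n \<Rightarrow> complex \<Rightarrow> 'e lop"
  where "regularized_kernel m a \<phi> \<epsilon> \<eta> z =
    (\<Sum>\<^sub>\<infinity>k. (exp (\<i> * complex_of_real (rvec k \<bullet> \<eta>)) * cutoff m \<phi> \<epsilon> (rvec k) z)
      *\<^sub>C lop_inv (a k + z *\<^sub>C lop_id))"

definition pointwise_estimate ::
    "real \<Rightarrow> real \<Rightarrow> real \<Rightarrow> (real ^ 'n::finite \<Rightarrow> complex \<Rightarrow> 'e::complex_banach lop) \<Rightarrow> bool"
  where "pointwise_estimate m R C K \<longleftrightarrow>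
    (let \<theta>\<^sub>0 = min m 1 / 2; \<theta>\<^sub>1 = 1 - \<theta>\<^sub>0 in
      \<forall>\<eta>\<in>torus - {0}. \<forall>z\<in>sector (pi / 2) R.
        let \<mu> = cmod z powr (1 / m) in
          cmod z * norm (K \<eta> z) \<le>
            C * ((\<mu> powr \<theta>\<^sub>0 * norm \<eta> powr \<theta>\<^sub>0 + \<mu> powr \<theta>\<^sub>1 * norm \<eta> powr \<theta>\<^sub>1)
              / (norm \<eta> ^ CARD('n) * (1 + \<mu> * norm \<eta>))))"

text \<open>The measurability conjunct, together with finiteness of the extended-valued norm, says that
  \<open>K(\<cdot>, z)\<close> is an element of \<open>L\<^sup>1(T\<^sup>n, L(E))\<close>.\<close>

definition L1_estimate ::
    "real \<Rightarrow> real \<Rightarrow> (real ^ 'n::finite \<Rightarrow> complex \<Rightarrow> 'e::complex_banach lop) \<Rightarrow> bool"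
  where "L1_estimate R C K \<longleftrightarrow>
    (\<forall>z\<in>sector (pi / 2) R.
      strongly_measurable torus_measure (\<lambda>\<eta>. K \<eta> z) \<and>
      ennreal (cmod z) * L1_norm torus_measure (\<lambda>\<eta>. K \<eta> z) \<le> ennreal C)"

end

theory Submission
  imports Defs
begin

text \<open>Write \<open>n\<close> for the dimension, \<open>\<mu> = |z| powr (1/m)\<close> and \<open>s = \<mu>|\<eta>|\<close>. The regularised kernel is
the trigonometric series with the coefficients \<open>p = \<chi> (a + z)\<inverse>\<close>. Multiplying such a series by
\<open>(exp (-i \<eta>\<^sub>j) - 1) ^ N\<close> replaces \<open>p\<close> by its \<open>N\<close>-th difference in direction \<open>j\<close>
(\<open>torus_series_diff_op_funpow\<close>). If \<open>j\<close> is the direction in which \<open>|\<eta>\<^sub>j|\<close> is largest, then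
\<open>|exp (-i \<eta>\<^sub>j) - 1| \<ge> |\<eta>| / (2n)\<close>. Hence pure differences in one direction, of the orders \<open>n\<close> and
\<open>n + 1\<close>, suffice for everything.

With \<open>r = \<langle>k\<rangle>/\<mu>\<close> and \<open>2\<theta> = min m 1\<close>, these differences satisfy
\<open>|z| |\<Delta>\<^sub>j\<^sup>N p(k)| \<le> C \<langle>k\<rangle> powr (-N) min (r powr 2\<theta>) (r powr -2\<theta>)\<close> uniformly in \<open>\<epsilon>\<close>
(\<open>kernel_symbol_diff_bound\<close>). The reason is the identity
\<open>\<Delta>\<^sub>j b = - b(\<cdot> + e\<^sub>j) (\<Delta>\<^sub>j a) b\<close> for \<open>b = (a + z)\<inverse>\<close>: once a difference has been taken, \<open>a\<close>
contributes \<open>\<langle>k\<rangle> powr m\<close> and the two inverses contribute \<open>\<langle>k,z\<rangle> powr -2m\<close>, which together with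
\<open>|z| = \<mu> powr m\<close> is decay on both sides of \<open>\<langle>k\<rangle> = \<mu>\<close>. Each difference of the cut-off function gains a
factor \<open>\<langle>k,z\<rangle>\<inverse>\<close>, uniformly in \<open>\<epsilon>\<close> (\<open>cutoff_mixed\<close>).

Summing this bound for \<open>N = n\<close> yields only \<open>|\<eta>| powr -n\<close>, which is not integrable. The missing gain in
\<open>s\<close> comes from a cancellation: the series of \<open>\<Delta>\<^sub>j\<^sup>N p\<close> vanishes at \<open>\<eta> = 0\<close>, so each character may be
replaced by its difference to \<open>1\<close>, which is at most \<open>2 (|k||\<eta>|) powr \<tau>\<close> for every \<open>\<tau>\<close> in
\<open>[0, 1]\<close>. With \<open>\<tau> = \<theta>\<close> for \<open>N = n\<close> and \<open>\<tau> = 1 - \<theta>\<close> for \<open>N = n + 1\<close> the factor \<open>\<langle>k\<rangle> powr \<tau>\<close>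
is absorbed by the two-sided decay in \<open>r\<close>, and one obtains that \<open>|z| |\<eta>|\<^sup>n |K|\<close> is bounded by
\<open>C s powr \<theta>\<close> and by \<open>C s powr -\<theta>\<close>; together these bounds are the pointwise estimate
(\<open>kernel_bound\<close>).

The sum over the lattice and the integral of the pointwise bound over the torus are two instances of one dyadic
estimate (\<open>nn_integral_dyadic_le\<close>), which only uses that the ball of radius \<open>\<rho>\<close> has measure at most
\<open>C \<rho>\<^sup>n\<close> and is uniform in the scale \<open>\<mu>\<close>. This gives the \<open>L\<^sup>1\<close> estimate with a constant independent of
\<open>z\<close>.

Finally, the bound for \<open>N = n + 1\<close> is a summable majorant independent of \<open>\<epsilon>\<close>, so the series of
\<open>\<Delta>\<^sub>j\<^sup>N p\<close>, and hence the kernels, converge for every \<open>\<eta> \<noteq> 0\<close> by dominated convergence. The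
regularised kernels are jointly continuous, so they have separable range; their pointwise limit inherits
separability, and therefore it is strongly measurable even though \<open>L(E)\<close> need not be separable.\<close>

section \<open>The algebra of bounded operators\<close>

lift_definition lop_comp :: "'e::complex_banach lop \<Rightarrow> 'e lop \<Rightarrow> 'e lop"
  is "\<lambda>S T. S o\<^sub>L T"
  by simp

lemma lop_apply_comp [simp]: "lop_apply (lop_comp S T) x = lop_apply S (lop_apply T x)"
  by transfer simp

lemma lop_apply_diff: "lop_apply (S - T) x = lop_apply S x - lop_apply T x"
  by (simp add: lop_apply.rep_eq minus_lop.rep_eq blinfun.diff_left)

lemma bounded_linear_lop_apply: "bounded_linear (lop_apply T)"
  by transfer (rule blinfun.bounded_linear_right)

lemma norm_lop_comp: "norm (lop_comp S T) \<le> norm S * norm T"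
  by transfer (rule norm_blinfun_compose)

lemma bounded_bilinear_lop_comp: "bounded_bilinear lop_comp"
proof
  fix S S' T T' :: "'e::complex_banach lop" and r :: real
  note lin = linear_simps[OF bounded_linear_lop_apply]
  show "lop_comp (S + S') T = lop_comp S T + lop_comp S' T"
    and "lop_comp S (T + T') = lop_comp S T + lop_comp S T'"
    and "lop_comp (r *\<^sub>R S) T = r *\<^sub>R lop_comp S T"
    and "lop_comp S (r *\<^sub>R T) = r *\<^sub>R lop_comp S T"
    by (rule lop_eqI; simp add: lop_apply_add lop_apply_scaleR lin)+
  show "\<exists>K. \<forall>(S::'e lop) T. norm (lop_comp S T) \<le> norm S * norm T * K"
    by (rule exI[of _ 1]) (simp add: norm_lop_comp)
qed

lemma bounded_bilinear_scaleC:
  "bounded_bilinear ((*\<^sub>C) :: complex \<Rightarrow> 'v::complex_normed_vector \<Rightarrow> 'v)"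
proof
  fix c d :: complex and x y :: 'v and r :: real
  show "(c + d) *\<^sub>C x = c *\<^sub>C x + d *\<^sub>C x" by (rule scaleC_add_left)
  show "c *\<^sub>C (x + y) = c *\<^sub>C x + c *\<^sub>C y" by (rule scaleC_add_right)
  show "(r *\<^sub>R c) *\<^sub>C x = r *\<^sub>R c *\<^sub>C x"
    by (simp add: scaleR_conv_of_real flip: scaleC_scaleC scaleC_of_real)
  show "c *\<^sub>C r *\<^sub>R x = r *\<^sub>R c *\<^sub>C x" by (simp add: scaleC_simps)
  show "\<exists>K. \<forall>c (x::'v). norm (c *\<^sub>C x) \<le> cmod c * norm x * K"
    by (rule exI[of _ 1]) (simp add: norm_scaleC)
qed

lemma lop_inv_left:
  assumes "lop_invertible T"
  shows "lop_apply (lop_inv T) (lop_apply T x) = x"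
  using assms by (simp add: lop_apply_inv lop_invertible_def bij_is_inj)

lemma lop_inv_right:
  assumes "lop_invertible T"
  shows "lop_apply T (lop_apply (lop_inv T) x) = x"
  using assms by (simp add: lop_apply_inv lop_invertible_def bij_is_surj surj_f_inv_f)

text \<open>The order of the factors is chosen so that \<open>S = A(k + e\<^sub>j)\<close> and \<open>T = A(k)\<close> express the difference of an
inverse through the difference of \<open>A\<close>.\<close>

lemma resolvent_identity:
  assumes "lop_invertible S" and "lop_invertible T"
  shows "lop_inv S - lop_inv T = - lop_comp (lop_comp (lop_inv S) (S - T)) (lop_inv T)"
proof -
  have "lop_comp (lop_comp (lop_inv S) (S - T)) (lop_inv T) = lop_inv T - lop_inv S"
    by (rule lop_eqI)
      (simp add: lop_apply_diff linear_simps[OF bounded_linear_lop_apply]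
        lop_inv_left[OF assms(1)] lop_inv_right[OF assms(2)])
  then show ?thesis by simp
qed


section \<open>Brackets\<close>

lemma bracket_sqrt: "bracket x = sqrt (1 + (norm x)\<^sup>2)"
  unfolding bracket_def by (rule powr_half_sqrt) simp

lemma param_bracket_sqrt: "param_bracket m x z = sqrt (1 + (norm x)\<^sup>2 + (cmod z powr (1 / m))\<^sup>2)"
proof -
  have "cmod z powr (2 / m) = (cmod z powr (1 / m))\<^sup>2"
    by (simp add: power2_eq_square flip: powr_add)
  then show ?thesis
    unfolding param_bracket_def by (simp add: powr_half_sqrt)
qed

lemma param_abs_sqrt: "param_abs m x z = sqrt ((norm x)\<^sup>2 + (cmod z powr (1 / m))\<^sup>2)"
proof -
  have "cmod z powr (2 / m) = (cmod z powr (1 / m))\<^sup>2"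
    by (simp add: power2_eq_square flip: powr_add)
  then show ?thesis
    unfolding param_abs_def by (simp add: powr_half_sqrt)
qed

lemma bracket_ge_1: "1 \<le> bracket x"
  by (simp add: bracket_sqrt)

lemma bracket_pos: "0 < bracket x"
  using bracket_ge_1[of x] by simp

lemma norm_le_bracket: "norm x \<le> bracket x"
  by (simp add: bracket_sqrt real_le_rsqrt)

lemma bracket_le_param_bracket: "bracket x \<le> param_bracket m x z"
  by (simp add: bracket_sqrt param_bracket_sqrt)

lemma param_bracket_ge_1: "1 \<le> param_bracket m x z"
  using bracket_le_param_bracket[of x m z] bracket_ge_1[of x] by simp

lemma param_bracket_pos: "0 < param_bracket m x z"
  using param_bracket_ge_1[of m x z] by simp

lemma cmod_powr_le_param_bracket: "cmod z powr (1 / m) \<le> param_bracket m x z"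
  unfolding param_bracket_sqrt by (rule real_le_rsqrt) simp

lemma cmod_powr_le_param_abs: "cmod z powr (1 / m) \<le> param_abs m x z"
  unfolding param_abs_sqrt by (rule real_le_rsqrt) simp

text \<open>The bracket with parameter is the plain bracket of a longer vector, so that both share one shift inequality.\<close>

lemma param_bracket_eq_bracket: "param_bracket m x z = bracket (x, cmod z powr (1 / m))"
  by (simp add: bracket_sqrt param_bracket_sqrt norm_Pair real_sqrt_pow2)

text \<open>The brackets vary slowly: a shift by one lattice step changes them, and hence all their powers, only by a bounded
factor. This is what makes the shifts in the discrete product rule harmless.\<close>

lemma bracket_shift:
  assumes "norm (x - y) \<le> 1"
  shows "bracket x \<le> 2 * bracket y"
proof -
  have "norm x \<le> norm y + 1"
    using norm_triangle_ineq2[of x y] assms by linarith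
  then have "1 + (norm x)\<^sup>2 \<le> 1 + (norm y + 1)\<^sup>2"
    by (intro add_left_mono power_mono) auto
  also have "\<dots> \<le> 1 + (norm y + 1)\<^sup>2 + ((norm y - 1)\<^sup>2 + (1 + 2 * (norm y)\<^sup>2))"
    by (rule add_increasing2[OF _ order_refl]) (intro add_nonneg_nonneg; simp)
  also have "\<dots> = 2\<^sup>2 * (1 + (norm y)\<^sup>2)"
    by (simp add: power2_eq_square algebra_simps)
  finally have "1 + (norm x)\<^sup>2 \<le> 2\<^sup>2 * (1 + (norm y)\<^sup>2)" .
  then have "sqrt (1 + (norm x)\<^sup>2) \<le> sqrt (2\<^sup>2 * (1 + (norm y)\<^sup>2))"
    by (rule real_sqrt_le_mono)
  also have "\<dots> = 2 * sqrt (1 + (norm y)\<^sup>2)"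
    by (simp only: real_sqrt_mult real_sqrt_abs)
  finally show ?thesis by (simp only: bracket_sqrt)
qed

lemma powr_comparable:
  fixes x y c s :: real
  assumes "0 < x" "0 < y" "1 \<le> c" "x \<le> c * y" "y \<le> c * x"
  shows "x powr s \<le> c powr \<bar>s\<bar> * y powr s"
proof (cases "0 \<le> s")
  case True
  then have "x powr s \<le> (c * y) powr s" using assms by (intro powr_mono2) auto
  with True assms show ?thesis by (simp add: powr_mult)
next
  case False
  have "x powr s \<le> (y / c) powr s"
    using assms False by (intro powr_mono2') (auto simp: field_simps)
  also have "\<dots> = c powr \<bar>s\<bar> * y powr s"
    using assms False by (simp add: powr_divide powr_minus field_simps)
  finally show ?thesis .
qed

lemma rvec_add: "rvec (k + l) = rvec k + rvec l"
  by (simp add: rvec_def vec_eq_iff)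

lemma rvec_axis: "rvec (axis j 1) = axis j 1"
  by (simp add: rvec_def vec_eq_iff axis_def)

lemma norm_rvec_axis: "norm (rvec (axis j 1)) = 1"
  by (simp add: rvec_axis norm_axis_1)


section \<open>Mixed symbol classes\<close>

lemma diff_op_funpow_add:
  fixes f g :: "int ^ 'n::finite \<Rightarrow> 'v::ab_group_add"
  shows "(diff_op j ^^ N) (\<lambda>k. f k + g k) = (\<lambda>k. (diff_op j ^^ N) f k + (diff_op j ^^ N) g k)"
proof (induction N arbitrary: f g)
  case (Suc N)
  have "diff_op j (\<lambda>k. f k + g k) = (\<lambda>k. diff_op j f k + diff_op j g k)"
    by (simp add: diff_op_def fun_eq_iff)
  then show ?case by (simp add: funpow_Suc_right Suc.IH del: funpow.simps)
qed simp

lemma diff_op_funpow_uminus: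
  fixes f :: "int ^ 'n::finite \<Rightarrow> 'v::ab_group_add"
  shows "(diff_op j ^^ N) (\<lambda>k. - f k) = (\<lambda>k. - (diff_op j ^^ N) f k)"
proof (induction N arbitrary: f)
  case (Suc N)
  have "diff_op j (\<lambda>k. - f k) = (\<lambda>k. - diff_op j f k)"
    by (simp add: diff_op_def fun_eq_iff)
  then show ?case by (simp add: funpow_Suc_right Suc.IH del: funpow.simps)
qed simp

lemma diff_op_funpow_shift:
  fixes f :: "int ^ 'n::finite \<Rightarrow> 'v::ab_group_add"
  shows "(diff_op j ^^ N) (\<lambda>k. f (k + l)) = (\<lambda>k. (diff_op j ^^ N) f (k + l))"
proof (induction N arbitrary: f)
  case (Suc N)
  have "diff_op j (\<lambda>k. f (k + l)) = (\<lambda>k. diff_op j f (k + l))"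
    by (simp add: diff_op_def fun_eq_iff algebra_simps)
  then show ?case by (simp add: funpow_Suc_right Suc.IH del: funpow.simps)
qed simp

text \<open>The discrete product rule has one shifted factor; all differences of products and of inverses below are obtained by
iterating it.\<close>

lemma diff_op_product:
  assumes "bounded_bilinear bp"
  shows "diff_op j (\<lambda>k. bp (f k) (g k)) =
    (\<lambda>k. bp (f (k + axis j 1)) (diff_op j g k) + bp (diff_op j f k) (g k))"
  by (simp add: diff_op_def fun_eq_iff bounded_bilinear.diff_left[OF assms]
      bounded_bilinear.diff_right[OF assms])

definition mixed_weight :: "real \<Rightarrow> complex \<Rightarrow> real \<Rightarrow> real \<Rightarrow> int ^ 'n::finite \<Rightarrow> real"
  where "mixed_weight m z s t k = bracket (rvec k) powr s * param_bracket m (rvec k) z powr t"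

text \<open>A symbol of order \<open>(s, t)\<close> behaves like \<open>\<langle>k\<rangle> powr s * \<langle>k,z\<rangle> powr t\<close>, and each difference in
direction \<open>j\<close> gains a factor \<open>\<langle>k\<rangle>\<inverse>\<close>. Keeping the two exponents apart is necessary because for small
\<open>m\<close> the difference of \<open>a\<close> has the negative order \<open>m - 1\<close> in \<open>\<langle>k\<rangle>\<close>, which cannot be traded for
\<open>\<langle>k,z\<rangle>\<close>. The constant is a parameter, since all bounds have to be uniform in \<open>z\<close> and \<open>\<epsilon>\<close>.\<close>

definition mixed_symbol :: "real \<Rightarrow> complex \<Rightarrow> 'n \<Rightarrow> nat \<Rightarrow> real \<Rightarrow> real \<Rightarrow> real \<Rightarrow>
    (int ^ 'n::finite \<Rightarrow> 'v::real_normed_vector) \<Rightarrow> bool"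
  where "mixed_symbol m z j L C s t f \<longleftrightarrow>
    (\<forall>i\<le>L. \<forall>k. norm ((diff_op j ^^ i) f k) \<le> C * mixed_weight m z (s - real i) t k)"

lemma mixed_weight_pos: "0 < mixed_weight m z s t k"
  by (simp add: mixed_weight_def bracket_pos param_bracket_pos less_imp_neq[THEN not_sym])

lemma mixed_weight_mult:
  "mixed_weight m z s t k * mixed_weight m z s' t' k = mixed_weight m z (s + s') (t + t') k"
  by (simp add: mixed_weight_def powr_add)

lemma mixed_weight_shift:
  "mixed_weight m z s t (k + axis j 1) \<le> 2 powr (\<bar>s\<bar> + \<bar>t\<bar>) * mixed_weight m z s t k"
proof -
  let ?x = "rvec k" and ?y = "rvec (k + axis j 1)" and ?\<mu> = "cmod z powr (1 / m)"
  have d: "norm (?x - ?y) \<le> 1" "norm (?y - ?x) \<le> 1"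
    by (simp_all add: rvec_add norm_rvec_axis)
  then have d': "norm ((?x, ?\<mu>) - (?y, ?\<mu>)) \<le> 1" "norm ((?y, ?\<mu>) - (?x, ?\<mu>)) \<le> 1"
    by (simp_all add: norm_Pair)
  have "bracket ?y powr s \<le> 2 powr \<bar>s\<bar> * bracket ?x powr s"
    by (intro powr_comparable bracket_pos bracket_shift d) simp
  moreover have "param_bracket m ?y z powr t \<le> 2 powr \<bar>t\<bar> * param_bracket m ?x z powr t"
    unfolding param_bracket_eq_bracket
    by (intro powr_comparable bracket_pos bracket_shift d') simp
  ultimately have "mixed_weight m z s t (k + axis j 1)
      \<le> (2 powr \<bar>s\<bar> * bracket ?x powr s) * (2 powr \<bar>t\<bar> * param_bracket m ?x z powr t)"
    unfolding mixed_weight_def by (intro mult_mono) auto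
  then show ?thesis by (simp add: mixed_weight_def powr_add mult_ac)
qed

text \<open>Since \<open>\<langle>k\<rangle> \<le> \<langle>k,z\<rangle>\<close>, decay in \<open>\<langle>k,z\<rangle>\<close> may be exchanged for decay in \<open>\<langle>k\<rangle>\<close>, but not
conversely.\<close>

lemma mixed_weight_mono:
  assumes "0 \<le> u"
  shows "mixed_weight m z (s + u) (t - u) k \<le> mixed_weight m z s t k"
proof -
  have "bracket (rvec k) powr u \<le> param_bracket m (rvec k) z powr u"
    using assms bracket_pos[of "rvec k"]
    by (intro powr_mono2 bracket_le_param_bracket) auto
  then have "mixed_weight m z (s + u) (t - u) k
      \<le> bracket (rvec k) powr s * param_bracket m (rvec k) z powr u * param_bracket m (rvec k) z powr (t - u)"
    unfolding mixed_weight_def powr_add by (intro mult_right_mono mult_left_mono) auto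
  also have "\<dots> = mixed_weight m z s t k"
    by (simp add: mixed_weight_def mult.assoc flip: powr_add)
  finally show ?thesis .
qed

lemma mixed_symbol_norm_le:
  assumes "mixed_symbol m z j L C s t f"
  shows "norm (f k) \<le> C * mixed_weight m z s t k"
proof -
  have "norm ((diff_op j ^^ 0) f k) \<le> C * mixed_weight m z (s - real 0) t k"
    using assms unfolding mixed_symbol_def by blast
  then show ?thesis by simp
qed

lemma mixed_symbol_const_nonneg:
  fixes f :: "int ^ 'n::finite \<Rightarrow> 'v::real_normed_vector"
  assumes "mixed_symbol m z j L C s t f"
  shows "0 \<le> C"
proof -
  have "0 \<le> C * mixed_weight m z s t (0 :: int ^ 'n)"
    using order_trans[OF norm_ge_zero mixed_symbol_norm_le[OF assms, of 0]] .
  then show ?thesis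
    using mixed_weight_pos[of m z s t "0 :: int ^ 'n"] by (simp add: zero_le_mult_iff)
qed

lemma mixed_symbol_le_order:
  assumes "mixed_symbol m z j L C s t f" and "L' \<le> L"
  shows "mixed_symbol m z j L' C s t f"
  using assms by (simp add: mixed_symbol_def)

lemma mixed_symbol_weaken:
  assumes "mixed_symbol m z j L C s t f" and "s' \<le> s" and "s' + t' = s + t"
  shows "mixed_symbol m z j L C s' t' f"
  unfolding mixed_symbol_def
proof (intro allI impI)
  fix i k assume "i \<le> L"
  then have "norm ((diff_op j ^^ i) f k) \<le> C * mixed_weight m z (s - real i) t k"
    using assms(1) by (simp add: mixed_symbol_def)
  also have "\<dots> \<le> C * mixed_weight m z (s' - real i) t' k"
    using mixed_weight_mono[of "s - s'" m z "s' - real i" t' k] assms(2,3)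
    by (intro mult_left_mono mixed_symbol_const_nonneg[OF assms(1)]) (simp add: algebra_simps)
  finally show "norm ((diff_op j ^^ i) f k) \<le> C * mixed_weight m z (s' - real i) t' k" .
qed

lemma mixed_symbol_const_mono:
  assumes "mixed_symbol m z j L C s t f" and "C \<le> C'"
  shows "mixed_symbol m z j L C' s t f"
  unfolding mixed_symbol_def
proof (intro allI impI)
  fix i k assume "i \<le> L"
  then have "norm ((diff_op j ^^ i) f k) \<le> C * mixed_weight m z (s - real i) t k"
    using assms(1) by (simp add: mixed_symbol_def)
  also have "\<dots> \<le> C' * mixed_weight m z (s - real i) t k"
    by (intro mult_right_mono assms(2) less_imp_le[OF mixed_weight_pos])
  finally show "norm ((diff_op j ^^ i) f k) \<le> C' * mixed_weight m z (s - real i) t k" .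
qed

lemma mixed_symbol_add:
  assumes "mixed_symbol m z j L C s t f" and "mixed_symbol m z j L C' s t g"
  shows "mixed_symbol m z j L (C + C') s t (\<lambda>k. f k + g k)"
  unfolding mixed_symbol_def diff_op_funpow_add
  using assms by (auto simp: mixed_symbol_def distrib_right intro!: norm_triangle_le add_mono)

lemma mixed_symbol_uminus:
  assumes "mixed_symbol m z j L C s t f"
  shows "mixed_symbol m z j L C s t (\<lambda>k. - f k)"
  using assms by (simp add: mixed_symbol_def diff_op_funpow_uminus)

lemma mixed_symbol_diff_op:
  assumes "mixed_symbol m z j (Suc L) C s t f"
  shows "mixed_symbol m z j L C (s - 1) t (diff_op j f)"
  unfolding mixed_symbol_def
proof (intro allI impI)
  fix i k assume "i \<le> L"
  then have "norm ((diff_op j ^^ Suc i) f k) \<le> C * mixed_weight m z (s - real (Suc i)) t k"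
    using assms unfolding mixed_symbol_def by (metis Suc_le_mono)
  then show "norm ((diff_op j ^^ i) (diff_op j f) k) \<le> C * mixed_weight m z (s - 1 - real i) t k"
    by (simp add: funpow_Suc_right algebra_simps del: funpow.simps)
qed

lemma mixed_symbol_SucI:
  assumes "\<And>k. norm (f k) \<le> C * mixed_weight m z s t k"
    and "mixed_symbol m z j L C (s - 1) t (diff_op j f)"
  shows "mixed_symbol m z j (Suc L) C s t f"
  unfolding mixed_symbol_def
proof (intro allI impI)
  fix i k assume i: "i \<le> Suc L"
  show "norm ((diff_op j ^^ i) f k) \<le> C * mixed_weight m z (s - real i) t k"
  proof (cases i)
    case 0
    then show ?thesis using assms(1) by simp
  next
    case (Suc l)
    with i assms(2) have "norm ((diff_op j ^^ l) (diff_op j f) k) \<le> C * mixed_weight m z (s - 1 - real l) t k"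
      by (simp add: mixed_symbol_def)
    with Suc show ?thesis
      by (simp add: funpow_Suc_right algebra_simps del: funpow.simps)
  qed
qed

lemma mixed_symbol_shift:
  assumes "mixed_symbol m z j L C s t f" and c: "2 powr (\<bar>s\<bar> + real L + \<bar>t\<bar>) \<le> c"
  shows "mixed_symbol m z j L (c * C) s t (\<lambda>k. f (k + axis j 1))"
  unfolding mixed_symbol_def diff_op_funpow_shift
proof (intro allI impI)
  fix i and k :: "int ^ 'a" assume i: "i \<le> L"
  note C = mixed_symbol_const_nonneg[OF assms(1)]
  have "norm ((diff_op j ^^ i) f (k + axis j 1)) \<le> C * mixed_weight m z (s - real i) t (k + axis j 1)"
    using assms(1) i by (simp add: mixed_symbol_def)
  also have "\<dots> \<le> C * (2 powr (\<bar>s - real i\<bar> + \<bar>t\<bar>) * mixed_weight m z (s - real i) t k)"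
    by (intro mult_left_mono mixed_weight_shift C)
  also have "\<dots> \<le> C * (c * mixed_weight m z (s - real i) t k)"
  proof (intro mult_left_mono mult_right_mono C less_imp_le[OF mixed_weight_pos])
    have "2 powr (\<bar>s - real i\<bar> + \<bar>t\<bar>) \<le> (2::real) powr (\<bar>s\<bar> + real L + \<bar>t\<bar>)"
      using i by (intro powr_mono) auto
    then show "2 powr (\<bar>s - real i\<bar> + \<bar>t\<bar>) \<le> c" using c by (rule order_trans)
  qed
  finally show "norm ((diff_op j ^^ i) f (k + axis j 1)) \<le> c * C * mixed_weight m z (s - real i) t k"
    by (simp add: mult_ac)
qed

text \<open>Orders add under products. The induction applies the product rule once and then the hypothesis to the two resulting
products of differences of lower order; the hypothesis on \<open>c\<close> is stable under this step because passing from
\<open>f\<close> to its difference lowers \<open>L\<close> by one and changes \<open>s\<close> by one.\<close>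

lemma mixed_symbol_product:
  fixes bp :: "'u::real_normed_vector \<Rightarrow> 'v::real_normed_vector \<Rightarrow> 'w::real_normed_vector"
  assumes bp: "bounded_bilinear bp" and norm_prod: "\<And>x y. norm (bp x y) \<le> norm x * norm y"
    and "mixed_symbol m z j L C s t f" and "mixed_symbol m z j L C' s' t' g"
    and "2 powr (\<bar>s\<bar> + real L + \<bar>t\<bar>) \<le> c"
  shows "mixed_symbol m z j L ((2 * c) ^ L * (C * C')) (s + s') (t + t') (\<lambda>k. bp (f k) (g k))"
  using assms(3-)
proof (induction L arbitrary: C s f C' s' g)
  case 0
  have "norm (bp (f k) (g k)) \<le> C * C' * mixed_weight m z (s + s') (t + t') k" for k
  proof -
    have "norm (bp (f k) (g k)) \<le> norm (f k) * norm (g k)" by (rule norm_prod)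
    also have "\<dots> \<le> (C * mixed_weight m z s t k) * (C' * mixed_weight m z s' t' k)"
      using mixed_symbol_const_nonneg[OF 0(1)] mixed_symbol_const_nonneg[OF 0(2)]
      by (intro mult_mono mult_nonneg_nonneg less_imp_le[OF mixed_weight_pos] norm_ge_zero
          mixed_symbol_norm_le[OF 0(1)] mixed_symbol_norm_le[OF 0(2)])
    also have "\<dots> = C * C' * (mixed_weight m z s t k * mixed_weight m z s' t' k)" by simp
    finally show ?thesis by (simp add: mixed_weight_mult)
  qed
  then show ?case by (simp add: mixed_symbol_def)
next
  case (Suc L)
  note f = Suc.prems(1) and g = Suc.prems(2) and c = Suc.prems(3)
  note C = mixed_symbol_const_nonneg[OF f] and C' = mixed_symbol_const_nonneg[OF g]
  have c1: "1 \<le> c" using c ge_one_powr_ge_zero[of 2 "\<bar>s\<bar> + real (Suc L) + \<bar>t\<bar>"] by simp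
  have c': "2 powr (\<bar>s\<bar> + real L + \<bar>t\<bar>) \<le> c"
    by (rule order_trans[OF powr_mono c]) auto
  have c'': "2 powr (\<bar>s - 1\<bar> + real L + \<bar>t\<bar>) \<le> c"
    by (rule order_trans[OF powr_mono c]) auto
  let ?D = "(2 * c) ^ L"
  have "mixed_symbol m z j L (c * C) s t (\<lambda>k. f (k + axis j 1))"
    by (intro mixed_symbol_shift c' mixed_symbol_le_order[OF f]) simp
  from Suc.IH[OF this mixed_symbol_diff_op[OF g] c']
  have 1: "mixed_symbol m z j L (?D * (c * C * C')) (s + s' - 1) (t + t')
      (\<lambda>k. bp (f (k + axis j 1)) (diff_op j g k))"
    by (simp add: algebra_simps)
  from Suc.IH[OF mixed_symbol_diff_op[OF f] mixed_symbol_le_order[OF g] c'']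
  have 2: "mixed_symbol m z j L (?D * (C * C')) (s + s' - 1) (t + t')
      (\<lambda>k. bp (diff_op j f k) (g k))"
    by (simp add: algebra_simps)
  have "C * C' \<le> c * (C * C')" 
    using c1 C C' mult_right_mono[OF c1, of "C * C'"] by simp
  moreover have "0 \<le> ?D" using c1 by simp
  ultimately have "?D * (c * C * C') + ?D * (C * C') \<le> ?D * (c * (C * C')) + ?D * (c * (C * C'))"
    by (intro add_mono mult_left_mono) auto
  also have "\<dots> = (2 * c) ^ Suc L * (C * C')" by simp
  finally have "mixed_symbol m z j L ((2 * c) ^ Suc L * (C * C')) (s + s' - 1) (t + t')
      (diff_op j (\<lambda>k. bp (f k) (g k)))"
    unfolding diff_op_product[OF bp]
    by (rule mixed_symbol_const_mono[OF mixed_symbol_add[OF 1 2]])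
  moreover have "norm (bp (f k) (g k)) \<le> (2 * c) ^ Suc L * (C * C') * mixed_weight m z (s + s') (t + t') k" for k
  proof -
    have "norm (bp (f k) (g k)) \<le> norm (f k) * norm (g k)" by (rule norm_prod)
    also have "\<dots> \<le> (C * mixed_weight m z s t k) * (C' * mixed_weight m z s' t' k)"
      by (intro mult_mono mult_nonneg_nonneg C C' less_imp_le[OF mixed_weight_pos] norm_ge_zero
          mixed_symbol_norm_le[OF f] mixed_symbol_norm_le[OF g])
    also have "\<dots> = 1 * (C * C') * (mixed_weight m z s t k * mixed_weight m z s' t' k)" by simp
    also have "\<dots> \<le> (2 * c) ^ Suc L * (C * C') * (mixed_weight m z s t k * mixed_weight m z s' t' k)"
      using c1 C C' by (intro mult_right_mono one_le_power mult_nonneg_nonneg less_imp_le[OF mixed_weight_pos]) auto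
    finally show ?thesis by (simp add: mixed_weight_mult)
  qed
  ultimately show ?case by (intro mixed_symbol_SucI)
qed


section \<open>Resolvents of parabolic symbols\<close>

lemma sector_half_plane:
  assumes "z \<in> sector (pi / 2) R"
  shows "0 \<le> Re z"
  using assms by (simp add: sector_def flip: Arg_Re_nonneg)

text \<open>The properties of a single parabolic symbol that the estimates use. Differences are controlled in coordinate directions
only, up to the order \<open>n + 1\<close>.\<close>

locale parabolic_symbol =
  fixes m \<kappa> R M :: real and a :: "int ^ 'n::finite \<Rightarrow> 'e::complex_banach lop"
  assumes m_pos: "0 < m" and R_pos: "0 < R" and \<kappa>_nonneg: "0 \<le> \<kappa>"
    and invertible: "z \<in> sector (pi / 2) R \<Longrightarrow> lop_invertible (a k + z *\<^sub>C lop_id)"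
    and norm_inv_le: "z \<in> sector (pi / 2) R \<Longrightarrow>
      norm (lop_inv (a k + z *\<^sub>C lop_id)) \<le> \<kappa> * param_bracket m (rvec k) z powr (- m)"
    and norm_diff_le: "i \<le> CARD('n) + 1 \<Longrightarrow>
      norm ((diff_op j ^^ i) a k) \<le> M * bracket (rvec k) powr (m - real i)"
begin

abbreviation resolvent :: "complex \<Rightarrow> int ^ 'n \<Rightarrow> 'e lop"
  where "resolvent z k \<equiv> lop_inv (a k + z *\<^sub>C lop_id)"

lemma diff_op_resolvent:
  assumes "z \<in> sector (pi / 2) R"
  shows "diff_op j (resolvent z) =
    (\<lambda>k. - lop_comp (lop_comp (resolvent z (k + axis j 1)) (diff_op j a k)) (resolvent z k))"
  using resolvent_identity[OF invertible[OF assms] invertible[OF assms]]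
  by (simp add: diff_op_def fun_eq_iff)

lemma symbol_mixed: "mixed_symbol m z j (CARD('n) + 1) M m 0 a"
  using norm_diff_le by (simp add: mixed_symbol_def mixed_weight_def powr_zero_eq_one
      less_imp_neq[OF param_bracket_pos, THEN not_sym])

text \<open>The gain in the estimate of the resolvent: after one difference there are two inverses and one difference of the symbol,
hence the order \<open>(m - 1, -2m)\<close> instead of \<open>(-1, -m)\<close>.\<close>

lemma diff_resolvent_mixed_step:
  assumes "L \<le> CARD('n)"
    and "\<And>z j. z \<in> sector (pi / 2) R \<Longrightarrow> mixed_symbol m z j L C 0 (- m) (resolvent z)"
  shows "\<exists>C'. \<forall>z\<in>sector (pi / 2) R. \<forall>j.
    mixed_symbol m z j L C' (m - 1) (- 2 * m) (diff_op j (resolvent z))"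
proof -
  define c where "c = (2::real) powr (\<bar>0\<bar> + real L + \<bar>- m\<bar>)"
  define c' where "c' = (2::real) powr (\<bar>0 + (m - 1)\<bar> + real L + \<bar>- m + 0\<bar>)"
  have "mixed_symbol m z j L ((2 * c') ^ L * (((2 * c) ^ L * ((c * C) * M)) * C)) (m - 1) (- 2 * m)
      (diff_op j (resolvent z))" if z: "z \<in> sector (pi / 2) R" for z j
  proof -
    note b = assms(2)[OF z, of j]
    have a: "mixed_symbol m z j L M (m - 1) 0 (diff_op j a)"
      by (intro mixed_symbol_diff_op mixed_symbol_le_order[OF symbol_mixed]) (use assms(1) in simp)
    have "mixed_symbol m z j L (c * C) 0 (- m) (\<lambda>k. resolvent z (k + axis j 1))"
      by (intro mixed_symbol_shift b) (simp add: c_def)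
    from mixed_symbol_product[OF bounded_bilinear_lop_comp norm_lop_comp this a order_refl]
    have "mixed_symbol m z j L ((2 * c) ^ L * ((c * C) * M)) (0 + (m - 1)) (- m + 0)
      (\<lambda>k. lop_comp (resolvent z (k + axis j 1)) (diff_op j a k))"
      unfolding c_def .
    from mixed_symbol_product[OF bounded_bilinear_lop_comp norm_lop_comp this b order_refl]
    show ?thesis
      unfolding diff_op_resolvent[OF z] c'_def by (intro mixed_symbol_uminus) simp
  qed
  then show ?thesis by blast
qed

text \<open>Bounds of the resolvent up to the order \<open>L\<close> give, by the formula for its difference, bounds for the difference up
to the order \<open>L\<close>, and therefore bounds of the resolvent up to the order \<open>L + 1\<close>.\<close>

lemma resolvent_mixed_bound:
  assumes "L \<le> CARD('n) + 1"
  shows "\<exists>C. \<forall>z\<in>sector (pi / 2) R. \<forall>j. mixed_symbol m z j L C 0 (- m) (resolvent z)"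
  using assms
proof (induction L)
  case 0
  have "mixed_symbol m z j 0 \<kappa> 0 (- m) (resolvent z)" if "z \<in> sector (pi / 2) R" for z j
    using norm_inv_le[OF that]
    by (simp add: mixed_symbol_def mixed_weight_def powr_zero_eq_one less_imp_neq[OF bracket_pos, THEN not_sym])
  then show ?case by blast
next
  case (Suc L)
  then obtain C where C: "\<And>z j. z \<in> sector (pi / 2) R \<Longrightarrow> mixed_symbol m z j L C 0 (- m) (resolvent z)"
    by auto
  from diff_resolvent_mixed_step[OF _ this] Suc.prems obtain C' where
    C': "\<And>z j. z \<in> sector (pi / 2) R \<Longrightarrow>
      mixed_symbol m z j L C' (m - 1) (- 2 * m) (diff_op j (resolvent z))"
    by auto
  have "mixed_symbol m z j (Suc L) (max \<kappa> C') 0 (- m) (resolvent z)"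
    if z: "z \<in> sector (pi / 2) R" for z j
  proof (rule mixed_symbol_SucI)
    fix k
    have "norm (resolvent z k) \<le> \<kappa> * mixed_weight m z 0 (- m) k"
      using norm_inv_le[OF z]
      by (simp add: mixed_weight_def powr_zero_eq_one less_imp_neq[OF bracket_pos, THEN not_sym])
    also have "\<dots> \<le> max \<kappa> C' * mixed_weight m z 0 (- m) k"
      by (intro mult_right_mono less_imp_le[OF mixed_weight_pos]) simp
    finally show "norm (resolvent z k) \<le> max \<kappa> C' * mixed_weight m z 0 (- m) k" .
  next
    have "mixed_symbol m z j L C' (0 - 1) (- m) (diff_op j (resolvent z))"
      by (rule mixed_symbol_weaken[OF C'[OF z]]) (use m_pos in auto)
    then show "mixed_symbol m z j L (max \<kappa> C') (0 - 1) (- m) (diff_op j (resolvent z))"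
      by (rule mixed_symbol_const_mono) simp
  qed
  then show ?case by blast
qed

lemma diff_resolvent_mixed:
  "\<exists>C. \<forall>z\<in>sector (pi / 2) R. \<forall>j.
    mixed_symbol m z j (CARD('n)) C (m - 1) (- 2 * m) (diff_op j (resolvent z))"
proof -
  obtain C where "\<And>z j. z \<in> sector (pi / 2) R \<Longrightarrow>
      mixed_symbol m z j (CARD('n)) C 0 (- m) (resolvent z)"
    using resolvent_mixed_bound[of "CARD('n)"] by auto
  from diff_resolvent_mixed_step[OF order_refl this] show ?thesis .
qed

end


section \<open>Differences of the cut-off function\<close>

definition forward_diff :: "(real \<Rightarrow> complex) \<Rightarrow> real \<Rightarrow> complex"
  where "forward_diff f t = f (t + 1) - f t"

lemma forward_diff_funpow_add:
  "(forward_diff ^^ N) (\<lambda>t. f t + g t) = (\<lambda>t. (forward_diff ^^ N) f t + (forward_diff ^^ N) g t)"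
proof (induction N arbitrary: f g)
  case (Suc N)
  have "forward_diff (\<lambda>t. f t + g t) = (\<lambda>t. forward_diff f t + forward_diff g t)"
    by (simp add: forward_diff_def fun_eq_iff)
  then show ?case by (simp add: funpow_Suc_right Suc.IH del: funpow.simps)
qed simp

lemma forward_diff_funpow_scaleR:
  "(forward_diff ^^ N) (\<lambda>t. r *\<^sub>R f t) = (\<lambda>t. r *\<^sub>R (forward_diff ^^ N) f t)"
proof (induction N arbitrary: f)
  case (Suc N)
  have "forward_diff (\<lambda>t. r *\<^sub>R f t) = (\<lambda>t. r *\<^sub>R forward_diff f t)"
    by (simp add: forward_diff_def fun_eq_iff scaleR_diff_right)
  then show ?case by (simp add: funpow_Suc_right Suc.IH del: funpow.simps)
qed simp

lemma forward_diff_funpow_has_vector_derivative: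
  assumes "\<And>t. (f has_vector_derivative f' t) (at t)"
  shows "((forward_diff ^^ N) f has_vector_derivative (forward_diff ^^ N) f' t) (at t)"
  using assms
proof (induction N arbitrary: f f' t)
  case (Suc N)
  have "(forward_diff f has_vector_derivative forward_diff f' t) (at t)" for t
  proof -
    have "((\<lambda>t. t + 1) has_vector_derivative 1) (at t)"
      by (auto intro!: derivative_eq_intros)
    from vector_diff_chain_at[OF this Suc.prems]
    have "((\<lambda>t. f (t + 1)) has_vector_derivative f' (t + 1)) (at t)"
      by (simp add: o_def)
    from has_vector_derivative_diff[OF this Suc.prems]
    show ?thesis by (simp add: forward_diff_def[abs_def])
  qed
  from Suc.IH[OF this] show ?case
    by (simp add: funpow_Suc_right del: funpow.simps)
qed simp

lemma norm_forward_diff_le: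
  assumes "\<And>t. (f has_vector_derivative f' t) (at t)"
    and "\<And>s. t \<le> s \<Longrightarrow> s \<le> t + 1 \<Longrightarrow> norm (f' s) \<le> B"
  shows "norm (forward_diff f t) \<le> B"
proof -
  have "norm (f (t + 1) - f t) \<le> B * (t + 1) - B * t"
  proof (rule differentiable_bound_general)
    show "continuous_on {t..t + 1} f"
      by (rule continuous_at_imp_continuous_on) (use assms(1) has_vector_derivative_continuous in blast)
    show "((\<lambda>x. B * x) has_vector_derivative B) (at x)" for x
      by (auto intro!: derivative_eq_intros simp flip: has_real_derivative_iff_has_vector_derivative)
  qed (use assms in \<open>auto intro!: continuous_intros\<close>)
  then show ?thesis by (simp add: forward_diff_def algebra_simps)
qed

text \<open>Along a line in a coordinate direction the cut-off is a function of \<open>\<epsilon> sqrt (c + t\<^sup>2)\<close>, where \<open>c\<close> collects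
the other coordinates and the spectral parameter. Its derivatives are linear combinations of terms of the following
form, in which \<open>D p\<close> is the \<open>p\<close>-th derivative of the Schwartz function; this family is closed under
differentiation.\<close>

definition cutoff_term ::
    "(nat \<Rightarrow> real \<Rightarrow> complex) \<Rightarrow> nat \<Rightarrow> nat \<Rightarrow> nat \<Rightarrow> real \<Rightarrow> real \<Rightarrow> real \<Rightarrow> complex"
  where "cutoff_term D p q r \<epsilon> c t =
    (\<epsilon> ^ p * t ^ q / sqrt (c + t\<^sup>2) ^ r) *\<^sub>R D p (\<epsilon> * sqrt (c + t\<^sup>2))"

lemma cutoff_term_has_vector_derivative:
  assumes D: "\<And>i x. (D i has_vector_derivative D (Suc i) x) (at x)" and "0 < c"
  shows "(cutoff_term D p q r \<epsilon> c has_vector_derivative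
      cutoff_term D (p + 1) (q + 1) (r + 1) \<epsilon> c t + (real q *\<^sub>R cutoff_term D p (q - 1) r \<epsilon> c t
        + (- real r) *\<^sub>R cutoff_term D p (q + 1) (r + 2) \<epsilon> c t)) (at t)"
proof -
  let ?h = "\<lambda>t. sqrt (c + t\<^sup>2)"
  have pos: "0 < c + t\<^sup>2" using assms(2) by (simp add: add_pos_nonneg)
  then have h: "0 < ?h t" by simp
  have dh: "(?h has_real_derivative t / ?h t) (at t)"
    using pos by (auto intro!: derivative_eq_intros simp: field_simps)
  have "((\<lambda>t. \<epsilon> ^ p * t ^ q / ?h t ^ r) has_real_derivative
      \<epsilon> ^ p * (real q * t ^ (q - 1)) / ?h t ^ r - real r * (\<epsilon> ^ p * t ^ (q + 1) / ?h t ^ (r + 2))) (at t)"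
  proof -
    have alg: "(A * H ^ r - B * (real r * H ^ (r - 1) * (t / H))) / (H ^ r * H ^ r)
        = A / H ^ r - real r * (B * t / H ^ (r + 2))" if "0 < H" for A B H :: real
    proof (cases r)
      case (Suc r')
      define P where "P = H ^ r'"
      have P: "H ^ r = H * P" "H ^ (r - 1) = P" "H ^ (r + 2) = H * (H * (H * P))" "0 < P"
        using that by (simp_all add: Suc P_def)
      show ?thesis
        unfolding P(1-3) using P(4) that by (simp add: divide_simps) (simp add: algebra_simps)
    qed (use that in simp)
    have "((\<lambda>t. \<epsilon> ^ p * t ^ q) has_real_derivative \<epsilon> ^ p * (real q * t ^ (q - 1))) (at t)"
      using DERIV_cmult[OF DERIV_pow[of q t], of "\<epsilon> ^ p"] by simp
    moreover have "((\<lambda>t. ?h t ^ r) has_real_derivative real r * ?h t ^ (r - 1) * (t / ?h t)) (at t)"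
      using DERIV_power[OF dh, of r] by (simp add: mult_ac)
    ultimately have "((\<lambda>t. \<epsilon> ^ p * t ^ q / ?h t ^ r) has_real_derivative
        (\<epsilon> ^ p * (real q * t ^ (q - 1)) * ?h t ^ r
          - \<epsilon> ^ p * t ^ q * (real r * ?h t ^ (r - 1) * (t / ?h t))) / (?h t ^ r * ?h t ^ r)) (at t)"
      by (rule DERIV_divide) (use h in simp)
    then show ?thesis unfolding alg[OF h] by (simp add: mult_ac)
  qed
  moreover have "((\<lambda>t. D p (\<epsilon> * ?h t)) has_vector_derivative
      (\<epsilon> * (t / ?h t)) *\<^sub>R D (Suc p) (\<epsilon> * ?h t)) (at t)"
  proof -
    have "((\<lambda>t. \<epsilon> * ?h t) has_vector_derivative \<epsilon> * (t / ?h t)) (at t)"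
      unfolding has_real_derivative_iff_has_vector_derivative[symmetric]
      by (rule DERIV_cmult[OF dh])
    from vector_diff_chain_at[OF this D] show ?thesis by (simp add: o_def)
  qed
  ultimately have "(cutoff_term D p q r \<epsilon> c has_vector_derivative
      (\<epsilon> ^ p * t ^ q / ?h t ^ r) *\<^sub>R (\<epsilon> * (t / ?h t)) *\<^sub>R D (Suc p) (\<epsilon> * ?h t)
      + (\<epsilon> ^ p * (real q * t ^ (q - 1)) / ?h t ^ r - real r * (\<epsilon> ^ p * t ^ (q + 1) / ?h t ^ (r + 2)))
        *\<^sub>R D p (\<epsilon> * ?h t)) (at t)"
    unfolding cutoff_term_def[abs_def] by (rule has_vector_derivative_scaleR)
  moreover have "(\<epsilon> ^ p * t ^ q / ?h t ^ r) *\<^sub>R (\<epsilon> * (t / ?h t)) *\<^sub>R D (Suc p) (\<epsilon> * ?h t)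
      = cutoff_term D (p + 1) (q + 1) (r + 1) \<epsilon> c t"
    by (simp add: cutoff_term_def mult_ac)
  moreover have "(\<epsilon> ^ p * (real q * t ^ (q - 1)) / ?h t ^ r - real r * (\<epsilon> ^ p * t ^ (q + 1) / ?h t ^ (r + 2)))
        *\<^sub>R D p (\<epsilon> * ?h t) = real q *\<^sub>R cutoff_term D p (q - 1) r \<epsilon> c t
        + (- real r) *\<^sub>R cutoff_term D p (q + 1) (r + 2) \<epsilon> c t"
    by (simp add: cutoff_term_def scaleR_diff_left mult_ac)
  ultimately show ?thesis by simp
qed

text \<open>Every derivative lowers the degree \<open>q - r - p\<close> of a term by one. The factor \<open>\<epsilon> ^ p\<close> is compensated by the decay
of \<open>D p\<close>, since \<open>x ^ p D p x\<close> is bounded, so that no power of \<open>\<epsilon>\<close> appears in the bound. An \<open>N\<close>-th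
difference is reduced to an \<open>(N - 1)\<close>-st difference of the derivative by the mean value inequality; the lower bound
\<open>c0\<close> keeps \<open>sqrt (c + t\<^sup>2)\<close> comparable over unit intervals.\<close>

lemma forward_diff_cutoff_term_bound:
  fixes D :: "nat \<Rightarrow> real \<Rightarrow> complex"
  assumes D: "\<And>i x. (D i has_vector_derivative D (Suc i) x) (at x)"
    and bdd: "\<And>i j. bounded (range (\<lambda>x. x ^ j *\<^sub>R D i x))" and c0: "0 < c0"
  shows "\<exists>C\<ge>0. \<forall>\<epsilon>>0. \<forall>c\<ge>c0. \<forall>t. norm ((forward_diff ^^ N) (cutoff_term D p q r \<epsilon> c) t)
    \<le> C * sqrt (c + t\<^sup>2) powr (real q - real r - real p - real N)"
proof (induction N arbitrary: p q r)
  case 0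
  obtain B where B: "\<And>x. norm (x ^ p *\<^sub>R D p x) \<le> B"
    using bdd[where i=p and j=p] by (auto simp: bounded_iff)
  have B0: "0 \<le> B" using order_trans[OF norm_ge_zero B] .
  have "norm (cutoff_term D p q r \<epsilon> c t) \<le> B * sqrt (c + t\<^sup>2) powr (real q - real r - real p)"
    if e: "0 < \<epsilon>" and c: "c0 \<le> c" for \<epsilon> c t
  proof -
    let ?h = "sqrt (c + t\<^sup>2)"
    have h: "0 < ?h" using c c0 by (simp add: add_pos_nonneg)
    have "\<epsilon> ^ p * norm (D p (\<epsilon> * ?h)) = norm ((\<epsilon> * ?h) ^ p *\<^sub>R D p (\<epsilon> * ?h)) / ?h ^ p"
      using e h by (simp add: power_mult_distrib)
    also have "\<dots> \<le> B / ?h ^ p"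
      by (intro divide_right_mono B) (use h in simp)
    finally have 1: "\<epsilon> ^ p * norm (D p (\<epsilon> * ?h)) \<le> B / ?h ^ p" .
    have "\<bar>t\<bar> \<le> ?h" using c c0 by (intro real_le_rsqrt) simp
    then have 2: "\<bar>t\<bar> ^ q \<le> ?h ^ q" by (rule power_mono) simp
    have "norm (cutoff_term D p q r \<epsilon> c t) = (\<epsilon> ^ p * norm (D p (\<epsilon> * ?h))) * (\<bar>t\<bar> ^ q / ?h ^ r)"
      using e h by (simp add: cutoff_term_def abs_mult power_abs)
    also have "\<dots> \<le> (B / ?h ^ p) * (?h ^ q / ?h ^ r)"
      using h B0 by (intro mult_mono 1 divide_right_mono 2) auto
    also have "\<dots> = B * ?h powr (real q - real r - real p)"
      using h by (simp add: powr_diff powr_realpow)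
    finally show ?thesis .
  qed
  with B0 show ?case by auto
next
  case (Suc N)
  define e where "e = real q - real r - real p - real (Suc N)"
  obtain C1 where C1: "C1 \<ge> 0" "\<And>\<epsilon> c t. \<epsilon> > 0 \<Longrightarrow> c \<ge> c0 \<Longrightarrow>
      norm ((forward_diff ^^ N) (cutoff_term D (p + 1) (q + 1) (r + 1) \<epsilon> c) t) \<le> C1 * sqrt (c + t\<^sup>2) powr e"
    using Suc.IH[of "p + 1" "q + 1" "r + 1"] by (auto simp: e_def algebra_simps)
  \<comment> \<open>For \<open>q = 0\<close> the exponent \<open>q - 1\<close> is truncated, but then the factor \<open>q\<close> vanishes.\<close>
  obtain C2 where C2: "C2 \<ge> 0" "\<And>\<epsilon> c t. \<epsilon> > 0 \<Longrightarrow> c \<ge> c0 \<Longrightarrow>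
      real q * norm ((forward_diff ^^ N) (cutoff_term D p (q - 1) r \<epsilon> c) t) \<le> C2 * sqrt (c + t\<^sup>2) powr e"
  proof (cases q)
    case 0
    then show ?thesis using that[of 0] by simp
  next
    case (Suc q')
    obtain C where C: "C \<ge> 0" "\<And>\<epsilon> c t. \<epsilon> > 0 \<Longrightarrow> c \<ge> c0 \<Longrightarrow>
      norm ((forward_diff ^^ N) (cutoff_term D p (q - 1) r \<epsilon> c) t) \<le> C * sqrt (c + t\<^sup>2) powr e"
      using Suc.IH[of p "q - 1" r] Suc by (auto simp: e_def algebra_simps)
    show ?thesis
      by (rule that[of "real q * C"]) (use C in \<open>auto simp: mult.assoc intro!: mult_left_mono\<close>)
  qed
  obtain C3 where C3: "C3 \<ge> 0" "\<And>\<epsilon> c t. \<epsilon> > 0 \<Longrightarrow> c \<ge> c0 \<Longrightarrow>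
      norm ((forward_diff ^^ N) (cutoff_term D p (q + 1) (r + 2) \<epsilon> c) t) \<le> C3 * sqrt (c + t\<^sup>2) powr e"
    using Suc.IH[of p "q + 1" "r + 2"] by (auto simp: e_def algebra_simps)
  \<comment> \<open>The three terms of the derivative, all of degree \<open>e\<close>.\<close>
  define C4 where "C4 = C1 + C2 + real r * C3"
  have C4: "0 \<le> C4" using C1(1) C2(1) C3(1) by (simp add: C4_def)
  \<comment> \<open>\<open>K\<close> compares \<open>sqrt (c + t\<^sup>2)\<close> at points of distance at most \<open>1\<close>.\<close>
  define K where "K = 1 + 1 / sqrt c0"
  have K1: "1 \<le> K" using c0 by (simp add: K_def)
  have "norm ((forward_diff ^^ Suc N) (cutoff_term D p q r \<epsilon> c) t)
      \<le> C4 * (K powr \<bar>e\<bar> * sqrt (c + t\<^sup>2) powr e)"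
    if eps: "0 < \<epsilon>" and c: "c0 \<le> c" for \<epsilon> c t
  proof -
    let ?h = "\<lambda>t. sqrt (c + t\<^sup>2)"
    have cpos: "0 < c" using c c0 by simp
    have h_ge: "sqrt c0 \<le> ?h t" for t using c by (simp add: add_increasing2)
    have h_pos: "0 < ?h t" for t using cpos by (simp add: add_pos_nonneg)
    have h_norm: "?h t = norm (sqrt c, t)" for t using cpos by (simp add: norm_Pair)
    have lip: "?h s \<le> K * ?h t" if "\<bar>s - t\<bar> \<le> 1" for s t
    proof -
      have "?h s \<le> ?h t + norm ((sqrt c, s) - (sqrt c, t))"
        unfolding h_norm using norm_triangle_ineq2[of "(sqrt c, s)" "(sqrt c, t)"] by linarith
      also have "norm ((sqrt c, s) - (sqrt c, t)) \<le> 1"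
        using that by (simp add: norm_Pair)
      also have "1 \<le> ?h t / sqrt c0"
        using h_ge[of t] c0 by simp
      finally show ?thesis by (simp add: K_def algebra_simps)
    qed
    let ?F' = "(forward_diff ^^ N) (\<lambda>t. cutoff_term D (p + 1) (q + 1) (r + 1) \<epsilon> c t
        + (real q *\<^sub>R cutoff_term D p (q - 1) r \<epsilon> c t
        + (- real r) *\<^sub>R cutoff_term D p (q + 1) (r + 2) \<epsilon> c t))"
    show ?thesis
      unfolding funpow.simps o_apply
    proof (rule norm_forward_diff_le)
      show "((forward_diff ^^ N) (cutoff_term D p q r \<epsilon> c) has_vector_derivative ?F' s) (at s)" for s
        by (rule forward_diff_funpow_has_vector_derivative, rule cutoff_term_has_vector_derivative[of D, OF D cpos])
    next
      fix s assume s: "t \<le> s" "s \<le> t + 1"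
      have "norm (?F' s) \<le> norm ((forward_diff ^^ N) (cutoff_term D (p + 1) (q + 1) (r + 1) \<epsilon> c) s)
          + (real q * norm ((forward_diff ^^ N) (cutoff_term D p (q - 1) r \<epsilon> c) s)
          + real r * norm ((forward_diff ^^ N) (cutoff_term D p (q + 1) (r + 2) \<epsilon> c) s))"
        unfolding forward_diff_funpow_add forward_diff_funpow_scaleR
        by (intro norm_triangle_le add_mono) (auto simp: norm_minus_cancel)
      also have "\<dots> \<le> C1 * ?h s powr e + (C2 * ?h s powr e + real r * (C3 * ?h s powr e))"
        by (intro add_mono C1 C2 mult_left_mono C3 eps c) simp
      also have "\<dots> = C4 * ?h s powr e" by (simp add: C4_def algebra_simps)
      also have "\<dots> \<le> C4 * (K powr \<bar>e\<bar> * ?h t powr e)"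
        using s by (intro mult_left_mono powr_comparable C4 h_pos K1 lip) auto
      finally show "norm (?F' s) \<le> C4 * (K powr \<bar>e\<bar> * ?h t powr e)" .
    qed
  qed
  note main = this
  show ?case
  proof (intro exI[of _ "C4 * K powr \<bar>e\<bar>"] conjI allI impI)
    show "0 \<le> C4 * K powr \<bar>e\<bar>" using C4 by simp
    fix \<epsilon> c t :: real assume "0 < \<epsilon>" and "c0 \<le> c"
    from main[OF this, of t]
    show "norm ((forward_diff ^^ Suc N) (cutoff_term D p q r \<epsilon> c) t)
      \<le> C4 * K powr \<bar>e\<bar> * sqrt (c + t\<^sup>2) powr (real q - real r - real p - real (Suc N))"
      unfolding e_def mult.assoc .
  qed
qed

text \<open>If \<open>S\<close> does not depend on the \<open>j\<close>-th coordinate, then differences in direction \<open>j\<close> of a function of \<open>S k\<close>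
and \<open>k\<^sub>j\<close> are differences in one real variable with a frozen parameter.\<close>

lemma diff_op_funpow_line:
  fixes G :: "real \<Rightarrow> real \<Rightarrow> complex" and S :: "int ^ 'n::finite \<Rightarrow> real"
  assumes "\<And>k. S (k + axis j 1) = S k"
  shows "(diff_op j ^^ N) (\<lambda>k. G (S k) (real_of_int (k $ j)))
    = (\<lambda>k. (forward_diff ^^ N) (G (S k)) (real_of_int (k $ j)))"
proof (induction N arbitrary: G)
  case (Suc N)
  have "diff_op j (\<lambda>k. G (S k) (real_of_int (k $ j))) = (\<lambda>k. forward_diff (G (S k)) (real_of_int (k $ j)))"
    by (rule ext) (simp add: diff_op_def forward_diff_def assms)
  then show ?case
    by (simp only: funpow_Suc_right o_apply Suc.IH[of "\<lambda>s. forward_diff (G s)"])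
qed simp

lemma param_bracket_le_param_abs:
  assumes "0 < m" and "0 < R" and "R \<le> cmod z"
  shows "param_bracket m x z \<le> sqrt (1 + 1 / (R powr (1 / m))\<^sup>2) * param_abs m x z"
proof -
  define \<mu> c0 where "\<mu> = cmod z powr (1 / m)" and "c0 = (R powr (1 / m))\<^sup>2"
  have c0: "0 < c0" using assms by (simp add: c0_def)
  have "c0 \<le> \<mu>\<^sup>2" unfolding c0_def \<mu>_def
    using assms by (intro power_mono powr_mono2) auto
  then have "c0 \<le> (norm x)\<^sup>2 + \<mu>\<^sup>2" by (simp add: add_increasing)
  then show ?thesis
    unfolding param_abs_sqrt param_bracket_sqrt \<mu>_def[symmetric] c0_def[symmetric] real_sqrt_mult[symmetric]
    using c0 by (intro real_sqrt_le_mono) (simp add: field_simps)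
qed

lemma diff_cutoff_bound:
  assumes "schwartz \<phi>" and "0 < m" and "0 < R"
  shows "\<exists>C. \<forall>\<epsilon>>0. \<forall>z j. \<forall>k :: int ^ 'n::finite. R \<le> cmod z \<longrightarrow>
    norm ((diff_op j ^^ N) (\<lambda>k. cutoff m \<phi> \<epsilon> (rvec k) z) k) \<le> C * mixed_weight m z 0 (- real N) k"
proof -
  obtain D where D0: "D 0 = \<phi>" and D: "\<And>i x. (D i has_vector_derivative D (Suc i) x) (at x)"
    and bdd: "\<And>i j. bounded (range (\<lambda>x. x ^ j *\<^sub>R D i x))"
    using assms(1) by (auto simp: schwartz_def)
  define c0 where "c0 = (R powr (1 / m))\<^sup>2"
  have c0: "0 < c0" using assms by (simp add: c0_def)
  from forward_diff_cutoff_term_bound[of D, OF D bdd c0, where N=N and p=0 and q=0 and r=0] obtain C where C: "0 \<le> C"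
    "\<And>\<epsilon> c t. 0 < \<epsilon> \<Longrightarrow> c0 \<le> c \<Longrightarrow> norm ((forward_diff ^^ N) (cutoff_term D 0 0 0 \<epsilon> c) t)
      \<le> C * sqrt (c + t\<^sup>2) powr (- real N)"
    by auto
  define K where "K = sqrt (1 + 1 / c0)"
  have K1: "1 \<le> K" using c0 by (simp add: K_def)
  have "norm ((diff_op j ^^ N) (\<lambda>k. cutoff m \<phi> \<epsilon> (rvec k) z) k)
      \<le> C * (K powr \<bar>- real N\<bar> * mixed_weight m z 0 (- real N) k)"
    if eps: "0 < \<epsilon>" and z: "R \<le> cmod z" for \<epsilon> z j and k :: "int ^ 'n"
  proof -
    define \<mu> where "\<mu> = cmod z powr (1 / m)"
    have \<mu>: "c0 \<le> \<mu>\<^sup>2" unfolding c0_def \<mu>_def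
      using assms z by (intro power_mono powr_mono2) auto
    \<comment> \<open>The part of \<open>param_abs\<close> that does not change along the line in direction \<open>j\<close>.\<close>
    define S where "S k = (norm (rvec k))\<^sup>2 - (real_of_int (k $ j))\<^sup>2 + \<mu>\<^sup>2" for k :: "int ^ 'n"
    have S_eq: "S k = (\<Sum>i\<in>UNIV - {j}. (real_of_int (k $ i))\<^sup>2) + \<mu>\<^sup>2" for k
      by (simp add: S_def norm_vec_def L2_set_def rvec_def sum_nonneg sum_diff1)
    have "S (k + axis j 1) = S k" for k
      unfolding S_eq by (intro arg_cong2[where f = "(+)"] sum.cong refl) (simp add: axis_def)
    note line = diff_op_funpow_line[of S, OF this]
    have "S k \<ge> c0" using \<mu> by (simp add: S_eq sum_nonneg add_increasing)
    have pa: "param_abs m (rvec k) z = sqrt (S k + (real_of_int (k $ j))\<^sup>2)" for k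
      by (simp add: param_abs_sqrt S_def \<mu>_def)
    have "(\<lambda>k. cutoff m \<phi> \<epsilon> (rvec k) z) = (\<lambda>k. cutoff_term D 0 0 0 \<epsilon> (S k) (real_of_int (k $ j)))"
      by (simp add: cutoff_def cutoff_term_def D0 pa)
    then have "norm ((diff_op j ^^ N) (\<lambda>k. cutoff m \<phi> \<epsilon> (rvec k) z) k)
        = norm ((forward_diff ^^ N) (cutoff_term D 0 0 0 \<epsilon> (S k)) (real_of_int (k $ j)))"
      using line[of N "cutoff_term D 0 0 0 \<epsilon>"] by simp
    also have "\<dots> \<le> C * param_abs m (rvec k) z powr (- real N)"
      unfolding pa by (intro C eps \<open>c0 \<le> S k\<close>)
    also have "\<dots> \<le> C * (K powr \<bar>- real N\<bar> * param_bracket m (rvec k) z powr (- real N))"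
    proof (intro mult_left_mono C(1) powr_comparable K1 param_bracket_pos)
      show "0 < param_abs m (rvec k) z"
        by (rule less_le_trans[OF _ cmod_powr_le_param_abs]) (use assms z in auto)
      show "param_bracket m (rvec k) z \<le> K * param_abs m (rvec k) z"
        unfolding K_def c0_def by (rule param_bracket_le_param_abs[OF assms(2,3) z])
      have "param_abs m (rvec k) z \<le> 1 * param_bracket m (rvec k) z"
        by (simp add: param_abs_sqrt param_bracket_sqrt)
      also have "\<dots> \<le> K * param_bracket m (rvec k) z"
        by (intro mult_right_mono K1 less_imp_le[OF param_bracket_pos])
      finally show "param_abs m (rvec k) z \<le> K * param_bracket m (rvec k) z" .
    qed
    also have "param_bracket m (rvec k) z powr (- real N) = mixed_weight m z 0 (- real N) k"
      by (simp add: mixed_weight_def powr_zero_eq_one less_imp_neq[OF bracket_pos, THEN not_sym])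
    finally show ?thesis .
  qed
  then show ?thesis
    by (intro exI[of _ "C * K powr \<bar>- real N\<bar>"]) (simp add: mult.assoc)
qed

text \<open>The cut-off has order \<open>(0, 0)\<close> and its difference has the order \<open>(0, -1)\<close>, which is better than the order
\<open>(-1, 0)\<close> that the first statement would give; the improved decay for small \<open>\<langle>k\<rangle>\<close> is what the two-sided bound
of the kernel symbol needs.\<close>

lemma cutoff_mixed:
  assumes "schwartz \<phi>" and "0 < m" and "0 < R"
  shows "\<exists>C. \<forall>\<epsilon>>0. \<forall>z. \<forall>j::'n::finite. R \<le> cmod z \<longrightarrow>
    mixed_symbol m z j L C 0 0 (\<lambda>k. cutoff m \<phi> \<epsilon> (rvec k) z) \<and>
    mixed_symbol m z j L C 0 (- 1) (diff_op j (\<lambda>k. cutoff m \<phi> \<epsilon> (rvec k) z))"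
proof -
  have "\<forall>N. \<exists>C. \<forall>\<epsilon>>0. \<forall>z j. \<forall>k :: int ^ 'n::finite. R \<le> cmod z \<longrightarrow>
      norm ((diff_op j ^^ N) (\<lambda>k. cutoff m \<phi> \<epsilon> (rvec k) z) k) \<le> C * mixed_weight m z 0 (- real N) k"
    using diff_cutoff_bound[OF assms] by blast
  then obtain C where C: "\<And>N \<epsilon> z j k. 0 < \<epsilon> \<Longrightarrow> R \<le> cmod z \<Longrightarrow>
      norm ((diff_op j ^^ N) (\<lambda>k :: int ^ 'n. cutoff m \<phi> \<epsilon> (rvec k) z) k)
        \<le> C N * mixed_weight m z 0 (- real N) k"
    by metis
  define C' where "C' = Max (C ` {..Suc L})"
  have C': "norm ((diff_op j ^^ N) (\<lambda>k :: int ^ 'n. cutoff m \<phi> \<epsilon> (rvec k) z) k)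
      \<le> C' * mixed_weight m z 0 (- real N) k"
    if "N \<le> Suc L" "0 < \<epsilon>" "R \<le> cmod z" for N \<epsilon> z j k
  proof -
    have "C N \<le> C'" unfolding C'_def using that by (intro Max_ge) auto
    then show ?thesis
      using C[OF that(2,3)] by (meson order_trans mult_right_mono less_imp_le[OF mixed_weight_pos])
  qed
  have C'0: "0 \<le> C'" if "0 < \<epsilon>" "R \<le> cmod z" for \<epsilon> :: real and z
    using order_trans[OF norm_ge_zero C'[of 0 \<epsilon> z undefined 0]] that
      mixed_weight_pos[of m z 0 0 "0 :: int ^ 'n"]
    by (simp add: zero_le_mult_iff)
  show ?thesis
  proof (intro exI[of _ C'] allI impI conjI)
    fix \<epsilon> :: real and z and j :: 'n assume eps: "0 < \<epsilon>" and z: "R \<le> cmod z"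
    show "mixed_symbol m z j L C' 0 0 (\<lambda>k. cutoff m \<phi> \<epsilon> (rvec k) z)"
      unfolding mixed_symbol_def
    proof (intro allI impI)
      fix i and k :: "int ^ 'n" assume "i \<le> L"
      then have "norm ((diff_op j ^^ i) (\<lambda>k. cutoff m \<phi> \<epsilon> (rvec k) z) k) \<le> C' * mixed_weight m z 0 (- real i) k"
        by (intro C' eps z) simp
      also have "\<dots> \<le> C' * mixed_weight m z (0 - real i) 0 k"
        using mixed_weight_mono[of "real i" m z "- real i" 0 k] C'0[OF eps z]
        by (intro mult_left_mono) auto
      finally show "norm ((diff_op j ^^ i) (\<lambda>k. cutoff m \<phi> \<epsilon> (rvec k) z) k) \<le> C' * mixed_weight m z (0 - real i) 0 k" .
    qed
    show "mixed_symbol m z j L C' 0 (- 1) (diff_op j (\<lambda>k. cutoff m \<phi> \<epsilon> (rvec k) z))"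
      unfolding mixed_symbol_def
    proof (intro allI impI)
      fix i and k :: "int ^ 'n" assume "i \<le> L"
      then have "norm ((diff_op j ^^ Suc i) (\<lambda>k. cutoff m \<phi> \<epsilon> (rvec k) z) k)
          \<le> C' * mixed_weight m z 0 (- real (Suc i)) k"
        by (intro C' eps z) simp
      also have "\<dots> \<le> C' * mixed_weight m z (0 - real i) (- 1) k"
        using mixed_weight_mono[of "real i" m z "- real i" "- 1" k] C'0[OF eps z]
        by (intro mult_left_mono) (auto simp: algebra_simps)
      finally show "norm ((diff_op j ^^ i) (diff_op j (\<lambda>k. cutoff m \<phi> \<epsilon> (rvec k) z)) k)
          \<le> C' * mixed_weight m z (0 - real i) (- 1) k"
        by (simp add: funpow_Suc_right del: funpow.simps)
    qed
  qed
qed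


section \<open>Dyadic estimates\<close>

text \<open>Two-sided decay away from the scale \<open>r = 1\<close>.\<close>

definition dyadic_profile :: "real \<Rightarrow> real \<Rightarrow> real"
  where "dyadic_profile \<alpha> r = min (r powr \<alpha>) (r powr (- \<alpha>))"

lemma dyadic_profile_nonneg: "0 \<le> dyadic_profile \<alpha> r"
  by (simp add: dyadic_profile_def)

lemma power_of_two_bracket:
  assumes "1 \<le> (r::real)"
  obtains i :: nat where "2 ^ i \<le> r" "r < 2 ^ Suc i"
proof
  have "0 \<le> log 2 r" using assms by simp
  define i where "i = nat \<lfloor>log 2 r\<rfloor>"
  have i: "real i \<le> log 2 r" "log 2 r < real i + 1"
    using \<open>0 \<le> log 2 r\<close> by (auto simp: i_def)
  have "2 powr real i \<le> r" using i(1) assms by (simp add: le_log_iff)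
  then show "2 ^ i \<le> r" by (simp add: powr_realpow)
  have "r < 2 powr (real i + 1)" using i(2) assms by (simp add: log_less_iff)
  then show "r < 2 ^ Suc i" by (simp add: powr_add powr_realpow mult.commute)
qed

text \<open>A function that decays like \<open>(N/\<mu>) powr \<plusminus>\<alpha> / N\<^sup>n\<close> on both sides of the scale \<open>\<mu>\<close> has a bounded integral if
the sublevel sets of \<open>N\<close> grow at most like \<open>\<rho>\<^sup>n\<close>: on the shell where \<open>N/\<mu>\<close> is comparable to \<open>2 ^ i\<close> or to
\<open>2 ^ (-i)\<close>, the growth of the measure cancels \<open>1 / N\<^sup>n\<close>, and the profile leaves the term \<open>q ^ i\<close> of a
geometric series. The bound does not depend on \<open>\<mu>\<close>. Points with \<open>N x = 0\<close> are harmless, because the profile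
vanishes there.\<close>

lemma nn_integral_dyadic_le:
  fixes N :: "'a \<Rightarrow> real"
  assumes meas [measurable]: "N \<in> borel_measurable M" and N: "\<And>x. x \<in> space M \<Longrightarrow> 0 \<le> N x"
    and C: "0 \<le> C" "\<And>\<rho>. 0 < \<rho> \<Longrightarrow> emeasure M {x \<in> space M. N x \<le> \<rho>} \<le> ennreal (C * \<rho> ^ n)"
    and \<alpha>: "0 < \<alpha>" and \<mu>: "0 < \<mu>"
  shows "(\<integral>\<^sup>+ x. ennreal (dyadic_profile \<alpha> (N x / \<mu>) / N x ^ n) \<partial>M)
    \<le> ennreal (2 * (2 ^ n * C) / (1 - 2 powr (- \<alpha>)))"
proof -
  define q where "q = (2::real) powr (- \<alpha>)"
  have q: "0 < q" "q < 1" using \<alpha> by (simp_all add: q_def powr_less_one)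
  have q_pow: "(2 ^ i) powr (- \<alpha>) = q ^ i" for i
    by (simp add: q_def powr_powr mult.commute flip: powr_realpow)
  define A where "A i = {x \<in> space M. N x \<le> \<mu> / 2 ^ i}" for i :: nat
  define B where "B i = {x \<in> space M. N x \<le> 2 ^ Suc i * \<mu>}" for i :: nat
  define c where "c i = q ^ i * (2 ^ Suc i / \<mu>) ^ n" for i
  define d where "d i = q ^ i / (2 ^ i * \<mu>) ^ n" for i
  have A [measurable]: "A i \<in> sets M" and B [measurable]: "B i \<in> sets M" for i
    unfolding A_def B_def by measurable
  have c0: "0 \<le> c i" and d0: "0 \<le> d i" for i using q \<mu> by (simp_all add: c_def d_def)
  let ?t = "\<lambda>i x. ennreal (c i) * indicator (A i) x + ennreal (d i) * indicator (B i) x"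
  have pt: "ennreal (dyadic_profile \<alpha> (N x / \<mu>) / N x ^ n) \<le> (\<Sum>i. ?t i x)"
    if x: "x \<in> space M" for x
  proof -
    define r where "r = N x / \<mu>"
    have Nx: "N x = r * \<mu>" using \<mu> by (simp add: r_def)
    have "0 \<le> r" using N[OF x] \<mu> by (simp add: r_def)
    then consider "r = 0" | "0 < r" "r \<le> 1" | "1 < r" by linarith
    then have "\<exists>i. ennreal (dyadic_profile \<alpha> r / N x ^ n) \<le> ?t i x"
    proof cases
      case 1
      then show ?thesis by (simp add: dyadic_profile_def)
    next
      case 2
      then have "1 \<le> 1 / r" by simp
      then obtain i :: nat where i: "2 ^ i \<le> 1 / r" "1 / r < 2 ^ Suc i"
        by (rule power_of_two_bracket)
      have "x \<in> A i" using i(1) 2 x \<mu> by (simp add: A_def Nx field_simps)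
      have "dyadic_profile \<alpha> r \<le> (1 / r) powr (- \<alpha>)"
        using 2 by (simp add: dyadic_profile_def powr_divide powr_minus)
      also have "\<dots> \<le> (2 ^ i) powr (- \<alpha>)"
        using i(1) \<alpha> by (intro powr_mono2') auto
      finally have 1: "dyadic_profile \<alpha> r \<le> q ^ i" unfolding q_pow .
      have "1 / N x ^ n = (1 / r / \<mu>) ^ n"
        by (simp add: Nx power_divide power_mult_distrib)
      also have "\<dots> \<le> (2 ^ Suc i / \<mu>) ^ n"
        using i(2) 2 \<mu> by (intro power_mono divide_right_mono) auto
      finally have 2: "1 / N x ^ n \<le> (2 ^ Suc i / \<mu>) ^ n" .
      have "dyadic_profile \<alpha> r * (1 / N x ^ n) \<le> c i"
        unfolding c_def using q N[OF x] by (intro mult_mono 1 2) auto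
      then have "ennreal (dyadic_profile \<alpha> r / N x ^ n) \<le> ?t i x"
        using \<open>x \<in> A i\<close> by (auto intro: ennreal_leI add_increasing2)
      then show ?thesis by blast
    next
      case 3
      then obtain i :: nat where i: "2 ^ i \<le> r" "r < 2 ^ Suc i"
        using power_of_two_bracket[of r] by auto
      have "x \<in> B i" using i(2) x \<mu> by (auto simp: B_def Nx intro!: mult_right_mono)
      have "dyadic_profile \<alpha> r \<le> r powr (- \<alpha>)"
        by (simp add: dyadic_profile_def)
      also have "\<dots> \<le> (2 ^ i) powr (- \<alpha>)"
        using i(1) \<alpha> by (intro powr_mono2') auto
      finally have 1: "dyadic_profile \<alpha> r \<le> q ^ i" unfolding q_pow .
      have "dyadic_profile \<alpha> r / N x ^ n \<le> d i"
        unfolding d_def Nx using q 1 i 3 \<mu>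
        by (intro frac_le power_mono mult_right_mono dyadic_profile_nonneg) auto
      then have "ennreal (dyadic_profile \<alpha> r / N x ^ n) \<le> ?t i x"
        using \<open>x \<in> B i\<close> by (auto intro: ennreal_leI add_increasing)
      then show ?thesis by blast
    qed
    then obtain i where "ennreal (dyadic_profile \<alpha> r / N x ^ n) \<le> ?t i x" ..
    also have "\<dots> = (\<Sum>j\<in>{i}. ?t j x)" by simp
    also have "\<dots> \<le> (\<Sum>i. ?t i x)" by (rule sum_le_suminf) auto
    finally show ?thesis by (simp add: r_def)
  qed
  have int: "(\<integral>\<^sup>+ x. ?t i x \<partial>M) \<le> ennreal (2 * (2 ^ n * C) * q ^ i)" for i
  proof -
    have "(\<integral>\<^sup>+ x. ?t i x \<partial>M) = ennreal (c i) * emeasure M (A i) + ennreal (d i) * emeasure M (B i)"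
      by (simp add: nn_integral_add nn_integral_cmult)
    also have "\<dots> \<le> ennreal (c i) * ennreal (C * (\<mu> / 2 ^ i) ^ n)
        + ennreal (d i) * ennreal (C * (2 ^ Suc i * \<mu>) ^ n)"
      unfolding A_def B_def by (intro add_mono mult_left_mono C(2)) (use \<mu> in auto)
    also have "\<dots> = ennreal (c i * (C * (\<mu> / 2 ^ i) ^ n) + d i * (C * (2 ^ Suc i * \<mu>) ^ n))"
      using C(1) \<mu> c0 d0 by (simp add: ennreal_mult ennreal_plus)
    also have "c i * (C * (\<mu> / 2 ^ i) ^ n) = 2 ^ n * C * q ^ i"
      using \<mu> by (simp add: c_def power_divide power_mult_distrib)
    also have "d i * (C * (2 ^ Suc i * \<mu>) ^ n) = 2 ^ n * C * q ^ i"
      using \<mu> by (simp add: d_def power_mult_distrib)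
    finally show ?thesis by (simp add: mult_ac)
  qed
  have geo: "(\<lambda>i. 2 * (2 ^ n * C) * q ^ i) sums (2 * (2 ^ n * C) * (1 / (1 - q)))"
    using q by (intro sums_mult geometric_sums) auto
  have "(\<integral>\<^sup>+ x. ennreal (dyadic_profile \<alpha> (N x / \<mu>) / N x ^ n) \<partial>M) \<le> (\<integral>\<^sup>+ x. (\<Sum>i. ?t i x) \<partial>M)"
    by (rule nn_integral_mono) (rule pt)
  also have "\<dots> = (\<Sum>i. \<integral>\<^sup>+ x. ?t i x \<partial>M)"
    by (rule nn_integral_suminf) measurable
  also have "\<dots> \<le> (\<Sum>i. ennreal (2 * (2 ^ n * C) * q ^ i))"
    by (intro suminf_le int) auto
  also have "\<dots> = ennreal (2 * (2 ^ n * C) * (1 / (1 - q)))"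
    using geo q C(1) by (intro suminf_ennreal_eq) auto
  finally show ?thesis by (simp add: q_def)
qed

lemma card_int_box_le:
  assumes "finite I"
  shows "finite {k :: int ^ 'n::finite. \<forall>j. k $ j \<in> I}"
    and "card {k :: int ^ 'n. \<forall>j. k $ j \<in> I} \<le> card I ^ CARD('n)"
proof -
  have eq: "{k :: int ^ 'n. \<forall>j. k $ j \<in> I} = vec_lambda ` (UNIV \<rightarrow>\<^sub>E I)"
    by (auto simp: PiE_def extensional_def intro!: image_eqI[of _ _ "vec_nth _"])
  have fin: "finite ((UNIV :: 'n set) \<rightarrow>\<^sub>E I)"
    using assms by (intro finite_PiE) auto
  then show "finite {k :: int ^ 'n. \<forall>j. k $ j \<in> I}"
    unfolding eq by simp
  show "card {k :: int ^ 'n. \<forall>j. k $ j \<in> I} \<le> card I ^ CARD('n)"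
    unfolding eq using card_image_le[OF fin, of vec_lambda] by (simp add: card_PiE)
qed

text \<open>Since the bracket is at least \<open>1\<close>, radii \<open>\<rho> < 1\<close> contribute nothing, and for \<open>\<rho> \<ge> 1\<close> the number
\<open>2\<lfloor>\<rho>\<rfloor> + 1\<close> of values of each coordinate is at most \<open>3\<rho>\<close>.\<close>

lemma lattice_count:
  assumes "0 < \<rho>"
  shows "emeasure (count_space UNIV) {k :: int ^ 'n::finite. bracket (rvec k) \<le> \<rho>}
    \<le> ennreal (3 ^ CARD('n) * \<rho> ^ CARD('n))"
proof (cases "\<rho> < 1")
  case True
  then have "{k :: int ^ 'n. bracket (rvec k) \<le> \<rho>} = {}"
    using bracket_ge_1 by (force simp: not_le intro: less_le_trans)
  then show ?thesis by simp
next
  case False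
  define I where "I = {- \<lfloor>\<rho>\<rfloor>..\<lfloor>\<rho>\<rfloor>}"
  have I: "finite I" by (simp add: I_def)
  have "real (card I) = 2 * real_of_int \<lfloor>\<rho>\<rfloor> + 1"
    using False by (simp add: I_def)
  then have cI: "real (card I) \<le> 3 * \<rho>"
    using False of_int_floor_le[of \<rho>] by linarith
  have sub: "{k :: int ^ 'n. bracket (rvec k) \<le> \<rho>} \<subseteq> {k. \<forall>j. k $ j \<in> I}"
  proof clarify
    fix k :: "int ^ 'n" and j assume "bracket (rvec k) \<le> \<rho>"
    then have "\<bar>real_of_int (k $ j)\<bar> \<le> \<rho>"
      using component_le_norm_cart[of "rvec k" j] norm_le_bracket[of "rvec k"]
      by (simp add: rvec_def)
    then show "k $ j \<in> I" by (simp add: I_def abs_le_iff le_floor_iff) linarith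
  qed
  have "emeasure (count_space UNIV) {k :: int ^ 'n. bracket (rvec k) \<le> \<rho>}
      \<le> emeasure (count_space UNIV) {k :: int ^ 'n. \<forall>j. k $ j \<in> I}"
    by (rule emeasure_mono[OF sub]) simp
  also have "\<dots> = ennreal (card {k :: int ^ 'n. \<forall>j. k $ j \<in> I})"
    using card_int_box_le(1)[OF I] by (simp add: emeasure_count_space ennreal_of_nat_eq_real_of_nat)
  also have "\<dots> \<le> ennreal (3 ^ CARD('n) * \<rho> ^ CARD('n))"
  proof (rule ennreal_leI)
    have "real (card {k :: int ^ 'n. \<forall>j. k $ j \<in> I}) \<le> real (card I ^ CARD('n))"
      using card_int_box_le(2)[OF I] by (simp only: of_nat_le_iff)
    also have "\<dots> \<le> (3 * \<rho>) ^ CARD('n)"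
      unfolding of_nat_power using cI by (rule power_mono) simp
    finally show "real (card {k :: int ^ 'n. \<forall>j. k $ j \<in> I}) \<le> 3 ^ CARD('n) * \<rho> ^ CARD('n)"
      by (simp add: power_mult_distrib)
  qed
  finally show ?thesis .
qed

text \<open>The dyadic estimate for the counting measure on the lattice. It also yields the summability of \<open>\<langle>k\<rangle> powr (-n-1)\<close>,
which is the case \<open>\<alpha> = \<mu> = 1\<close>.\<close>

lemma lattice_sum_le:
  assumes "0 < \<alpha>"
  shows "\<exists>S\<ge>0. \<forall>\<mu>>0.
    (\<lambda>k :: int ^ 'n::finite. dyadic_profile \<alpha> (bracket (rvec k) / \<mu>) / bracket (rvec k) ^ CARD('n)) summable_on UNIV \<and>
    (\<Sum>\<^sub>\<infinity>k :: int ^ 'n. dyadic_profile \<alpha> (bracket (rvec k) / \<mu>) / bracket (rvec k) ^ CARD('n)) \<le> S"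
proof -
  define S where "S = 2 * (2 ^ CARD('n) * 3 ^ CARD('n)) / (1 - 2 powr (- \<alpha>))"
  have S: "0 \<le> S" using assms by (auto simp: S_def powr_less_one intro!: divide_nonneg_nonneg less_imp_le)
  show ?thesis
  proof (intro exI[of _ S] conjI allI impI S)
    fix \<mu> :: real assume \<mu>: "0 < \<mu>"
    let ?f = "\<lambda>k :: int ^ 'n. dyadic_profile \<alpha> (bracket (rvec k) / \<mu>) / bracket (rvec k) ^ CARD('n)"
    have f0: "0 \<le> ?f k" for k
      by (intro divide_nonneg_nonneg dyadic_profile_nonneg zero_le_power less_imp_le[OF bracket_pos])
    have int: "(\<integral>\<^sup>+ k. ennreal (?f k) \<partial>count_space UNIV) \<le> ennreal S"
      unfolding S_def using assms \<mu>
      by (intro nn_integral_dyadic_le)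
        (auto simp: lattice_count intro: less_imp_le[OF bracket_pos])
    have fin: "sum ?f F \<le> S" if "finite F" for F
    proof -
      have "ennreal (sum ?f F) = (\<Sum>k\<in>F. ennreal (?f k))"
        using f0 by simp
      also have "\<dots> = (\<integral>\<^sup>+ k. ennreal (?f k) \<partial>count_space F)"
        using that by (simp add: nn_integral_count_space_finite)
      also have "\<dots> \<le> (\<integral>\<^sup>+ k. ennreal (?f k) \<partial>count_space UNIV)"
        by (subst nn_integral_count_space_indicator) (auto intro!: nn_integral_mono simp: indicator_def)
      also note int
      finally show ?thesis using S by simp
    qed
    show sum: "?f summable_on UNIV"
      by (intro nonneg_bdd_above_summable_on f0 bdd_aboveI[of _ S]) (use fin in auto)
    show "infsum ?f UNIV \<le> S"
      by (intro infsum_le_finite_sums[OF sum] fin)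
  qed
qed

lemma lattice_summable:
  assumes "0 < \<alpha>" and "0 < \<mu>"
  shows "(\<lambda>k :: int ^ 'n::finite. dyadic_profile \<alpha> (bracket (rvec k) / \<mu>) / bracket (rvec k) ^ CARD('n))
    summable_on UNIV"
  using lattice_sum_le[OF assms(1), where 'n='n] assms(2) by blast

lemma emeasure_lborel_cball_le:
  assumes "0 < \<rho>"
  shows "emeasure lborel {x :: real ^ 'n::finite. norm x \<le> \<rho>} \<le> ennreal (2 ^ CARD('n) * \<rho> ^ CARD('n))"
proof -
  have sub: "{x :: real ^ 'n. norm x \<le> \<rho>} \<subseteq> cbox (\<chi> i. - \<rho>) (\<chi> i. \<rho>)"
  proof
    fix x :: "real ^ 'n" assume x: "x \<in> {x. norm x \<le> \<rho>}"
    have "\<bar>x $ i\<bar> \<le> \<rho>" for i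
      using component_le_norm_cart[of x i] x by simp
    then show "x \<in> cbox (\<chi> i. - \<rho>) (\<chi> i. \<rho>)"
      unfolding mem_box_cart by (auto simp: abs_le_iff minus_le_iff)
  qed
  have "emeasure lborel {x :: real ^ 'n. norm x \<le> \<rho>} \<le> emeasure lborel (cbox (\<chi> i. - \<rho>) (\<chi> i. \<rho>) :: (real ^ 'n) set)"
    by (rule emeasure_mono[OF sub]) simp
  also have "\<dots> = ennreal (measure lborel (cbox (\<chi> i. - \<rho>) (\<chi> i. \<rho>) :: (real ^ 'n) set))"
    by (rule emeasure_eq_ennreal_measure) (use emeasure_lborel_cbox_finite in \<open>auto simp: top_unique less_top\<close>)
  also have "measure lborel (cbox (\<chi> i. - \<rho>) (\<chi> i. \<rho>) :: (real ^ 'n) set) = 2 ^ CARD('n) * \<rho> ^ CARD('n)"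
  proof -
    have "0 \<in> cbox (\<chi> i. - \<rho>) ((\<chi> i. \<rho>) :: real ^ 'n)"
      using assms by (simp add: mem_box_cart)
    then have "cbox (\<chi> i. - \<rho>) ((\<chi> i. \<rho>) :: real ^ 'n) \<noteq> {}" by blast
    from content_cbox_cart[OF this] show ?thesis
      by (simp add: power_mult_distrib)
  qed
  finally show ?thesis .
qed

lemma sets_borel_torus: "(torus :: (real ^ 'n::finite) set) \<in> sets borel"
  unfolding torus_def by measurable

lemma zero_null_sets_torus: "{0} \<in> null_sets (torus_measure :: (real ^ 'n::finite) measure)"
proof -
  have "0 \<in> (torus :: (real ^ 'n) set)" by (simp add: torus_def)
  then show ?thesis
    using sets_borel_torus[where 'n='n]
    by (auto simp: torus_measure_def null_sets_def emeasure_restrict_space sets_restrict_space_iff)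
qed

lemma measurable_torus:
  assumes "f \<in> borel_measurable borel"
  shows "f \<in> borel_measurable torus_measure"
  using measurable_restrict_space1[of f lborel borel torus] assms
  by (simp add: torus_measure_def cong: measurable_cong_sets)

lemma measurable_torus_ident: "(\<lambda>x. x) \<in> measurable torus_measure borel"
  using measurable_restrict_space1[of "\<lambda>x. x" lborel borel torus]
  by (simp add: torus_measure_def cong: measurable_cong_sets)

lemma nn_integral_torus_dyadic_le:
  assumes "0 < \<alpha>" and "0 < \<mu>"
  shows "(\<integral>\<^sup>+ \<eta>. ennreal (dyadic_profile \<alpha> (norm \<eta> / \<mu>) / norm \<eta> ^ CARD('n)) \<partial>(torus_measure :: (real ^ 'n::finite) measure))
    \<le> ennreal (2 * (2 ^ CARD('n) * 2 ^ CARD('n)) / (1 - 2 powr (- \<alpha>)))"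
proof -
  let ?f = "\<lambda>\<eta> :: real ^ 'n. ennreal (dyadic_profile \<alpha> (norm \<eta> / \<mu>) / norm \<eta> ^ CARD('n))"
  let ?c = "1 / (2 * pi) ^ CARD('n)"
  have torus: "torus \<in> sets (lborel :: (real ^ 'n) measure)"
    using sets_borel_torus by simp
  have [measurable]: "?f \<in> borel_measurable borel"
    unfolding dyadic_profile_def by measurable
  have "(\<integral>\<^sup>+ \<eta>. ?f \<eta> \<partial>torus_measure) = ennreal ?c * (\<integral>\<^sup>+ \<eta>. ?f \<eta> \<partial>restrict_space lborel torus)"
    unfolding torus_measure_def
    by (rule nn_integral_scale_measure) (simp add: measurable_restrict_space1)
  also have "\<dots> \<le> 1 * (\<integral>\<^sup>+ \<eta>. ?f \<eta> \<partial>lborel)"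
  proof (rule mult_mono)
    have "1 \<le> (2 * pi) ^ CARD('n)" using pi_gt3 by (intro one_le_power) auto
    then show "ennreal ?c \<le> 1" by (simp add: ennreal_le_1)
    show "(\<integral>\<^sup>+ \<eta>. ?f \<eta> \<partial>restrict_space lborel torus) \<le> (\<integral>\<^sup>+ \<eta>. ?f \<eta> \<partial>lborel)"
      by (subst nn_integral_restrict_space) (use torus in \<open>auto intro!: nn_integral_mono simp: indicator_def\<close>)
  qed auto
  also have "\<dots> \<le> ennreal (2 * (2 ^ CARD('n) * 2 ^ CARD('n)) / (1 - 2 powr (- \<alpha>)))"
    unfolding mult_1 using assms
    by (intro nn_integral_dyadic_le) (auto simp: emeasure_lborel_cball_le)
  finally show ?thesis .
qed

lemma quotient_le_dyadic_profile:
  assumes "0 < s" and "0 < \<theta>" and "\<theta> \<le> 1 / 2"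
  shows "(s powr \<theta> + s powr (1 - \<theta>)) / (1 + s) \<le> 2 * dyadic_profile \<theta> s"
proof (cases "s \<le> 1")
  case True
  have "s powr (1 - \<theta>) \<le> s powr \<theta>" "s powr \<theta> \<le> s powr (- \<theta>)"
    using assms True by (auto intro!: powr_mono')
  then have "s powr \<theta> + s powr (1 - \<theta>) \<le> 2 * dyadic_profile \<theta> s * 1"
    by (simp add: dyadic_profile_def)
  also have "\<dots> \<le> 2 * dyadic_profile \<theta> s * (1 + s)"
    using assms by (intro mult_left_mono mult_nonneg_nonneg dyadic_profile_nonneg) auto
  finally show ?thesis using assms by (simp add: divide_simps)
next
  case False
  have "s powr \<theta> \<le> s powr (1 - \<theta>)" "s powr (- \<theta>) \<le> s powr \<theta>"
    using assms False by (auto intro!: powr_mono)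
  moreover have "s powr (1 - \<theta>) = s powr (- \<theta>) * s"
    using assms powr_add[of s "- \<theta>" 1] by simp
  moreover have "dyadic_profile \<theta> s = s powr (- \<theta>)"
    using \<open>s powr (- \<theta>) \<le> s powr \<theta>\<close> by (simp add: dyadic_profile_def)
  ultimately have "s powr \<theta> + s powr (1 - \<theta>) \<le> 2 * dyadic_profile \<theta> s * s"
    by (simp add: mult.commute)
  also have "\<dots> \<le> 2 * dyadic_profile \<theta> s * (1 + s)"
    using assms by (intro mult_left_mono mult_nonneg_nonneg dyadic_profile_nonneg) auto
  finally show ?thesis using assms by (simp add: divide_simps)
qed

text \<open>The right-hand side of the pointwise estimate is at most \<open>2C\<close> times the profile of \<open>\<mu>|\<eta>|\<close>, divided by \<open>|\<eta>|\<^sup>n\<close>.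
Its integral is bounded independently of \<open>\<mu>\<close> by the dyadic estimate with the scale \<open>1/\<mu>\<close>.\<close>

lemma L1_estimate_of_pointwise:
  assumes "0 < m" and "0 < R" and "0 \<le> C"
  shows "\<exists>C'\<ge>0. \<forall>F :: real ^ 'n::finite \<Rightarrow> complex \<Rightarrow> 'e::complex_banach lop. pointwise_estimate m R C F \<longrightarrow>
    (\<forall>z\<in>sector (pi / 2) R. strongly_measurable torus_measure (\<lambda>\<eta>. F \<eta> z)) \<longrightarrow> L1_estimate R C' F"
proof -
  define \<theta> where "\<theta> = min m 1 / 2"
  have \<theta>: "0 < \<theta>" "\<theta> \<le> 1 / 2" using assms by (auto simp: \<theta>_def)
  define I where "I = 2 * (2 ^ CARD('n) * 2 ^ CARD('n)) / (1 - 2 powr (- \<theta>))"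
  have I: "0 \<le> I" using \<theta> by (auto simp: I_def powr_less_one intro!: divide_nonneg_nonneg less_imp_le)
  have null: "AE \<eta> in torus_measure. \<eta> \<noteq> (0 :: real ^ 'n)"
    by (rule AE_I'[OF zero_null_sets_torus]) auto
  have "ennreal (cmod z) * L1_norm torus_measure (\<lambda>\<eta>. F \<eta> z) \<le> ennreal (2 * C * I)"
    if F: "pointwise_estimate m R C F" and z: "z \<in> sector (pi / 2) R"
    for F :: "real ^ 'n \<Rightarrow> complex \<Rightarrow> 'e lop" and z
  proof -
    define \<mu> where "\<mu> = cmod z powr (1 / m)"
    have z0: "0 < cmod z" using z assms by (auto simp: sector_def)
    then have \<mu>: "0 < \<mu>" by (simp add: \<mu>_def)
    have pt: "norm (F \<eta> z) \<le> 2 * C / cmod z * (dyadic_profile \<theta> (norm \<eta> / (1 / \<mu>)) / norm \<eta> ^ CARD('n))"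
      if "\<eta> \<in> torus" "\<eta> \<noteq> 0" for \<eta>
    proof -
      define s where "s = \<mu> * norm \<eta>"
      have s: "0 < s" using \<mu> that by (simp add: s_def)
      have "cmod z * norm (F \<eta> z) \<le> C * ((\<mu> powr \<theta> * norm \<eta> powr \<theta> + \<mu> powr (1 - \<theta>) * norm \<eta> powr (1 - \<theta>))
              / (norm \<eta> ^ CARD('n) * (1 + \<mu> * norm \<eta>)))"
        using F that z by (auto simp: pointwise_estimate_def Let_def \<theta>_def \<mu>_def)
      also have "\<dots> = C * ((s powr \<theta> + s powr (1 - \<theta>)) / (1 + s) / norm \<eta> ^ CARD('n))"
        using \<mu> by (simp add: s_def powr_mult mult.commute)
      also have "\<dots> \<le> C * (2 * dyadic_profile \<theta> s / norm \<eta> ^ CARD('n))"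
        by (intro mult_left_mono divide_right_mono quotient_le_dyadic_profile s \<theta> assms) simp
      finally have "norm (F \<eta> z) \<le> C * (2 * dyadic_profile \<theta> s / norm \<eta> ^ CARD('n)) / cmod z"
        using z0 by (simp only: pos_le_divide_eq mult.commute[of "cmod z"])
      then show ?thesis by (simp add: s_def mult_ac)
    qed
    have meas: "(\<lambda>\<eta> :: real ^ 'n. ennreal (dyadic_profile \<theta> (norm \<eta> / (1 / \<mu>)) / norm \<eta> ^ CARD('n)))
        \<in> borel_measurable torus_measure"
      unfolding dyadic_profile_def by (intro measurable_torus) measurable
    have "L1_norm torus_measure (\<lambda>\<eta>. F \<eta> z)
      \<le> (\<integral>\<^sup>+ \<eta>. ennreal (2 * C / cmod z) * ennreal (dyadic_profile \<theta> (norm \<eta> / (1 / \<mu>)) / norm (\<eta> :: real ^ 'n) ^ CARD('n)) \<partial>torus_measure)"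
      unfolding L1_norm_def
    proof (rule nn_integral_mono_AE)
      have "AE \<eta> in torus_measure. \<eta> \<in> (torus :: (real ^ 'n) set)"
        by (rule AE_I2) (simp add: torus_measure_def space_restrict_space space_scale_measure)
      with null show "AE \<eta> in torus_measure. ennreal (norm (F \<eta> z))
        \<le> ennreal (2 * C / cmod z) * ennreal (dyadic_profile \<theta> (norm \<eta> / (1 / \<mu>)) / norm (\<eta> :: real ^ 'n) ^ CARD('n))"
      proof eventually_elim
        case (elim \<eta>)
        from pt[OF this(2,1)] show ?case
          using z0 assms by (subst ennreal_mult[symmetric])
            (auto intro!: ennreal_leI divide_nonneg_nonneg dyadic_profile_nonneg)
      qed
    qed
    also have "\<dots> = ennreal (2 * C / cmod z) *
        (\<integral>\<^sup>+ \<eta>. ennreal (dyadic_profile \<theta> (norm \<eta> / (1 / \<mu>)) / norm (\<eta> :: real ^ 'n) ^ CARD('n)) \<partial>torus_measure)"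
      by (rule nn_integral_cmult[OF meas])
    also have "\<dots> \<le> ennreal (2 * C / cmod z) * ennreal I"
      unfolding I_def using \<mu> \<theta> by (intro mult_left_mono nn_integral_torus_dyadic_le) auto
    finally have "ennreal (cmod z) * L1_norm torus_measure (\<lambda>\<eta>. F \<eta> z)
        \<le> ennreal (cmod z) * (ennreal (2 * C / cmod z) * ennreal I)"
      by (rule mult_left_mono) simp
    also have "\<dots> = ennreal (cmod z * (2 * C / cmod z * I))"
      using z0 assms I by (simp flip: ennreal_mult)
    also have "cmod z * (2 * C / cmod z * I) = 2 * C * I" using z0 by simp
    finally show ?thesis .
  qed
  then show ?thesis
    using I assms by (intro exI[of _ "2 * C * I"]) (auto simp: L1_estimate_def)
qed


section \<open>Strong measurability\<close>

text \<open>The \<open>i\<close>-th approximation sends \<open>x\<close> to a point nearest to \<open>f x\<close> among the first \<open>i + 1\<close> points of a dense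
sequence. Measurability is required only for the distances to these points, so that the codomain need not be
separable.\<close>

lemma strongly_measurable_separable:
  fixes f :: "'a \<Rightarrow> 'b::metric_space"
  assumes D: "countable D" "\<And>x. x \<in> space M \<Longrightarrow> f x \<in> closure D"
    and meas: "\<And>d. d \<in> D \<Longrightarrow> (\<lambda>x. dist (f x) d) \<in> borel_measurable M"
  shows "strongly_measurable M f"
proof (cases "space M = {}")
  case True
  then show ?thesis
    unfolding strongly_measurable_def by (intro exI[of _ "\<lambda>_ _. undefined"]) auto
next
  case False
  then have "D \<noteq> {}" using D(2) by fastforce
  define d where "d = from_nat_into D"
  have d: "d k \<in> D" for k using \<open>D \<noteq> {}\<close> by (simp add: d_def from_nat_into)
  have range_d: "range d = D" using D(1) \<open>D \<noteq> {}\<close> by (simp add: d_def)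
  have [measurable]: "(\<lambda>x. dist (f x) (d k)) \<in> borel_measurable M" for k
    by (rule meas[OF d])
  let ?P = "\<lambda>i x k. k \<le> i \<and> (\<forall>l\<le>i. dist (f x) (d k) \<le> dist (f x) (d l))"
  define index where "index i x = (LEAST k. ?P i x k)" for i :: nat and x
  have index: "?P i x (index i x)" for i x
  proof -
    have "\<exists>k\<in>{..i}. \<forall>l\<in>{..i}. dist (f x) (d k) \<le> dist (f x) (d l)"
      using ex_is_arg_min_if_finite[of "{..i}" "\<lambda>k. dist (f x) (d k)"]
      by (auto simp: is_arg_min_linorder)
    then have "\<exists>k. ?P i x k" by auto
    then show ?thesis unfolding index_def by (rule LeastI_ex)
  qed
  have "simple_function M (index i)" for i
    unfolding simple_function_eq_measurable
  proof
    show "finite (index i ` space M)"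
      by (rule finite_subset[of _ "{..i}"]) (use index in auto)
    show "index i \<in> measurable M (count_space UNIV)"
      unfolding index_def by measurable
  qed
  then have "simple_function M (\<lambda>x. d (index i x))" for i
    by (rule simple_function_compose1)
  moreover have "(\<lambda>i. d (index i x)) \<longlonglongrightarrow> f x" if x: "x \<in> space M" for x
  proof (rule metric_LIMSEQ_I)
    fix e :: real assume "0 < e"
    then obtain y where "y \<in> D" "dist y (f x) < e"
      using D(2)[OF x] by (auto simp: closure_approachable)
    then obtain k where k: "dist (f x) (d k) < e"
      using range_d by (metis dist_commute imageE)
    have "dist (d (index i x)) (f x) < e" if "k \<le> i" for i
      using index[of i x] that k by (metis dist_commute le_less_trans)
    then show "\<exists>k. \<forall>i\<ge>k. dist (d (index i x)) (f x) < e" by blast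
  qed
  ultimately show ?thesis
    unfolding strongly_measurable_def by (intro exI[of _ "\<lambda>i x. d (index i x)"]) auto
qed

text \<open>A continuous function on a subset of a separable metric space has separable range, and a pointwise limit of countably
many such functions takes values in the closure of the union of their countable dense subsets. The functions need to be
continuous on \<open>S\<close> only; the constant \<open>c\<close> outside of \<open>S\<close> takes care of the singularity of the kernel.\<close>

lemma strongly_measurable_limit:
  fixes f :: "'a::{metric_space, second_countable_topology} \<Rightarrow> 'b::metric_space"
  assumes S: "S \<in> sets borel" and M: "(\<lambda>x. x) \<in> measurable M borel"
    and cont: "\<And>i::nat. continuous_on S (F i)"
    and lim: "\<And>x. x \<in> S \<Longrightarrow> (\<lambda>i. F i x) \<longlonglongrightarrow> f x"
    and outside: "\<And>x. x \<notin> S \<Longrightarrow> f x = c"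
  shows "strongly_measurable M f"
proof -
  obtain T where T: "countable T" "T \<subseteq> S" "S \<subseteq> closure T" by (rule separable)
  define D where "D = insert c (\<Union>i. F i ` T)"
  have dense: "F i x \<in> closure D" if "x \<in> S" for i x
  proof -
    have "F i ` (S \<inter> closure T) \<subseteq> closure (F i ` T)"
    proof
      fix y assume "y \<in> F i ` (S \<inter> closure T)"
      then obtain x where x: "y = F i x" "x \<in> S" "x \<in> closure T" by auto
      show "y \<in> closure (F i ` T)"
        unfolding closure_approachable
      proof (intro allI impI)
        fix e :: real assume "0 < e"
        with cont[of i] x(2) obtain \<delta> where \<delta>: "0 < \<delta>"
          "\<And>x'. x' \<in> S \<Longrightarrow> dist x' x < \<delta> \<Longrightarrow> dist (F i x') (F i x) < e"
          unfolding continuous_on_iff by meson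
        obtain t where "t \<in> T" "dist t x < \<delta>"
          using x(3) \<delta>(1) by (auto simp: closure_approachable)
        then show "\<exists>y'\<in>F i ` T. dist y' y < e"
          using \<delta>(2) T(2) x(1) by auto
      qed
    qed
    moreover have "closure (F i ` T) \<subseteq> closure D"
      by (rule closure_mono) (auto simp: D_def)
    ultimately show ?thesis using that T(3) by blast
  qed
  show ?thesis
  proof (rule strongly_measurable_separable)
    show "countable D" unfolding D_def using T(1) by auto
    show "f x \<in> closure D" for x
    proof (cases "x \<in> S")
      case True
      then show ?thesis
        by (intro closed_sequentially[OF closed_closure _ lim] dense)
    next
      case False
      then have "f x \<in> D" by (simp add: outside D_def)
      then show ?thesis using closure_subset by blast
    qed
    fix d
    let ?g = "\<lambda>i x. if x \<in> S then dist (F i x) d else dist c d"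
    have "(\<lambda>x. dist (f x) d) \<in> borel_measurable borel"
    proof (rule borel_measurable_LIMSEQ_real)
      show "?g i \<in> borel_measurable borel" for i
        by (intro borel_measurable_continuous_on_if S continuous_intros cont)
      show "(\<lambda>i. ?g i x) \<longlonglongrightarrow> dist (f x) d" for x
        by (cases "x \<in> S") (simp_all add: outside tendsto_dist[OF lim tendsto_const])
    qed
    from measurable_compose[OF M this]
    show "(\<lambda>x. dist (f x) d) \<in> borel_measurable M" .
  qed
qed


section \<open>Characters\<close>

definition character :: "int ^ 'n::finite \<Rightarrow> real ^ 'n \<Rightarrow> complex"
  where "character k \<eta> = exp (\<i> * complex_of_real (rvec k \<bullet> \<eta>))"

lemma norm_character [simp]: "cmod (character k \<eta>) = 1"
  by (simp add: character_def)

text \<open>Moving the argument of a character by one lattice step costs a unimodular factor; this turns the reindexing of a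
trigonometric series into summation by parts.\<close>

lemma character_shift:
  "character k \<eta> = exp (\<i> * complex_of_real (- (\<eta> $ j))) * character (k + axis j 1) \<eta>"
  by (simp add: character_def rvec_add rvec_axis inner_add_left inner_axis' distrib_left flip: exp_add)

text \<open>A lower bound for \<open>|2 sin (t/2)|\<close> on one period; \<open>x - x\<^sup>3/6 \<ge> x/2\<close> holds up to \<open>x = sqrt 3\<close>, which
exceeds \<open>\<pi>/2\<close>.\<close>

lemma cmod_exp_minus_one_ge:
  assumes "\<bar>t\<bar> \<le> pi"
  shows "\<bar>t\<bar> / 2 \<le> cmod (exp (\<i> * complex_of_real t) - 1)"
proof -
  define x where "x = \<bar>t\<bar> / 2"
  have x: "0 \<le> x" "x \<le> 8 / 5" using assms pi_less_4 pi_approx by (auto simp: x_def)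
  have "\<bar>sin x - (\<Sum>i<3. sin_coeff i * x ^ i)\<bar> \<le> inverse (fact 3) * \<bar>x\<bar> ^ 3"
    by (rule Maclaurin_sin_bound)
  moreover have "(\<Sum>i<3. sin_coeff i * x ^ i) = x"
    by (simp add: numeral_3_eq_3 sin_coeff_def)
  moreover have "inverse (fact 3) * \<bar>x\<bar> ^ 3 = x ^ 3 / 6"
    using x by (simp add: fact_numeral)
  ultimately have "x - x ^ 3 / 6 \<le> sin x"
    by linarith
  moreover have "x ^ 3 \<le> 3 * x"
  proof -
    have "x * x \<le> (8 / 5) * (8 / 5)" using x by (intro mult_mono) auto
    then have "x * (x * x) \<le> x * 3" using x by (intro mult_left_mono) auto
    then show ?thesis by (simp add: power3_eq_cube mult_ac)
  qed
  ultimately have "x / 2 \<le> sin x" by simp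
  also have "\<dots> \<le> \<bar>sin (t / 2)\<bar>" by (cases "0 \<le> t") (auto simp: x_def)
  finally show ?thesis unfolding dist_exp_i_1 by (simp add: x_def)
qed

text \<open>Interpolation between the bounds \<open>|t|\<close> and \<open>2\<close>.\<close>

lemma cmod_exp_minus_one_le:
  assumes "0 \<le> \<tau>" and "\<tau> \<le> 1"
  shows "cmod (exp (\<i> * complex_of_real t) - 1) \<le> 2 * \<bar>t\<bar> powr \<tau>"
proof (cases "t = 0")
  case False
  have "\<bar>sin (t / 2)\<bar> \<le> \<bar>t / 2\<bar>" by (rule abs_sin_x_le_abs_x)
  show ?thesis
  proof (cases "\<bar>t\<bar> \<le> 1")
    case True
    then have "\<bar>t\<bar> powr 1 \<le> \<bar>t\<bar> powr \<tau>" using False assms by (intro powr_mono') auto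
    then show ?thesis
      unfolding dist_exp_i_1 using False \<open>\<bar>sin (t / 2)\<bar> \<le> \<bar>t / 2\<bar>\<close> by simp
  next
    case False
    then have "1 \<le> \<bar>t\<bar> powr \<tau>" using assms by (intro ge_one_powr_ge_zero) auto
    moreover have "\<bar>sin (t / 2)\<bar> \<le> 1" by (rule abs_sin_le_one)
    ultimately have "\<bar>sin (t / 2)\<bar> \<le> \<bar>t\<bar> powr \<tau>" by (rule order_trans[rotated])
    then show ?thesis unfolding dist_exp_i_1 by simp
  qed
qed simp


section \<open>Trigonometric series and summation by parts\<close>

definition torus_series :: "(int ^ 'n::finite \<Rightarrow> 'v::complex_banach) \<Rightarrow> real ^ 'n \<Rightarrow> 'v"
  where "torus_series p \<eta> = (\<Sum>\<^sub>\<infinity>k. character k \<eta> *\<^sub>C p k)"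

lemma norm_character_scaleC [simp]: "norm (character k \<eta> *\<^sub>C x) = norm x"
  by (simp add: norm_scaleC)

lemma bij_shift: "bij (\<lambda>k :: int ^ 'n::finite. k + l)"
  by (rule bij_betw_byWitness[of _ "\<lambda>k. k - l"]) auto

lemma abs_summable_diff_op:
  fixes p :: "int ^ 'n::finite \<Rightarrow> 'v::real_normed_vector"
  assumes "p abs_summable_on UNIV"
  shows "diff_op j p abs_summable_on UNIV"
proof (rule summable_on_comparison_test)
  have "(\<lambda>k. norm (p (k + axis j 1))) summable_on UNIV"
    using assms summable_on_reindex_bij_betw[OF bij_shift, of "\<lambda>k. norm (p k)" "axis j 1"] by simp
  then show "(\<lambda>k. norm (p (k + axis j 1)) + norm (p k)) summable_on UNIV"
    using assms by (rule summable_on_add)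
  show "norm (diff_op j p k) \<le> norm (p (k + axis j 1)) + norm (p k)" for k
    unfolding diff_op_def by (rule norm_triangle_ineq4)
qed simp

lemma abs_summable_diff_op_funpow:
  fixes p :: "int ^ 'n::finite \<Rightarrow> 'v::real_normed_vector"
  assumes "p abs_summable_on UNIV"
  shows "(diff_op j ^^ N) p abs_summable_on UNIV"
  by (induction N) (use assms in \<open>auto intro: abs_summable_diff_op\<close>)

lemma torus_series_diff_op:
  fixes p :: "int ^ 'n::finite \<Rightarrow> 'v::complex_banach"
  assumes "p abs_summable_on UNIV"
  shows "torus_series (diff_op j p) \<eta> = (exp (\<i> * complex_of_real (- (\<eta> $ j))) - 1) *\<^sub>C torus_series p \<eta>"
proof -
  let ?c = "exp (\<i> * complex_of_real (- (\<eta> $ j)))"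
  let ?f = "\<lambda>k. character k \<eta> *\<^sub>C p k"
  have s: "?f summable_on UNIV"
    by (rule abs_summable_summable) (use assms in simp)
  have s1: "(\<lambda>k. ?f (k + axis j 1)) summable_on UNIV"
    using s summable_on_reindex_bij_betw[OF bij_shift, of ?f "axis j 1"] by simp
  have s2: "(\<lambda>k. ?c *\<^sub>C ?f (k + axis j 1)) summable_on UNIV"
    by (rule summable_on_bounded_linear[OF bounded_linear_scaleC s1])
  have s3: "(\<lambda>k. (- 1) *\<^sub>C ?f k) summable_on UNIV"
    by (rule summable_on_bounded_linear[OF bounded_linear_scaleC s])
  have "character k \<eta> *\<^sub>C diff_op j p k = ?c *\<^sub>C ?f (k + axis j 1) + (- 1) *\<^sub>C ?f k" for k
  proof -
    have "character k \<eta> *\<^sub>C diff_op j p k = character k \<eta> *\<^sub>C p (k + axis j 1) - ?f k"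
      by (simp add: diff_op_def scaleC_simps)
    also have "character k \<eta> *\<^sub>C p (k + axis j 1) = ?c *\<^sub>C ?f (k + axis j 1)"
      by (subst character_shift[of k \<eta> j]) (simp add: scaleC_scaleC)
    also have "\<dots> - ?f k = ?c *\<^sub>C ?f (k + axis j 1) + (- 1) *\<^sub>C ?f k"
      using scaleC_of_real[of "- 1" "?f k"] by simp
    finally show ?thesis .
  qed
  then have "torus_series (diff_op j p) \<eta>
      = (\<Sum>\<^sub>\<infinity>k. ?c *\<^sub>C ?f (k + axis j 1)) + (\<Sum>\<^sub>\<infinity>k. (- 1) *\<^sub>C ?f k)"
    unfolding torus_series_def by (simp only: infsum_add[OF s2 s3])
  also have "(\<Sum>\<^sub>\<infinity>k. ?c *\<^sub>C ?f (k + axis j 1)) = ?c *\<^sub>C (\<Sum>\<^sub>\<infinity>k. ?f (k + axis j 1))"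
    using s1 s2 by (intro infsum_bounded_linear_strong bounded_linear_scaleC) simp
  also have "(\<Sum>\<^sub>\<infinity>k. ?f (k + axis j 1)) = torus_series p \<eta>"
    unfolding torus_series_def by (rule infsum_reindex_bij_betw[OF bij_shift])
  also have "(\<Sum>\<^sub>\<infinity>k. (- 1) *\<^sub>C ?f k) = (- 1) *\<^sub>C torus_series p \<eta>"
    unfolding torus_series_def using s s3
    by (intro infsum_bounded_linear_strong bounded_linear_scaleC) simp
  also have "?c *\<^sub>C torus_series p \<eta> + (- 1) *\<^sub>C torus_series p \<eta> = (?c - 1) *\<^sub>C torus_series p \<eta>"
    by (simp flip: scaleC_add_left)
  finally show ?thesis .
qed

lemma torus_series_diff_op_funpow:
  fixes p :: "int ^ 'n::finite \<Rightarrow> 'v::complex_banach"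
  assumes "p abs_summable_on UNIV"
  shows "torus_series ((diff_op j ^^ N) p) \<eta>
    = (exp (\<i> * complex_of_real (- (\<eta> $ j))) - 1) ^ N *\<^sub>C torus_series p \<eta>"
proof (induction N)
  case 0
  show ?case using scaleC_of_real[of 1 "torus_series p \<eta>"] by simp
next
  case (Suc N)
  then show ?case
    by (simp add: torus_series_diff_op[OF abs_summable_diff_op_funpow[OF assms]] scaleC_scaleC)
qed

text \<open>Here the cancellation enters: for \<open>N > 0\<close> the series of the \<open>N\<close>-th difference vanishes at the origin, because the
factor \<open>exp (-i \<eta>\<^sub>j) - 1\<close> does. Subtracting this value replaces every character by its difference to \<open>1\<close>, which
gains \<open>(|k||\<eta>|) powr \<tau>\<close>.\<close>

lemma norm_torus_series_diff_le:
  fixes p :: "int ^ 'n::finite \<Rightarrow> 'v::complex_banach"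
  assumes p: "p abs_summable_on UNIV" and N: "0 < N" and \<tau>: "0 \<le> \<tau>" "\<tau> \<le> 1"
    and g: "g summable_on UNIV"
    and bound: "\<And>k. norm ((diff_op j ^^ N) p k) * norm (rvec k) powr \<tau> \<le> g k"
  shows "norm (torus_series ((diff_op j ^^ N) p) \<eta>) \<le> 2 * norm \<eta> powr \<tau> * (\<Sum>\<^sub>\<infinity>k. g k)"
proof -
  define q where "q = (diff_op j ^^ N) p"
  have q: "q abs_summable_on UNIV" unfolding q_def by (rule abs_summable_diff_op_funpow[OF p])
  have zero: "torus_series q 0 = 0"
  proof -
    have "torus_series q 0 = (0 :: complex) *\<^sub>C torus_series p 0"
      unfolding q_def torus_series_diff_op_funpow[OF p] using N by (simp add: power_0_left)
    then show ?thesis using scaleC_of_real[of 0 "torus_series p 0"] by simp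
  qed
  have s: "(\<lambda>k. character k \<eta> *\<^sub>C q k) summable_on UNIV" for \<eta>
    by (rule abs_summable_summable) (use q in simp)
  have "torus_series q \<eta> = torus_series q \<eta> + (- 1) *\<^sub>C torus_series q 0"
    using scaleC_of_real[of "- 1" "torus_series q 0"] zero by simp
  also have "(- 1) *\<^sub>C torus_series q 0 = (\<Sum>\<^sub>\<infinity>k. (- 1) *\<^sub>C (character k 0 *\<^sub>C q k))"
    unfolding torus_series_def
    using s summable_on_bounded_linear[OF bounded_linear_scaleC s]
    by (intro infsum_bounded_linear_strong[symmetric] bounded_linear_scaleC) simp
  also have "torus_series q \<eta> + \<dots> = (\<Sum>\<^sub>\<infinity>k. character k \<eta> *\<^sub>C q k + (- 1) *\<^sub>C (character k 0 *\<^sub>C q k))"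
    unfolding torus_series_def
    by (rule infsum_add[symmetric, OF s summable_on_bounded_linear[OF bounded_linear_scaleC s]])
  also have "\<dots> = (\<Sum>\<^sub>\<infinity>k. (character k \<eta> - 1) *\<^sub>C q k)"
    by (simp add: scaleC_scaleC character_def flip: scaleC_add_left)
  finally have eq: "torus_series q \<eta> = (\<Sum>\<^sub>\<infinity>k. (character k \<eta> - 1) *\<^sub>C q k)" .
  have le: "norm ((character k \<eta> - 1) *\<^sub>C q k) \<le> 2 * norm \<eta> powr \<tau> * g k" for k
  proof -
    have "cmod (character k \<eta> - 1) \<le> 2 * \<bar>rvec k \<bullet> \<eta>\<bar> powr \<tau>"
      unfolding character_def by (rule cmod_exp_minus_one_le[OF \<tau>])
    also have "\<dots> \<le> 2 * (norm (rvec k) * norm \<eta>) powr \<tau>"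
      using Cauchy_Schwarz_ineq2[of "rvec k" \<eta>] \<tau> by (intro mult_left_mono powr_mono2) auto
    also have "\<dots> = 2 * norm \<eta> powr \<tau> * norm (rvec k) powr \<tau>"
      by (simp add: powr_mult)
    finally have "norm ((character k \<eta> - 1) *\<^sub>C q k) \<le> 2 * norm \<eta> powr \<tau> * norm (rvec k) powr \<tau> * norm (q k)"
      unfolding norm_scaleC by (rule mult_right_mono) simp
    also have "\<dots> = 2 * norm \<eta> powr \<tau> * (norm (q k) * norm (rvec k) powr \<tau>)" by simp
    also have "\<dots> \<le> 2 * norm \<eta> powr \<tau> * g k"
      using bound by (intro mult_left_mono) (auto simp: q_def)
    finally show ?thesis .
  qed
  have g': "(\<lambda>k. 2 * norm \<eta> powr \<tau> * g k) summable_on UNIV"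
    by (rule summable_on_cmult_right[OF g])
  have abs: "(\<lambda>k. (character k \<eta> - 1) *\<^sub>C q k) abs_summable_on UNIV"
    by (rule summable_on_comparison_test[OF g' le]) simp
  have "norm (torus_series q \<eta>) \<le> (\<Sum>\<^sub>\<infinity>k. norm ((character k \<eta> - 1) *\<^sub>C q k))"
    unfolding eq by (rule norm_infsum_bound[OF abs])
  also have "\<dots> \<le> (\<Sum>\<^sub>\<infinity>k. 2 * norm \<eta> powr \<tau> * g k)"
    by (rule infsum_mono[OF abs g' le])
  also have "\<dots> = 2 * norm \<eta> powr \<tau> * (\<Sum>\<^sub>\<infinity>k. g k)"
    by (rule infsum_cmult_right) (rule g)
  finally show ?thesis by (simp add: q_def)
qed

text \<open>The only property of the kernel symbol that enters the pointwise estimate.\<close>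

definition dyadic_decay :: "real \<Rightarrow> real \<Rightarrow> real \<Rightarrow> (int ^ 'n::finite \<Rightarrow> 'v::real_normed_vector) \<Rightarrow> bool"
  where "dyadic_decay \<alpha> \<mu> A p \<longleftrightarrow> (\<forall>N\<in>{CARD('n), CARD('n) + 1}. \<forall>j k.
    norm ((diff_op j ^^ N) p k) \<le> A * (dyadic_profile \<alpha> (bracket (rvec k) / \<mu>) / bracket (rvec k) ^ N))"

text \<open>Half of the decay of the profile pays for one factor \<open>r powr \<plusminus>\<theta>\<close>.\<close>

lemma dyadic_profile_shift:
  assumes "0 < r" and "0 < \<theta>" and "\<sigma> = \<theta> \<or> \<sigma> = - \<theta>"
  shows "r powr \<sigma> * dyadic_profile (2 * \<theta>) r \<le> dyadic_profile \<theta> r"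
proof (cases "r \<le> 1")
  case True
  then have "dyadic_profile (2 * \<theta>) r = r powr (2 * \<theta>)" "dyadic_profile \<theta> r = r powr \<theta>"
    using assms by (auto simp: dyadic_profile_def intro!: min_absorb1 powr_mono')
  moreover have "r powr (\<sigma> + 2 * \<theta>) \<le> r powr \<theta>"
    using assms True by (intro powr_mono') auto
  ultimately show ?thesis by (simp add: powr_add)
next
  case False
  then have "dyadic_profile (2 * \<theta>) r = r powr (- (2 * \<theta>))" "dyadic_profile \<theta> r = r powr (- \<theta>)"
    using assms by (auto simp: dyadic_profile_def intro!: min_absorb2 powr_mono)
  moreover have "r powr (\<sigma> + - (2 * \<theta>)) \<le> r powr (- \<theta>)"
    using assms False by (intro powr_mono) auto
  ultimately show ?thesis by (simp only: powr_add)
qed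

lemma torus_component_ge:
  fixes \<eta> :: "real ^ 'n::finite"
  obtains j where "norm \<eta> \<le> real CARD('n) * \<bar>\<eta> $ j\<bar>"
proof -
  have "\<exists>j\<in>UNIV. \<forall>i\<in>UNIV. \<bar>\<eta> $ i\<bar> \<le> \<bar>\<eta> $ j\<bar>"
    using ex_is_arg_min_if_finite[of "UNIV :: 'n set" "\<lambda>i. - \<bar>\<eta> $ i\<bar>"]
    by (auto simp: is_arg_min_linorder)
  then obtain j where j: "\<And>i. \<bar>\<eta> $ i\<bar> \<le> \<bar>\<eta> $ j\<bar>" by auto
  have "norm \<eta> \<le> (\<Sum>i\<in>UNIV. \<bar>\<eta> $ i\<bar>)" by (rule norm_le_l1_cart)
  also have "\<dots> \<le> real CARD('n) * \<bar>\<eta> $ j\<bar>"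
    using sum_bounded_above[of UNIV "\<lambda>i. \<bar>\<eta> $ i\<bar>" "\<bar>\<eta> $ j\<bar>"] j by simp
  finally show ?thesis by (rule that)
qed

text \<open>One of the two bounds of the kernel. The relation between \<open>\<tau>\<close>, \<open>N\<close> and \<open>\<sigma>\<close> says that
\<open>\<langle>k\<rangle> powr \<tau> / \<langle>k\<rangle>\<^sup>N = \<mu> powr \<sigma> r powr \<sigma> / \<langle>k\<rangle>\<^sup>n\<close>, so that the remaining sum over the lattice is
scale invariant.\<close>

lemma kernel_bound_aux:
  fixes p :: "int ^ 'n::finite \<Rightarrow> 'v::complex_banach"
  assumes p: "p abs_summable_on UNIV" and N: "0 < N" and \<theta>: "0 < \<theta>" "\<theta> \<le> 1 / 2" and \<mu>: "0 < \<mu>"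
    and \<sigma>: "\<sigma> = \<theta> \<or> \<sigma> = - \<theta>" and \<tau>: "0 \<le> \<tau>" "\<tau> \<le> 1" "\<tau> = real N - real CARD('n) + \<sigma>"
    and A: "0 \<le> A"
    and bound: "\<And>j k. norm ((diff_op j ^^ N) p k)
      \<le> A * (dyadic_profile (2 * \<theta>) (bracket (rvec k) / \<mu>) / bracket (rvec k) ^ N)"
    and S: "(\<lambda>k :: int ^ 'n. dyadic_profile \<theta> (bracket (rvec k) / \<mu>) / bracket (rvec k) ^ CARD('n)) summable_on UNIV"
      "(\<Sum>\<^sub>\<infinity>k :: int ^ 'n. dyadic_profile \<theta> (bracket (rvec k) / \<mu>) / bracket (rvec k) ^ CARD('n)) \<le> S"
    and \<eta>: "\<eta> \<in> torus"
  shows "norm \<eta> ^ N * norm (torus_series p \<eta>)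
    \<le> (2 * real CARD('n)) ^ N * (2 * A * S) * (norm \<eta> powr \<tau> * \<mu> powr \<sigma>)"
proof -
  obtain j where j: "norm \<eta> \<le> real CARD('n) * \<bar>\<eta> $ j\<bar>" by (rule torus_component_ge)
  let ?h = "\<lambda>k :: int ^ 'n. dyadic_profile \<theta> (bracket (rvec k) / \<mu>) / bracket (rvec k) ^ CARD('n)"
  have g: "norm ((diff_op j ^^ N) p k) * norm (rvec k) powr \<tau> \<le> A * \<mu> powr \<sigma> * ?h k" for k
  proof -
    define b where "b = bracket (rvec k)"
    define r where "r = b / \<mu>"
    have b: "0 < b" by (simp add: b_def bracket_pos)
    have r: "0 < r" using b \<mu> by (simp add: r_def)
    have "norm ((diff_op j ^^ N) p k) * norm (rvec k) powr \<tau>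
        \<le> A * (dyadic_profile (2 * \<theta>) r / b ^ N) * b powr \<tau>"
      unfolding b_def r_def using \<tau>(1)
      by (intro mult_mono bound powr_mono2 norm_le_bracket mult_nonneg_nonneg A divide_nonneg_nonneg
          dyadic_profile_nonneg zero_le_power less_imp_le[OF bracket_pos]) auto
    also have "b powr \<tau> = b ^ N / b ^ CARD('n) * (\<mu> powr \<sigma> * r powr \<sigma>)"
      using b \<mu> unfolding \<tau>(3) r_def by (simp add: powr_add powr_diff powr_realpow powr_divide)
    also have "A * (dyadic_profile (2 * \<theta>) r / b ^ N) * (b ^ N / b ^ CARD('n) * (\<mu> powr \<sigma> * r powr \<sigma>))
        = A * \<mu> powr \<sigma> * ((r powr \<sigma> * dyadic_profile (2 * \<theta>) r) / b ^ CARD('n))"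
      using b by simp
    also have "\<dots> \<le> A * \<mu> powr \<sigma> * (dyadic_profile \<theta> r / b ^ CARD('n))"
      using A b by (intro mult_left_mono divide_right_mono dyadic_profile_shift r \<theta> \<sigma>) auto
    finally show ?thesis by (simp add: b_def r_def)
  qed
  have "norm (torus_series ((diff_op j ^^ N) p) \<eta>)
      \<le> 2 * norm \<eta> powr \<tau> * (\<Sum>\<^sub>\<infinity>k. A * \<mu> powr \<sigma> * ?h k)"
    by (rule norm_torus_series_diff_le[OF p N \<tau>(1,2) summable_on_cmult_right[OF S(1)] g])
  also have "(\<Sum>\<^sub>\<infinity>k. A * \<mu> powr \<sigma> * ?h k) = A * \<mu> powr \<sigma> * (\<Sum>\<^sub>\<infinity>k. ?h k)"
    by (rule infsum_cmult_right) (rule S(1))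
  also have "2 * norm \<eta> powr \<tau> * \<dots> \<le> 2 * norm \<eta> powr \<tau> * (A * \<mu> powr \<sigma> * S)"
    using A by (intro mult_left_mono S(2)) auto
  finally have upper: "norm (torus_series ((diff_op j ^^ N) p) \<eta>)
      \<le> 2 * norm \<eta> powr \<tau> * (A * \<mu> powr \<sigma> * S)" .
  have "\<bar>\<eta> $ j\<bar> \<le> pi" using \<eta> by (auto simp: torus_def abs_le_iff minus_le_iff intro: less_imp_le)
  then have "\<bar>\<eta> $ j\<bar> / 2 \<le> cmod (exp (\<i> * complex_of_real (- (\<eta> $ j))) - 1)"
    using cmod_exp_minus_one_ge[of "- (\<eta> $ j)"] by simp
  moreover have "norm \<eta> / (2 * real CARD('n)) \<le> \<bar>\<eta> $ j\<bar> / 2"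
    using j by (simp add: field_simps)
  ultimately have "norm \<eta> / (2 * real CARD('n)) \<le> cmod (exp (\<i> * complex_of_real (- (\<eta> $ j))) - 1)"
    by linarith
  then have "(norm \<eta> / (2 * real CARD('n))) ^ N \<le> cmod (exp (\<i> * complex_of_real (- (\<eta> $ j))) - 1) ^ N"
    by (rule power_mono) simp
  then have "(norm \<eta> / (2 * real CARD('n))) ^ N * norm (torus_series p \<eta>)
      \<le> norm (torus_series ((diff_op j ^^ N) p) \<eta>)"
    unfolding torus_series_diff_op_funpow[OF p] norm_scaleC norm_power by (rule mult_right_mono) simp
  also note upper
  finally have "(2 * real CARD('n)) ^ N * ((norm \<eta> / (2 * real CARD('n))) ^ N * norm (torus_series p \<eta>))
      \<le> (2 * real CARD('n)) ^ N * (2 * norm \<eta> powr \<tau> * (A * \<mu> powr \<sigma> * S))"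
    by (rule mult_left_mono) simp
  then show ?thesis by (simp add: power_divide mult_ac)
qed

text \<open>The case \<open>N = n\<close>, \<open>\<tau> = \<sigma> = \<theta>\<close> bounds \<open>|\<eta>|\<^sup>n |K|\<close> by \<open>(\<mu>|\<eta>|) powr \<theta>\<close>; the case
\<open>N = n + 1\<close>, \<open>\<tau> = 1 - \<theta>\<close>, \<open>\<sigma> = -\<theta>\<close>, multiplied by \<open>\<mu>\<close>, bounds \<open>\<mu>|\<eta>| |\<eta>|\<^sup>n |K|\<close> by
\<open>(\<mu>|\<eta>|) powr (1 - \<theta>)\<close>. The sum of the two is the claim.\<close>

lemma kernel_bound:
  assumes \<theta>: "0 < \<theta>" "\<theta> \<le> 1 / 2"
  shows "\<exists>C\<ge>0. \<forall>(p :: int ^ 'n::finite \<Rightarrow> 'v::complex_banach) \<mu> A \<eta>.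
    p abs_summable_on UNIV \<longrightarrow> 0 < \<mu> \<longrightarrow> 0 \<le> A \<longrightarrow>
    dyadic_decay (2 * \<theta>) \<mu> A p \<longrightarrow> \<eta> \<in> torus - {0} \<longrightarrow>
    norm (torus_series p \<eta>) \<le> C * A * ((\<mu> powr \<theta> * norm \<eta> powr \<theta> + \<mu> powr (1 - \<theta>) * norm \<eta> powr (1 - \<theta>))
      / (norm \<eta> ^ CARD('n) * (1 + \<mu> * norm \<eta>)))"
proof -
  let ?n = "CARD('n)"
  obtain S where S0: "0 \<le> S" and S: "\<And>\<mu>. 0 < \<mu> \<Longrightarrow>
    (\<lambda>k :: int ^ 'n. dyadic_profile \<theta> (bracket (rvec k) / \<mu>) / bracket (rvec k) ^ ?n) summable_on UNIV"
    "\<And>\<mu>. 0 < \<mu> \<Longrightarrow> (\<Sum>\<^sub>\<infinity>k :: int ^ 'n. dyadic_profile \<theta> (bracket (rvec k) / \<mu>) / bracket (rvec k) ^ ?n) \<le> S"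
    using lattice_sum_le[OF \<theta>(1), where 'n='n] by auto
  define C where "C = (2 * real ?n) ^ (?n + 1) * (2 * S)"
  have C0: "0 \<le> C" using S0 by (simp add: C_def)
  have "norm (torus_series p \<eta>) \<le> C * A * ((\<mu> powr \<theta> * norm \<eta> powr \<theta> + \<mu> powr (1 - \<theta>) * norm \<eta> powr (1 - \<theta>))
      / (norm \<eta> ^ ?n * (1 + \<mu> * norm \<eta>)))"
    if p: "p abs_summable_on UNIV" and \<mu>: "0 < \<mu>" and A: "0 \<le> A"
    and decay: "dyadic_decay (2 * \<theta>) \<mu> A p"
    and \<eta>: "\<eta> \<in> torus" "\<eta> \<noteq> 0"
    for p :: "int ^ 'n \<Rightarrow> 'v" and \<mu> A \<eta>
  proof -
    have bound: "norm ((diff_op j ^^ N) p k)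
      \<le> A * (dyadic_profile (2 * \<theta>) (bracket (rvec k) / \<mu>) / bracket (rvec k) ^ N)"
      if "N \<in> {?n, ?n + 1}" for N j k
      using decay that unfolding dyadic_decay_def by blast
    define x where "x = norm \<eta>"
    define K where "K = norm (torus_series p \<eta>)"
    have x: "0 < x" using \<eta>(2) by (simp add: x_def)
    have "x ^ ?n * K \<le> (2 * real ?n) ^ ?n * (2 * A * S) * (x powr \<theta> * \<mu> powr \<theta>)"
      unfolding x_def K_def
      by (rule kernel_bound_aux[OF p _ \<theta> \<mu> _ _ _ _ A bound S[OF \<mu>] \<eta>(1)]) (use \<theta> in auto)
    also have "\<dots> \<le> (2 * real ?n) ^ (?n + 1) * (2 * A * S) * (x powr \<theta> * \<mu> powr \<theta>)"
    proof -
      have "1 \<le> 2 * real ?n" using zero_less_card_finite[where 'a='n] by linarith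
      then show ?thesis
        using A S0 by (intro mult_right_mono power_increasing) auto
    qed
    finally have low: "x ^ ?n * K \<le> C * A * (\<mu> powr \<theta> * x powr \<theta>)"
      by (simp add: C_def mult_ac)
    have "x ^ (?n + 1) * K \<le> (2 * real ?n) ^ (?n + 1) * (2 * A * S) * (x powr (1 - \<theta>) * \<mu> powr (- \<theta>))"
      unfolding x_def K_def
      by (rule kernel_bound_aux[OF p _ \<theta> \<mu> _ _ _ _ A bound S[OF \<mu>] \<eta>(1)]) (use \<theta> in auto)
    then have "\<mu> * (x ^ (?n + 1) * K) \<le> \<mu> * (C * A * (x powr (1 - \<theta>) * \<mu> powr (- \<theta>)))"
      using \<mu> by (intro mult_left_mono) (auto simp: C_def mult_ac)
    also have "\<mu> * (C * A * (x powr (1 - \<theta>) * \<mu> powr (- \<theta>))) = C * A * (\<mu> powr (1 - \<theta>) * x powr (1 - \<theta>))"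
      using \<mu> powr_add[of \<mu> 1 "- \<theta>"] by simp
    finally have high: "\<mu> * (x ^ (?n + 1) * K) \<le> C * A * (\<mu> powr (1 - \<theta>) * x powr (1 - \<theta>))" .
    have "K * (x ^ ?n * (1 + \<mu> * x)) \<le> C * A * (\<mu> powr \<theta> * x powr \<theta> + \<mu> powr (1 - \<theta>) * x powr (1 - \<theta>))"
      using add_mono[OF low high] by (simp add: algebra_simps)
    moreover have "0 < x ^ ?n * (1 + \<mu> * x)" using x \<mu> by (simp add: add_pos_pos)
    ultimately show ?thesis
      unfolding x_def[symmetric] K_def[symmetric] times_divide_eq_right by (subst pos_le_divide_eq)
  qed
  with C0 show ?thesis by (intro exI[of _ C]) blast
qed

text \<open>Dominated convergence for unordered sums, for values in a Banach space that need not be separable: the majorant makes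
the partial sums converge uniformly in the parameter, so that the two limits may be interchanged.\<close>

lemma tendsto_infsum_dominated:
  fixes f :: "'b \<Rightarrow> 'a \<Rightarrow> 'v::banach"
  assumes "F \<noteq> bot" and lim: "\<And>k. ((\<lambda>x. f x k) \<longlongrightarrow> g k) F"
    and Y: "\<forall>\<^sub>F x in F. x \<in> Y" and bound: "\<And>x k. x \<in> Y \<Longrightarrow> norm (f x k) \<le> M k"
    and M: "M summable_on UNIV"
  shows "((\<lambda>x. \<Sum>\<^sub>\<infinity>k. f x k) \<longlongrightarrow> (\<Sum>\<^sub>\<infinity>k. g k)) F"
proof (rule swap_uniform_limit')
  have "norm (g k) \<le> M k" for k
  proof (rule tendsto_upperbound[OF tendsto_norm[OF lim] _ assms(1)])
    show "\<forall>\<^sub>F x in F. norm (f x k) \<le> M k"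
      using Y by (rule eventually_mono) (rule bound)
  qed
  then have "g abs_summable_on UNIV"
    by (intro summable_on_comparison_test[OF M]) auto
  then have "g summable_on UNIV" by (rule abs_summable_summable)
  then show "(sum g \<longlongrightarrow> (\<Sum>\<^sub>\<infinity>k. g k)) (finite_subsets_at_top UNIV)"
    using has_sum_infsum has_sum_def by blast
  show "uniform_limit Y (\<lambda>X x. \<Sum>k\<in>X. f x k) (\<lambda>x. \<Sum>\<^sub>\<infinity>k. f x k) (finite_subsets_at_top UNIV)"
    by (rule Weierstrass_m_test_general[OF _ M]) (rule bound)
  show "\<forall>\<^sub>F X in finite_subsets_at_top UNIV. ((\<lambda>x. \<Sum>k\<in>X. f x k) \<longlongrightarrow> sum g X) F"
    by (intro always_eventually allI tendsto_sum lim)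
qed (use Y in auto)


section \<open>The regularised kernels\<close>

text \<open>Two-sided decay out of decay in \<open>Q\<close>, which here is \<open>\<langle>k,z\<rangle>\<close>: bound \<open>Q\<close> from below by \<open>\<mu>\<close> if
\<open>b \<le> \<mu>\<close> and by \<open>b\<close> otherwise.\<close>

lemma powr_le_dyadic_profile:
  assumes "0 < b" "0 < \<mu>" "b \<le> Q" "\<mu> \<le> Q" "0 < \<alpha>" "\<alpha> \<le> s" "\<alpha> \<le> t"
  shows "\<mu> powr s * b powr t * Q powr (- (s + t)) \<le> dyadic_profile \<alpha> (b / \<mu>)"
proof (cases "b / \<mu> \<le> 1")
  case True
  have "\<mu> powr s * b powr t * Q powr (- (s + t)) \<le> \<mu> powr s * b powr t * \<mu> powr (- (s + t))"
    using assms by (intro mult_left_mono powr_mono2') auto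
  also have "\<dots> = (b / \<mu>) powr t"
    using assms by (simp add: powr_divide powr_add powr_minus powr_diff field_simps)
  also have "\<dots> \<le> (b / \<mu>) powr \<alpha>"
    using assms True by (intro powr_mono') auto
  also have "\<dots> = dyadic_profile \<alpha> (b / \<mu>)"
    using assms True by (auto simp: dyadic_profile_def intro!: min_absorb1[symmetric] powr_mono')
  finally show ?thesis .
next
  case False
  have "\<mu> powr s * b powr t * Q powr (- (s + t)) \<le> \<mu> powr s * b powr t * b powr (- (s + t))"
    using assms by (intro mult_left_mono powr_mono2') auto
  also have "\<dots> = (b / \<mu>) powr (- s)"
    using assms by (simp add: powr_divide powr_add powr_minus powr_diff field_simps)
  also have "\<dots> \<le> (b / \<mu>) powr (- \<alpha>)"
    using assms False by (intro powr_mono) auto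
  also have "\<dots> = dyadic_profile \<alpha> (b / \<mu>)"
    using assms False by (auto simp: dyadic_profile_def intro!: min_absorb2[symmetric] powr_mono)
  finally show ?thesis .
qed

lemma sector_closed: "closed (sector (pi / 2) R)"
proof -
  have "sector (pi / 2) R = {z. R \<le> cmod z} \<inter> {z. 0 \<le> Re z}"
    unfolding sector_def Arg_Re_nonneg by blast
  moreover have "closed {z. R \<le> cmod z}" "closed {z. 0 \<le> Re z}"
    by (intro closed_Collect_le continuous_intros)+
  ultimately show ?thesis by (simp add: closed_Int)
qed

lemma schwartz_continuous:
  assumes "schwartz \<phi>"
  shows "isCont \<phi> x"
proof -
  obtain D where "D 0 = \<phi>" and "\<And>i x. (D i has_vector_derivative D (Suc i) x) (at x)"
    using assms by (auto simp: schwartz_def)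
  then have "(\<phi> has_vector_derivative D (Suc 0) x) (at x)" by metis
  then show ?thesis by (rule has_vector_derivative_continuous)
qed

context parabolic_symbol
begin

definition kernel_symbol :: "(real \<Rightarrow> complex) \<Rightarrow> real \<Rightarrow> complex \<Rightarrow> int ^ 'n \<Rightarrow> 'e lop"
  where "kernel_symbol \<phi> \<epsilon> z k = cutoff m \<phi> \<epsilon> (rvec k) z *\<^sub>C resolvent z k"

lemma regularized_kernel_eq:
  "regularized_kernel m a \<phi> \<epsilon> \<eta> z = torus_series (kernel_symbol \<phi> \<epsilon> z) \<eta>"
  by (simp add: regularized_kernel_def torus_series_def kernel_symbol_def character_def scaleC_scaleC)

lemma sector_cmod_pos: "z \<in> sector (pi / 2) R \<Longrightarrow> 0 < cmod z"
  using R_pos by (auto simp: sector_def)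

text \<open>The first difference of the product is written as two products: the one with the difference of the resolvent has the
order \<open>(m - 1, -2m)\<close>, and the one with the difference of the cut-off has the order \<open>(0, -1 - m)\<close>. Multiplied by
\<open>|z| = \<mu> powr m\<close>, both decay on both sides of \<open>\<langle>k\<rangle> = \<mu>\<close>, with the exponents \<open>m\<close> or \<open>1\<close>; hence the
exponent \<open>min m 1\<close>. At least one difference is needed for this, and there is one because \<open>n \<ge> 1\<close>.\<close>

lemma kernel_symbol_diff_bound:
  assumes \<phi>: "schwartz \<phi>"
  shows "\<exists>C\<ge>0. \<forall>\<epsilon>>0. \<forall>z\<in>sector (pi / 2) R.
    dyadic_decay (min m 1) (cmod z powr (1 / m)) (C / cmod z) (kernel_symbol \<phi> \<epsilon> z)"
proof -
  let ?n = "CARD('n)"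
  obtain C1 where C1: "\<And>\<epsilon> z j. 0 < \<epsilon> \<Longrightarrow> R \<le> cmod z \<Longrightarrow>
      mixed_symbol m z (j :: 'n) ?n C1 0 0 (\<lambda>k. cutoff m \<phi> \<epsilon> (rvec k) z)"
    "\<And>\<epsilon> z j. 0 < \<epsilon> \<Longrightarrow> R \<le> cmod z \<Longrightarrow>
      mixed_symbol m z (j :: 'n) ?n C1 0 (- 1) (diff_op j (\<lambda>k. cutoff m \<phi> \<epsilon> (rvec k) z))"
    using cutoff_mixed[OF \<phi> m_pos R_pos, where 'n='n and L = ?n] by blast
  obtain C2 where C2: "\<And>z j. z \<in> sector (pi / 2) R \<Longrightarrow> mixed_symbol m z j ?n C2 0 (- m) (resolvent z)"
    using resolvent_mixed_bound[of ?n] by auto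
  obtain C3 where C3: "\<And>z j. z \<in> sector (pi / 2) R \<Longrightarrow>
      mixed_symbol m z j ?n C3 (m - 1) (- 2 * m) (diff_op j (resolvent z))"
    using diff_resolvent_mixed by blast
  define c where "c = (2::real) powr real (?n + 1)"
  define D1 where "D1 = (2 * c) ^ ?n * (c * C1 * C3)"
  define D2 where "D2 = (2 * c) ^ ?n * (C1 * C2)"
  have c: "2 powr (\<bar>0\<bar> + real ?n + \<bar>0\<bar>) \<le> c" "2 powr (\<bar>0\<bar> + real ?n + \<bar>- 1\<bar>) \<le> c"
    unfolding c_def by (intro powr_mono; simp)+
  note prod = bounded_bilinear_scaleC eq_refl[OF norm_scaleC]
  have 1: "mixed_symbol m z j ?n D1 (m - 1) (- 2 * m)
      (\<lambda>k. cutoff m \<phi> \<epsilon> (rvec (k + axis j 1)) z *\<^sub>C diff_op j (resolvent z) k)"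
    if "0 < \<epsilon>" "z \<in> sector (pi / 2) R" for \<epsilon> z j
    unfolding D1_def
    using mixed_symbol_product[OF prod mixed_symbol_shift[OF C1(1) c(1)] C3 c(1)] that
    by (simp add: sector_def)
  have 2: "mixed_symbol m z j ?n D2 0 (- 1 - m)
      (\<lambda>k. diff_op j (\<lambda>k. cutoff m \<phi> \<epsilon> (rvec k) z) k *\<^sub>C resolvent z k)"
    if "0 < \<epsilon>" "z \<in> sector (pi / 2) R" for \<epsilon> z j
    unfolding D2_def
    using mixed_symbol_product[OF prod C1(2) C2 c(2)] that
    by (simp add: sector_def)
  define C where "C = \<bar>D1\<bar> + \<bar>D2\<bar>"
  show ?thesis
    unfolding dyadic_decay_def
  proof (intro exI[of _ C] conjI allI impI ballI)
    show "0 \<le> C" by (simp add: C_def)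
  next
    fix \<epsilon> :: real and z N and j :: 'n and k :: "int ^ 'n"
    assume eps: "0 < \<epsilon>" and z: "z \<in> sector (pi / 2) R" and N: "N \<in> {?n, ?n + 1}"
    \<comment> \<open>This uses \<open>N \<ge> n \<ge> 1\<close>.\<close>
    obtain i where i: "N = Suc i" "i \<le> ?n"
      using N zero_less_card_finite[where 'a='n] by (cases N) auto
    define b where "b = bracket (rvec k)"
    define \<mu> where "\<mu> = cmod z powr (1 / m)"
    define Q where "Q = param_bracket m (rvec k) z"
    have b: "0 < b" "b \<le> Q" and Q: "0 < Q" "\<mu> \<le> Q"
      by (simp_all add: b_def Q_def \<mu>_def bracket_pos param_bracket_pos bracket_le_param_bracket
          cmod_powr_le_param_bracket)
    have \<mu>: "0 < \<mu>" "cmod z = \<mu> powr m"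
      using sector_cmod_pos[OF z] m_pos by (auto simp: \<mu>_def powr_powr)
    define P where "P = dyadic_profile (min m 1) (b / \<mu>)"
    have P1: "\<mu> powr m * b powr m * Q powr (- (m + m)) \<le> P"
      and P2: "\<mu> powr m * b powr 1 * Q powr (- (m + 1)) \<le> P"
      unfolding P_def by (intro powr_le_dyadic_profile b \<mu> Q; use m_pos in simp)+
    have w1: "cmod z * mixed_weight m z (m - 1 - real i) (- 2 * m) k \<le> P / b ^ N"
    proof -
      have "cmod z * mixed_weight m z (m - 1 - real i) (- 2 * m) k
          = \<mu> powr m * b powr m * Q powr (- (m + m)) / b ^ N"
        using b(1) unfolding \<mu>(2) mixed_weight_def b_def[symmetric] Q_def[symmetric] i(1)
        by (simp add: powr_diff powr_realpow)
      also have "\<dots> \<le> P / b ^ N" using b(1) by (intro divide_right_mono P1) simp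
      finally show ?thesis .
    qed
    have w2: "cmod z * mixed_weight m z (0 - real i) (- 1 - m) k \<le> P / b ^ N"
    proof -
      have "cmod z * mixed_weight m z (0 - real i) (- 1 - m) k
          = \<mu> powr m * b powr 1 * Q powr (- (m + 1)) / b ^ N"
      proof -
        have e1: "b powr (0 - real i) = b powr 1 / b ^ N"
          using b(1) by (simp add: i(1) powr_minus powr_realpow divide_inverse)
        have e2: "- 1 - m = - (m + 1)" by simp
        show ?thesis
          unfolding \<mu>(2) mixed_weight_def b_def[symmetric] Q_def[symmetric] e1 e2 by simp
      qed
      also have "\<dots> \<le> P / b ^ N" using b(1) by (intro divide_right_mono P2) simp
      finally show ?thesis .
    qed
    let ?T1 = "\<lambda>k. cutoff m \<phi> \<epsilon> (rvec (k + axis j 1)) z *\<^sub>C diff_op j (resolvent z) k"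
    let ?T2 = "\<lambda>k. diff_op j (\<lambda>k. cutoff m \<phi> \<epsilon> (rvec k) z) k *\<^sub>C resolvent z k"
    have "(diff_op j ^^ N) (kernel_symbol \<phi> \<epsilon> z) k = (diff_op j ^^ i) ?T1 k + (diff_op j ^^ i) ?T2 k"
      unfolding i(1) funpow_Suc_right o_apply kernel_symbol_def[abs_def]
        diff_op_product[OF bounded_bilinear_scaleC] diff_op_funpow_add ..
    then have "norm ((diff_op j ^^ N) (kernel_symbol \<phi> \<epsilon> z) k)
        \<le> norm ((diff_op j ^^ i) ?T1 k) + norm ((diff_op j ^^ i) ?T2 k)"
      by (simp add: norm_triangle_ineq)
    also have "\<dots> \<le> D1 * mixed_weight m z (m - 1 - real i) (- 2 * m) k
        + D2 * mixed_weight m z (0 - real i) (- 1 - m) k"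
      using 1[OF eps z, of j] 2[OF eps z, of j] i(2) unfolding mixed_symbol_def
      by (intro add_mono) auto
    also have "\<dots> \<le> \<bar>D1\<bar> * mixed_weight m z (m - 1 - real i) (- 2 * m) k
        + \<bar>D2\<bar> * mixed_weight m z (0 - real i) (- 1 - m) k"
      by (intro add_mono mult_right_mono less_imp_le[OF mixed_weight_pos]) auto
    finally have "cmod z * norm ((diff_op j ^^ N) (kernel_symbol \<phi> \<epsilon> z) k)
        \<le> cmod z * (\<bar>D1\<bar> * mixed_weight m z (m - 1 - real i) (- 2 * m) k
        + \<bar>D2\<bar> * mixed_weight m z (0 - real i) (- 1 - m) k)"
      by (rule mult_left_mono) simp
    also have "\<dots> = \<bar>D1\<bar> * (cmod z * mixed_weight m z (m - 1 - real i) (- 2 * m) k)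
        + \<bar>D2\<bar> * (cmod z * mixed_weight m z (0 - real i) (- 1 - m) k)"
      by (simp add: algebra_simps)
    also have "\<dots> \<le> \<bar>D1\<bar> * (P / b ^ N) + \<bar>D2\<bar> * (P / b ^ N)"
      by (intro add_mono mult_left_mono w1 w2) auto
    also have "\<dots> = C * (P / b ^ N)" by (simp only: C_def distrib_right)
    finally show "norm ((diff_op j ^^ N) (kernel_symbol \<phi> \<epsilon> z) k)
      \<le> C / cmod z * (dyadic_profile (min m 1) (bracket (rvec k) / cmod z powr (1 / m)) / bracket (rvec k) ^ N)"
      unfolding P_def b_def \<mu>_def using sector_cmod_pos[OF z]
      by (simp only: pos_le_divide_eq times_divide_eq_left mult.commute)
  qed
qed

lemma norm_resolvent_le:
  assumes "z \<in> sector (pi / 2) R"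
  shows "norm (resolvent z k) \<le> \<kappa>"
proof -
  have "param_bracket m (rvec k) z powr (- m) \<le> 1 powr (- m)"
    using m_pos param_bracket_ge_1 by (intro powr_mono2') auto
  then show ?thesis
    using norm_inv_le[OF assms, of k] \<kappa>_nonneg mult_left_mono[of _ 1 \<kappa>] by (force intro: order_trans)
qed

text \<open>For fixed \<open>\<epsilon>\<close> the rapid decay of the cut-off makes the coefficients summable, uniformly in \<open>z\<close>. The majorant
depends on \<open>\<epsilon>\<close>; it serves only for summability and continuity.\<close>

lemma kernel_symbol_majorant:
  assumes \<phi>: "schwartz \<phi>" and \<epsilon>: "0 < \<epsilon>"
  shows "\<exists>g. g summable_on UNIV \<and>
    (\<forall>z\<in>sector (pi / 2) R. \<forall>k. norm (kernel_symbol \<phi> \<epsilon> z k) \<le> g k)"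
proof -
  let ?n = "CARD('n)"
  obtain B where B: "\<And>x. norm (x ^ (?n + 1) *\<^sub>R \<phi> x) \<le> B"
  proof -
    obtain D where D: "D 0 = \<phi>" "\<And>i j. bounded (range (\<lambda>x. x ^ j *\<^sub>R D i x))"
      using \<phi> by (auto simp: schwartz_def)
    from D(2)[of "?n + 1" 0] have "bounded (range (\<lambda>x. x ^ (?n + 1) *\<^sub>R \<phi> x))"
      by (simp only: D(1))
    then show ?thesis using that unfolding bounded_iff by blast
  qed
  have B0: "0 \<le> B" using order_trans[OF norm_ge_zero B] .
  define K where "K = sqrt (1 + 1 / (R powr (1 / m))\<^sup>2)"
  \<comment> \<open>\<open>K\<close> is the factor between \<open>param_bracket\<close> and \<open>param_abs\<close>.\<close>
  define E where "E = B * (K / \<epsilon>) ^ (?n + 1) * \<kappa>"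
  define g where "g k = E * (dyadic_profile 1 (bracket (rvec k) / 1) / bracket (rvec k) ^ ?n)"
    for k :: "int ^ 'n"
  have "g summable_on UNIV"
    unfolding g_def[abs_def] by (intro summable_on_cmult_right lattice_summable) auto
  moreover have "norm (kernel_symbol \<phi> \<epsilon> z k) \<le> g k" if z: "z \<in> sector (pi / 2) R" for z k
  proof -
    define b where "b = bracket (rvec k)"
    define h where "h = param_abs m (rvec k) z"
    have b: "1 \<le> b" by (simp add: b_def bracket_ge_1)
    have K: "0 < K" by (auto simp: K_def intro!: add_pos_nonneg)
    have "b \<le> K * h"
      using bracket_le_param_bracket[of "rvec k" m z] param_bracket_le_param_abs[OF m_pos R_pos, of z "rvec k"] z
      by (simp add: b_def h_def K_def sector_def)
    then have bh: "b / K \<le> h" using K by (simp add: field_simps)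
    moreover have "0 < b / K" using b K by simp
    ultimately have h: "0 < h" by linarith
    have "cmod (\<phi> (\<epsilon> * h)) = norm ((\<epsilon> * h) ^ (?n + 1) *\<^sub>R \<phi> (\<epsilon> * h)) / (\<epsilon> * h) ^ (?n + 1)"
      using \<epsilon> h by simp
    also have "\<dots> \<le> B / (\<epsilon> * (b / K)) ^ (?n + 1)"
      using \<epsilon> h bh b K B0 by (intro frac_le B power_mono mult_left_mono) auto
    also have "\<dots> = B * (K / \<epsilon>) ^ (?n + 1) / b ^ (?n + 1)"
    proof -
      have eq: "\<epsilon> * (b / K) = b / (K / \<epsilon>)" by simp
      show ?thesis unfolding eq power_divide[of b] by simp
    qed
    finally have "cmod (\<phi> (\<epsilon> * h)) \<le> B * (K / \<epsilon>) ^ (?n + 1) / b ^ (?n + 1)" .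
    then have "cmod (\<phi> (\<epsilon> * h)) * norm (resolvent z k) \<le> B * (K / \<epsilon>) ^ (?n + 1) / b ^ (?n + 1) * \<kappa>"
      using B0 K \<epsilon> b by (intro mult_mono norm_resolvent_le z) auto
    also have "\<dots> = E / b ^ (?n + 1)" by (simp add: E_def)
    also have "\<dots> = g k"
    proof -
      have "dyadic_profile 1 b = 1 / b"
      proof -
        have "b powr (- 1) \<le> b powr 1" using b by (intro powr_mono) auto
        then show ?thesis
          using b by (simp add: dyadic_profile_def min_absorb2 powr_minus_divide)
      qed
      then show ?thesis by (simp add: g_def flip: b_def)
    qed
    finally show ?thesis by (simp add: kernel_symbol_def cutoff_def norm_scaleC h_def)
  qed
  ultimately show ?thesis by blast
qed

lemma kernel_symbol_abs_summable:
  assumes "schwartz \<phi>" and "0 < \<epsilon>" and "z \<in> sector (pi / 2) R"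
  shows "kernel_symbol \<phi> \<epsilon> z abs_summable_on UNIV"
proof -
  obtain g where "g summable_on UNIV" "\<And>k. norm (kernel_symbol \<phi> \<epsilon> z k) \<le> g k"
    using kernel_symbol_majorant[OF assms(1,2)] assms(3) by blast
  then show ?thesis by (rule summable_on_comparison_test) simp
qed

lemma regularized_kernel_bound:
  assumes "schwartz \<phi>"
  shows "\<exists>C\<ge>0. \<forall>\<epsilon>>0. pointwise_estimate m R C (regularized_kernel m a \<phi> \<epsilon>)"
proof -
  define \<theta> where "\<theta> = min m 1 / 2"
  have \<theta>: "0 < \<theta>" "\<theta> \<le> 1 / 2" "2 * \<theta> = min m 1" using m_pos by (auto simp: \<theta>_def)
  obtain A where A: "0 \<le> A" "\<And>\<epsilon> z. 0 < \<epsilon> \<Longrightarrow> z \<in> sector (pi / 2) R \<Longrightarrow>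
      dyadic_decay (2 * \<theta>) (cmod z powr (1 / m)) (A / cmod z) (kernel_symbol \<phi> \<epsilon> z)"
    using kernel_symbol_diff_bound[OF assms] unfolding \<theta>(3) by blast
  obtain C where C: "0 \<le> C" "\<And>(p :: int ^ 'n \<Rightarrow> 'e lop) \<mu> A \<eta>.
    p abs_summable_on UNIV \<Longrightarrow> 0 < \<mu> \<Longrightarrow> 0 \<le> A \<Longrightarrow> dyadic_decay (2 * \<theta>) \<mu> A p \<Longrightarrow> \<eta> \<in> torus - {0} \<Longrightarrow>
    norm (torus_series p \<eta>) \<le> C * A * ((\<mu> powr \<theta> * norm \<eta> powr \<theta> + \<mu> powr (1 - \<theta>) * norm \<eta> powr (1 - \<theta>))
      / (norm \<eta> ^ CARD('n) * (1 + \<mu> * norm \<eta>)))"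
    using kernel_bound[OF \<theta>(1,2), where 'n='n and 'v="'e lop"] by metis
  have "pointwise_estimate m R (C * A) (regularized_kernel m a \<phi> \<epsilon>)" if \<epsilon>: "0 < \<epsilon>" for \<epsilon>
    unfolding pointwise_estimate_def Let_def \<theta>_def[symmetric]
  proof (intro ballI)
    fix \<eta> :: "real ^ 'n" and z
    assume \<eta>: "\<eta> \<in> torus - {0}" and z: "z \<in> sector (pi / 2) R"
    let ?\<mu> = "cmod z powr (1 / m)"
    let ?q = "(?\<mu> powr \<theta> * norm \<eta> powr \<theta> + ?\<mu> powr (1 - \<theta>) * norm \<eta> powr (1 - \<theta>))
      / (norm \<eta> ^ CARD('n) * (1 + ?\<mu> * norm \<eta>))"
    note z0 = sector_cmod_pos[OF z]
    have "norm (torus_series (kernel_symbol \<phi> \<epsilon> z) \<eta>) \<le> C * (A / cmod z) * ?q"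
      by (rule C(2)[OF kernel_symbol_abs_summable[OF assms \<epsilon> z] _ _ A(2)[OF \<epsilon> z] \<eta>]) (use z0 A in auto)
    then have "cmod z * norm (torus_series (kernel_symbol \<phi> \<epsilon> z) \<eta>) \<le> cmod z * (C * (A / cmod z) * ?q)"
      by (rule mult_left_mono) simp
    also have "\<dots> = C * A * ?q" using z0 by simp
    finally show "cmod z * norm (regularized_kernel m a \<phi> \<epsilon> \<eta> z) \<le> C * A * ?q"
      unfolding regularized_kernel_eq .
  qed
  then show ?thesis using A C by (intro exI[of _ "C * A"]) auto
qed

text \<open>By the resolvent identity and the uniform bound of the inverses the resolvent is even Lipschitz continuous on the
sector.\<close>

lemma continuous_on_resolvent: "continuous_on (sector (pi / 2) R) (\<lambda>z. resolvent z k)"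
proof (rule lipschitz_on_continuous_on)
  show "(\<kappa> * norm (lop_id :: 'e lop) * \<kappa>)-lipschitz_on (sector (pi / 2) R) (\<lambda>z. resolvent z k)"
  proof (rule lipschitz_onI)
    fix z w assume z: "z \<in> sector (pi / 2) R" and w: "w \<in> sector (pi / 2) R"
    have "norm (resolvent z k - resolvent w k)
        \<le> norm (lop_comp (resolvent z k) ((a k + z *\<^sub>C lop_id) - (a k + w *\<^sub>C lop_id))) * norm (resolvent w k)"
      unfolding resolvent_identity[OF invertible[OF z] invertible[OF w]] norm_minus_cancel
      by (rule norm_lop_comp)
    also have "\<dots> \<le> norm (resolvent z k) * norm ((a k + z *\<^sub>C lop_id) - (a k + w *\<^sub>C lop_id)) * norm (resolvent w k)"
      by (intro mult_right_mono norm_lop_comp) simp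
    also have "(a k + z *\<^sub>C lop_id) - (a k + w *\<^sub>C lop_id) = (z - w) *\<^sub>C lop_id"
      by (simp add: bounded_bilinear.diff_left[OF bounded_bilinear_scaleC])
    also have "norm (resolvent z k) * norm ((z - w) *\<^sub>C (lop_id :: 'e lop)) * norm (resolvent w k)
        \<le> \<kappa> * norm ((z - w) *\<^sub>C (lop_id :: 'e lop)) * \<kappa>"
      using \<kappa>_nonneg by (intro mult_mono norm_resolvent_le z w) auto
    finally show "dist (resolvent z k) (resolvent w k) \<le> \<kappa> * norm (lop_id :: 'e lop) * \<kappa> * dist z w"
      by (simp add: dist_norm norm_scaleC mult_ac)
  qed (use \<kappa>_nonneg in simp)
qed

lemma continuous_on_regularized_kernel:
  assumes \<phi>: "schwartz \<phi>" and \<epsilon>: "0 < \<epsilon>"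
  shows "continuous_on (UNIV \<times> sector (pi / 2) R) (\<lambda>(\<eta>, z). regularized_kernel m a \<phi> \<epsilon> \<eta> z)"
proof -
  let ?Y = "UNIV \<times> sector (pi / 2) R"
  let ?t = "\<lambda>k (\<eta>, z). character k \<eta> *\<^sub>C kernel_symbol \<phi> \<epsilon> z k"
  obtain g where g: "g summable_on UNIV"
    "\<And>z k. z \<in> sector (pi / 2) R \<Longrightarrow> norm (kernel_symbol \<phi> \<epsilon> z k) \<le> g k"
    using kernel_symbol_majorant[OF assms] by blast
  have "continuous_on ?Y (\<lambda>y. \<Sum>\<^sub>\<infinity>k. ?t k y)"
  proof (rule uniform_limit_theorem)
    show "uniform_limit ?Y (\<lambda>X y. \<Sum>k\<in>X. ?t k y) (\<lambda>y. \<Sum>\<^sub>\<infinity>k. ?t k y) (finite_subsets_at_top UNIV)"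
      by (rule Weierstrass_m_test_general[OF _ g(1)]) (use g(2) in auto)
    have "continuous_on ?Y (?t k)" for k
    proof -
      have "continuous_on ?Y (\<lambda>y. character k (fst y))"
        unfolding character_def by (intro continuous_intros)
      moreover have "continuous_on ?Y (\<lambda>y. cutoff m \<phi> \<epsilon> (rvec k) (snd y))"
      proof -
        have "continuous_on ?Y (\<lambda>y. \<epsilon> * param_abs m (rvec k) (snd y))"
          unfolding param_abs_sqrt
          using R_pos by (intro continuous_intros) (auto simp: sector_def)
        moreover have "continuous_on UNIV \<phi>"
          using schwartz_continuous[OF \<phi>] by (simp add: continuous_at_imp_continuous_on)
        ultimately show ?thesis
          unfolding cutoff_def using continuous_on_compose2 by blast
      qed
      moreover have "continuous_on ?Y (\<lambda>y. resolvent (snd y) k)"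
        by (rule continuous_on_compose2[OF continuous_on_resolvent]) (auto intro: continuous_intros)
      ultimately have "continuous_on ?Y (\<lambda>y. character k (fst y) *\<^sub>C cutoff m \<phi> \<epsilon> (rvec k) (snd y) *\<^sub>C resolvent (snd y) k)"
        by (intro bounded_bilinear.continuous_on[OF bounded_bilinear_scaleC])
      then show ?thesis by (simp add: kernel_symbol_def case_prod_unfold)
    qed
    then show "\<forall>\<^sub>F X in finite_subsets_at_top UNIV. continuous_on ?Y (\<lambda>y. \<Sum>k\<in>X. ?t k y)"
      by (intro always_eventually allI continuous_on_sum)
  qed simp
  then show ?thesis
    by (simp add: regularized_kernel_eq torus_series_def case_prod_unfold)
qed

text \<open>As \<open>\<epsilon>\<close> tends to \<open>0\<close> the coefficients converge to those without cut-off, which need not be summable. After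
\<open>n + 1\<close> differences they have a summable majorant independent of \<open>\<epsilon>\<close>, and away from \<open>\<eta> = 0\<close> the factor
\<open>w ^ (n + 1)\<close> produced by these differences can be divided out.\<close>

lemma regularized_kernel_converges:
  assumes \<phi>: "schwartz \<phi>" and "\<phi> 0 = 1" and \<eta>: "\<eta> \<in> torus - {0}" and z: "z \<in> sector (pi / 2) R"
  shows "\<exists>l. ((\<lambda>\<epsilon>. regularized_kernel m a \<phi> \<epsilon> \<eta> z) \<longlongrightarrow> l) (at_right 0)"
proof -
  let ?N = "CARD('n) + 1" and ?\<mu> = "cmod z powr (1 / m)"
  note z0 = sector_cmod_pos[OF z]
  obtain j where j: "norm \<eta> \<le> real CARD('n) * \<bar>\<eta> $ j\<bar>" by (rule torus_component_ge)
  define w where "w = exp (\<i> * complex_of_real (- (\<eta> $ j))) - 1"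
  have "w \<noteq> 0"
  proof -
    have "\<bar>\<eta> $ j\<bar> \<le> pi" using \<eta> by (auto simp: torus_def abs_le_iff minus_le_iff intro: less_imp_le)
    then have "\<bar>\<eta> $ j\<bar> / 2 \<le> cmod w"
      using cmod_exp_minus_one_ge[of "- (\<eta> $ j)"] by (simp add: w_def)
    moreover have "\<eta> $ j \<noteq> 0" using j \<eta> by auto
    ultimately show ?thesis by auto
  qed
  obtain A where A: "0 \<le> A" "\<And>\<epsilon>. 0 < \<epsilon> \<Longrightarrow>
      dyadic_decay (min m 1) ?\<mu> (A / cmod z) (kernel_symbol \<phi> \<epsilon> z)"
    using kernel_symbol_diff_bound[OF \<phi>] z by blast
  define g where "g k = A / cmod z * (dyadic_profile (min m 1) (bracket (rvec k) / ?\<mu>) / bracket (rvec k) ^ CARD('n))"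
    for k :: "int ^ 'n"
  have g: "g summable_on UNIV"
    unfolding g_def[abs_def] using m_pos z0 by (intro summable_on_cmult_right lattice_summable) auto
  have bound: "norm ((diff_op j ^^ ?N) (kernel_symbol \<phi> \<epsilon> z) k) \<le> g k" if \<epsilon>: "0 < \<epsilon>" for \<epsilon> k
  proof -
    have "norm ((diff_op j ^^ ?N) (kernel_symbol \<phi> \<epsilon> z) k)
        \<le> A / cmod z * (dyadic_profile (min m 1) (bracket (rvec k) / ?\<mu>) / bracket (rvec k) ^ ?N)"
      using A(2)[OF \<epsilon>] unfolding dyadic_decay_def by blast
    also have "\<dots> \<le> g k"
      unfolding g_def using bracket_ge_1[of "rvec k"] bracket_pos[of "rvec k"] A(1)
      by (intro mult_left_mono divide_left_mono dyadic_profile_nonneg power_increasing mult_pos_pos zero_less_power) auto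
    finally show ?thesis .
  qed
  have lim: "((\<lambda>\<epsilon>. (diff_op j ^^ N) (kernel_symbol \<phi> \<epsilon> z) k) \<longlongrightarrow> (diff_op j ^^ N) (resolvent z) k) (at_right 0)"
    for N k
  proof (induction N arbitrary: k)
    case 0
    have "((\<lambda>\<epsilon>. \<epsilon> * param_abs m (rvec k) z) \<longlongrightarrow> 0 * param_abs m (rvec k) z) (at_right 0)"
      by (intro tendsto_intros)
    then have "((\<lambda>\<epsilon>. cutoff m \<phi> \<epsilon> (rvec k) z) \<longlongrightarrow> \<phi> 0) (at_right 0)"
      unfolding cutoff_def using isCont_tendsto_compose[OF schwartz_continuous[OF \<phi>]] by fastforce
    from bounded_bilinear.tendsto[OF bounded_bilinear_scaleC this tendsto_const[of "resolvent z k"]]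
    show ?case
      using scaleC_of_real[of 1 "resolvent z k"] by (simp add: kernel_symbol_def assms(2))
  next
    case (Suc N)
    have step: "(diff_op j ^^ Suc N) p k = (diff_op j ^^ N) p (k + axis j 1) - (diff_op j ^^ N) p k"
      for p :: "int ^ 'n \<Rightarrow> 'e lop"
      by (simp add: diff_op_def[of j "(diff_op j ^^ N) p"])
    show ?case
      unfolding step by (intro tendsto_diff Suc.IH)
  qed
  have "((\<lambda>\<epsilon>. torus_series ((diff_op j ^^ ?N) (kernel_symbol \<phi> \<epsilon> z)) \<eta>)
      \<longlongrightarrow> torus_series ((diff_op j ^^ ?N) (resolvent z)) \<eta>) (at_right 0)"
    unfolding torus_series_def
  proof (rule tendsto_infsum_dominated[where Y = "{0<..}", OF _ _ _ _ g])
    show "((\<lambda>\<epsilon>. character k \<eta> *\<^sub>C (diff_op j ^^ ?N) (kernel_symbol \<phi> \<epsilon> z) k)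
        \<longlongrightarrow> character k \<eta> *\<^sub>C (diff_op j ^^ ?N) (resolvent z) k) (at_right 0)" for k
      by (rule bounded_linear.tendsto[OF bounded_linear_scaleC lim])
    show "\<forall>\<^sub>F \<epsilon> in at_right 0. \<epsilon> \<in> {0 :: real<..}"
      by (simp add: eventually_at_right_less)
    show "norm (character k \<eta> *\<^sub>C (diff_op j ^^ ?N) (kernel_symbol \<phi> \<epsilon> z) k) \<le> g k"
      if "\<epsilon> \<in> {0<..}" for \<epsilon> k
      using bound that unfolding norm_character_scaleC by simp
  qed simp
  then have "((\<lambda>\<epsilon>. inverse (w ^ ?N) *\<^sub>C torus_series ((diff_op j ^^ ?N) (kernel_symbol \<phi> \<epsilon> z)) \<eta>)
      \<longlongrightarrow> inverse (w ^ ?N) *\<^sub>C torus_series ((diff_op j ^^ ?N) (resolvent z)) \<eta>) (at_right 0)"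
    by (rule bounded_linear.tendsto[OF bounded_linear_scaleC])
  moreover have "inverse (w ^ ?N) *\<^sub>C torus_series ((diff_op j ^^ ?N) (kernel_symbol \<phi> \<epsilon> z)) \<eta>
      = regularized_kernel m a \<phi> \<epsilon> \<eta> z" if "0 < \<epsilon>" for \<epsilon>
  proof -
    have "inverse (w ^ ?N) * w ^ ?N = 1"
      by (rule left_inverse) (use \<open>w \<noteq> 0\<close> in simp)
    then show ?thesis
      unfolding torus_series_diff_op_funpow[OF kernel_symbol_abs_summable[OF \<phi> that z]] scaleC_scaleC
        w_def[symmetric] regularized_kernel_eq
      using scaleC_of_real[of 1 "torus_series (kernel_symbol \<phi> \<epsilon> z) \<eta>"] by simp
  qed
  ultimately show ?thesis
    by (intro exI) (rule Lim_transform_eventually, assumption, rule eventually_mono[OF eventually_at_right_less], simp)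
qed

end

lemma foldr_diff_op_single:
  fixes a :: "int ^ 'n::finite \<Rightarrow> 'v::ab_group_add"
  assumes "distinct js"
  shows "foldr (\<lambda>l. diff_op l ^^ (if l = j then i else 0)) js a
    = (if j \<in> set js then (diff_op j ^^ i) a else a)"
  using assms by (induction js) auto

lemma multi_diff_single:
  fixes a :: "int ^ 'n::finite \<Rightarrow> 'v::ab_group_add"
  shows "multi_diff (\<chi> l. if l = j then i else 0) a = (diff_op j ^^ i) a"
proof -
  obtain js :: "'n list" where "set js = UNIV" "distinct js"
    using finite_distinct_list[of "UNIV :: 'n set"] by auto
  then show ?thesis
    using multi_diff_foldr[of js "\<chi> l. if l = j then i else 0" a] foldr_diff_op_single[of js j i a]
    by simp
qed

text \<open>The multiindices concentrated in one coordinate give the bounds for pure differences.\<close>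

lemma symbol_space_diff_le:
  assumes "a \<in> symbol_space m \<rho>"
  shows "\<exists>M. \<forall>i\<le>\<rho>. \<forall>j k. norm ((diff_op j ^^ i) a k) \<le> M * bracket (rvec k) powr (m - real i)"
proof -
  define M where "M = enn2real (symbol_norm m \<rho> a)"
  have M: "symbol_norm m \<rho> a = ennreal M"
    using assms by (simp add: symbol_space_def M_def less_top)
  have "norm ((diff_op j ^^ i) a k) \<le> M * bracket (rvec k) powr (m - real i)" if i: "i \<le> \<rho>" for i j k
  proof -
    define \<alpha> where "\<alpha> = (\<chi> l. if l = j then i else 0)"
    have order: "multi_order \<alpha> = i" by (simp add: multi_order_def \<alpha>_def)
    have diff: "multi_diff \<alpha> a = (diff_op j ^^ i) a"
      unfolding \<alpha>_def by (rule multi_diff_single)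
    have "ennreal (bracket (rvec k) powr (real (multi_order \<alpha>) - m) * norm (multi_diff \<alpha> a k)) \<le> symbol_norm m \<rho> a"
      unfolding symbol_norm_def using i order by (intro SUP_upper2[of \<alpha>] SUP_upper2[of k]) auto
    then have "bracket (rvec k) powr (real i - m) * norm ((diff_op j ^^ i) a k) \<le> M"
      unfolding M order diff by (simp add: M_def)
    then have "bracket (rvec k) powr (m - real i) * (bracket (rvec k) powr (real i - m) * norm ((diff_op j ^^ i) a k))
        \<le> bracket (rvec k) powr (m - real i) * M"
      by (rule mult_left_mono) simp
    moreover have "bracket (rvec k) powr (m - real i) * bracket (rvec k) powr (real i - m) = 1"
      using bracket_pos[of "rvec k"] by (simp flip: powr_add)
    ultimately have "1 * norm ((diff_op j ^^ i) a k) \<le> bracket (rvec k) powr (m - real i) * M"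
      by (metis mult.assoc)
    then show ?thesis by (simp only: mult_1 mult.commute)
  qed
  then show ?thesis by blast
qed

lemma parabolic_symbol_intro:
  assumes m: "0 < m" and "CARD('n) + 1 \<le> \<rho>" and \<omega>: "0 \<le> \<omega>" and "0 < \<kappa>"
    and a: "a \<in> parabolic_symbols \<omega> \<kappa> m \<rho>" and R: "0 < R" "\<omega> powr m \<le> R"
  shows "\<exists>M. parabolic_symbol m \<kappa> R M (a :: int ^ 'n::finite \<Rightarrow> 'e::complex_banach lop)"
proof -
  have sp: "a \<in> symbol_space m \<rho>" and par: "parabolic m \<omega> \<kappa> a"
    using a by (auto simp: parabolic_symbols_def)
  obtain M where M: "\<And>i j k. i \<le> \<rho> \<Longrightarrow>
      norm ((diff_op j ^^ i) a k) \<le> M * bracket (rvec k) powr (m - real i)"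
    using symbol_space_diff_le[OF sp] by blast
  have \<omega>_le: "\<omega> \<le> param_abs m (rvec k) z" if "z \<in> sector (pi / 2) R" for z and k :: "int ^ 'n"
  proof -
    have "\<omega> = (\<omega> powr m) powr (1 / m)"
      using m \<omega> by (simp add: powr_powr)
    also have "\<dots> \<le> cmod z powr (1 / m)"
      using m R that by (intro powr_mono2) (auto simp: sector_def)
    also have "\<dots> \<le> param_abs m (rvec k) z" by (rule cmod_powr_le_param_abs)
    finally show ?thesis .
  qed
  have "parabolic_symbol m \<kappa> R M a"
  proof
    fix z k assume z: "z \<in> sector (pi / 2) R"
    show "lop_invertible (a k + z *\<^sub>C lop_id)"
      and "norm (lop_inv (a k + z *\<^sub>C lop_id)) \<le> \<kappa> * param_bracket m (rvec k) z powr - m"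
      using par sector_half_plane[OF z] \<omega>_le[OF z, of k] unfolding parabolic_def by blast+
  qed (use assms M in auto)
  then show ?thesis by blast
qed

theorem lemma4p8:
  fixes m \<omega> \<kappa> R :: real and \<rho> :: nat
    and A :: "(int ^ 'n::finite \<Rightarrow> 'e::complex_banach lop) set"
    and a :: "int ^ 'n \<Rightarrow> 'e lop"
    and \<phi> :: "real \<Rightarrow> complex"
  assumes "0 < m" and "CARD('n) + 1 \<le> \<rho>" and "0 \<le> \<omega>" and "0 < \<kappa>"
    and "A \<subseteq> parabolic_symbols \<omega> \<kappa> m \<rho>" and "symbol_bounded m \<rho> A"
    and "0 < R" and "\<omega> powr m \<le> R"
    and "a \<in> A"
    and "schwartz \<phi>" and "\<phi> 0 = 1"
  shows "\<exists>C.
    (\<forall>\<epsilon>\<in>{0<..<1}. pointwise_estimate m R C (regularized_kernel m a \<phi> \<epsilon>)) \<and>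
    (\<forall>\<epsilon>\<in>{0<..<1}. L1_estimate R C (regularized_kernel m a \<phi> \<epsilon>)) \<and>
    (\<exists>K :: real ^ 'n \<Rightarrow> complex \<Rightarrow> 'e lop.
      strongly_measurable
        (torus_measure \<Otimes>\<^sub>M restrict_space lborel (sector (pi / 2) R)) (\<lambda>(\<eta>, z). K \<eta> z) \<and>
      (AE (\<eta>, z) in torus_measure \<Otimes>\<^sub>M restrict_space lborel (sector (pi / 2) R).
        ((\<lambda>\<epsilon>. regularized_kernel m a \<phi> \<epsilon> \<eta> z) \<longlongrightarrow> K \<eta> z) (at_right 0)) \<and>
      (\<forall>z\<in>sector (pi / 2) R. AE \<eta> in torus_measure.
        ((\<lambda>\<epsilon>. regularized_kernel m a \<phi> \<epsilon> \<eta> z) \<longlongrightarrow> K \<eta> z) (at_right 0)) \<and>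
      pointwise_estimate m R C K \<and> L1_estimate R C K)"
proof -
  let ?S = "sector (pi / 2) R"
  let ?K = "regularized_kernel m a \<phi>"
  obtain M where "parabolic_symbol m \<kappa> R M a"
    using parabolic_symbol_intro[OF assms(1-4) _ assms(7,8)] assms(5,9) by blast
  then interpret parabolic_symbol m \<kappa> R M a .
  obtain C1 where C1: "0 \<le> C1" "\<And>\<epsilon>. 0 < \<epsilon> \<Longrightarrow> pointwise_estimate m R C1 (?K \<epsilon>)"
    using regularized_kernel_bound[OF \<open>schwartz \<phi>\<close>] by blast
  obtain C2 where C2: "0 \<le> C2" "\<And>F :: real ^ 'n \<Rightarrow> complex \<Rightarrow> 'e lop. pointwise_estimate m R C1 F \<Longrightarrow>
      (\<And>z. z \<in> ?S \<Longrightarrow> strongly_measurable torus_measure (\<lambda>\<eta>. F \<eta> z)) \<Longrightarrow> L1_estimate R C2 F"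
    using L1_estimate_of_pointwise[OF \<open>0 < m\<close> \<open>0 < R\<close> C1(1), where 'n='n and 'e='e] by blast
  define K where "K \<eta> z = (if (\<eta>, z) \<in> (torus - {0}) \<times> ?S then Lim (at_right 0) (\<lambda>\<epsilon>. ?K \<epsilon> \<eta> z) else 0)"
    for \<eta> z
  have lim: "((\<lambda>\<epsilon>. ?K \<epsilon> \<eta> z) \<longlongrightarrow> K \<eta> z) (at_right 0)" if \<eta>: "\<eta> \<in> torus - {0}" and z: "z \<in> ?S" for \<eta> z
  proof -
    obtain l where l: "((\<lambda>\<epsilon>. ?K \<epsilon> \<eta> z) \<longlongrightarrow> l) (at_right 0)"
      using regularized_kernel_converges[OF \<open>schwartz \<phi>\<close> \<open>\<phi> 0 = 1\<close> \<eta> z] by blast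
    then have "Lim (at_right 0) (\<lambda>\<epsilon>. ?K \<epsilon> \<eta> z) = l"
      by (intro tendsto_Lim) simp
    with l \<eta> z show ?thesis by (simp add: K_def)
  qed
  \<comment> \<open>Measurability requires a sequence instead of the limit along all \<open>\<epsilon>\<close>.\<close>
  have lim_seq: "(\<lambda>i. ?K (inverse (real (Suc i))) \<eta> z) \<longlonglongrightarrow> K \<eta> z"
    if "\<eta> \<in> torus - {0}" "z \<in> ?S" for \<eta> z
  proof -
    have "filterlim (\<lambda>i. inverse (real (Suc i))) (at_right 0) sequentially"
      unfolding filterlim_at using LIMSEQ_inverse_real_of_nat by auto
    from filterlim_compose[OF lim[OF that] this] show ?thesis .
  qed
  have cont: "continuous_on (UNIV \<times> ?S) (\<lambda>(\<eta>, z). ?K \<epsilon> \<eta> z)" if "0 < \<epsilon>" for \<epsilon>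
    by (rule continuous_on_regularized_kernel[OF \<open>schwartz \<phi>\<close> that])
  have cont1: "continuous_on UNIV (\<lambda>\<eta>. ?K \<epsilon> \<eta> z)" if "0 < \<epsilon>" "z \<in> ?S" for \<epsilon> z
  proof -
    have "continuous_on UNIV (\<lambda>\<eta> :: real ^ 'n. (\<eta>, z))" by (intro continuous_intros)
    then show ?thesis
      using continuous_on_compose2[OF cont[OF that(1)], of UNIV "\<lambda>\<eta>. (\<eta>, z)"] that(2) by auto
  qed
  have meas_eps: "strongly_measurable torus_measure (\<lambda>\<eta>. ?K \<epsilon> \<eta> z)" if "0 < \<epsilon>" "z \<in> ?S" for \<epsilon> z
    by (rule strongly_measurable_limit[of UNIV _ "\<lambda>_ \<eta>. ?K \<epsilon> \<eta> z"])
      (auto intro: cont1 that measurable_torus_ident)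
  have L1_eps: "L1_estimate R C2 (?K \<epsilon>)" if "0 < \<epsilon>" for \<epsilon>
    by (intro C2 C1 that meas_eps)
  have est_K: "pointwise_estimate m R C1 K"
    unfolding pointwise_estimate_def Let_def
  proof (intro ballI)
    fix \<eta> :: "real ^ 'n" and z assume \<eta>: "\<eta> \<in> torus - {0}" and z: "z \<in> ?S"
    let ?b = "C1 * (((cmod z powr (1 / m)) powr (min m 1 / 2) * norm \<eta> powr (min m 1 / 2)
        + (cmod z powr (1 / m)) powr (1 - min m 1 / 2) * norm \<eta> powr (1 - min m 1 / 2))
        / (norm \<eta> ^ CARD('n) * (1 + cmod z powr (1 / m) * norm \<eta>)))"
    show "cmod z * norm (K \<eta> z) \<le> ?b"
    proof (rule tendsto_upperbound)
      show "((\<lambda>\<epsilon>. cmod z * norm (?K \<epsilon> \<eta> z)) \<longlongrightarrow> cmod z * norm (K \<eta> z)) (at_right 0)"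
        by (intro tendsto_intros lim \<eta> z)
      have "cmod z * norm (?K \<epsilon> \<eta> z) \<le> ?b" if "0 < \<epsilon>" for \<epsilon>
        using C1(2)[OF that] \<eta> z unfolding pointwise_estimate_def Let_def by blast
      then show "\<forall>\<^sub>F \<epsilon> in at_right 0. cmod z * norm (?K \<epsilon> \<eta> z) \<le> ?b"
        using eventually_at_right_less by (rule eventually_mono[rotated])
    qed simp
  qed
  have "strongly_measurable torus_measure (\<lambda>\<eta>. K \<eta> z)" if z: "z \<in> ?S" for z
  proof (rule strongly_measurable_limit)
    show "torus - {0} \<in> sets (borel :: (real ^ 'n) measure)"
      using sets_borel_torus by auto
    show "continuous_on (torus - {0}) (\<lambda>\<eta>. ?K (inverse (real (Suc i))) \<eta> z)" for i
      by (rule continuous_on_subset[OF cont1[OF _ z]]) auto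
    show "(\<lambda>i. ?K (inverse (real (Suc i))) \<eta> z) \<longlonglongrightarrow> K \<eta> z" if "\<eta> \<in> torus - {0}" for \<eta>
      by (rule lim_seq[OF that z])
    show "K \<eta> z = 0" if "\<eta> \<notin> torus - {0}" for \<eta>
      unfolding K_def using that by (intro if_not_P) blast
  qed (rule measurable_torus_ident)
  then have L1_K: "L1_estimate R C2 K" by (rule C2(2)[OF est_K])
  let ?P = "torus_measure \<Otimes>\<^sub>M restrict_space lborel ?S :: ((real ^ 'n) \<times> complex) measure"
  have sets_S: "?S \<in> sets borel" by (rule borel_closed[OF sector_closed])
  have meas_K: "strongly_measurable ?P (\<lambda>(\<eta>, z). K \<eta> z)"
  proof (rule strongly_measurable_limit)
    show "(torus - {0}) \<times> ?S \<in> sets (borel :: ((real ^ 'n) \<times> complex) measure)"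
      using sets_borel_torus sets_S by (intro borel_Times) auto
    have "(\<lambda>x. x) \<in> measurable (restrict_space lborel ?S) borel"
      by (rule measurable_restrict_space1) simp
    then have "(\<lambda>x. (fst x, snd x)) \<in> measurable ?P (borel \<Otimes>\<^sub>M borel)"
      by (intro measurable_Pair measurable_compose[OF measurable_fst measurable_torus_ident]
          measurable_compose[OF measurable_snd])
    then show "(\<lambda>x. x) \<in> measurable ?P borel" by (simp add: borel_prod)
    show "continuous_on ((torus - {0}) \<times> ?S) (\<lambda>(\<eta>, z). ?K (inverse (real (Suc i))) \<eta> z)" for i
      by (rule continuous_on_subset[OF cont]) auto
    show "(\<lambda>i. case x of (\<eta>, z) \<Rightarrow> ?K (inverse (real (Suc i))) \<eta> z) \<longlonglongrightarrow> (case x of (\<eta>, z) \<Rightarrow> K \<eta> z)"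
      if "x \<in> (torus - {0}) \<times> ?S" for x
      using that lim_seq by auto
    show "(case x of (\<eta>, z) \<Rightarrow> K \<eta> z) = 0" if "x \<notin> (torus - {0}) \<times> ?S" for x
      using that unfolding K_def by (cases x) (simp only: prod.case if_False)
  qed
  note zero_null = zero_null_sets_torus[where 'n='n]
  have AE_z: "AE \<eta> in torus_measure. ((\<lambda>\<epsilon>. ?K \<epsilon> \<eta> z) \<longlongrightarrow> K \<eta> z) (at_right 0)" if z: "z \<in> ?S" for z
  proof (rule AE_I'[OF zero_null])
    show "{\<eta> \<in> space torus_measure. \<not> ((\<lambda>\<epsilon>. ?K \<epsilon> \<eta> z) \<longlongrightarrow> K \<eta> z) (at_right 0)} \<subseteq> {0}"
      using lim[OF _ z] by (auto simp: torus_measure_def space_scale_measure space_restrict_space)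
  qed
  have AE_P: "AE (\<eta>, z) in ?P. ((\<lambda>\<epsilon>. ?K \<epsilon> \<eta> z) \<longlongrightarrow> K \<eta> z) (at_right 0)"
  proof (rule AE_I')
    interpret S: sigma_finite_measure "restrict_space lborel ?S"
      by (intro sigma_finite_measure_restrict_space lborel.sigma_finite_measure_axioms) (use sets_S in simp)
    have "emeasure ?P ({0} \<times> ?S) = emeasure torus_measure {0 :: real ^ 'n} * emeasure (restrict_space lborel ?S) ?S"
      using zero_null sets_S by (intro S.emeasure_pair_measure_Times) (auto simp: sets_restrict_space_iff)
    then show "{0} \<times> ?S \<in> null_sets ?P"
      using zero_null sets_S by (auto simp: null_sets_def sets_restrict_space_iff intro!: pair_measureI)
    show "{x \<in> space ?P. \<not> (case x of (\<eta>, z) \<Rightarrow> ((\<lambda>\<epsilon>. ?K \<epsilon> \<eta> z) \<longlongrightarrow> K \<eta> z) (at_right 0))} \<subseteq> {0} \<times> ?S"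
      using lim by (auto simp: space_pair_measure torus_measure_def space_scale_measure space_restrict_space)
  qed
  have mono1: "pointwise_estimate m R (max C1 C2) F" if F: "pointwise_estimate m R C1 F"
    for F :: "real ^ 'n \<Rightarrow> complex \<Rightarrow> 'e lop"
    unfolding pointwise_estimate_def Let_def
  proof (intro ballI)
    fix \<eta> :: "real ^ 'n" and z assume \<eta>: "\<eta> \<in> torus - {0}" and z: "z \<in> ?S"
    let ?q = "((cmod z powr (1 / m)) powr (min m 1 / 2) * norm \<eta> powr (min m 1 / 2)
        + (cmod z powr (1 / m)) powr (1 - min m 1 / 2) * norm \<eta> powr (1 - min m 1 / 2))
        / (norm \<eta> ^ CARD('n) * (1 + cmod z powr (1 / m) * norm \<eta>))"
    have "cmod z * norm (F \<eta> z) \<le> C1 * ?q"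
      using F \<eta> z unfolding pointwise_estimate_def Let_def by blast
    also have "\<dots> \<le> max C1 C2 * ?q"
      by (intro mult_right_mono divide_nonneg_nonneg add_nonneg_nonneg mult_nonneg_nonneg) auto
    finally show "cmod z * norm (F \<eta> z) \<le> max C1 C2 * ?q" .
  qed
  have mono2: "L1_estimate R (max C1 C2) F" if F: "L1_estimate R C2 F"
    for F :: "real ^ 'n \<Rightarrow> complex \<Rightarrow> 'e lop"
    unfolding L1_estimate_def
  proof (intro ballI conjI)
    fix z assume z: "z \<in> ?S"
    show "strongly_measurable torus_measure (\<lambda>\<eta>. F \<eta> z)"
      using F z unfolding L1_estimate_def by blast
    have "ennreal (cmod z) * L1_norm torus_measure (\<lambda>\<eta>. F \<eta> z) \<le> ennreal C2"
      using F z unfolding L1_estimate_def by blast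
    also have "\<dots> \<le> ennreal (max C1 C2)" by (rule ennreal_leI) simp
    finally show "ennreal (cmod z) * L1_norm torus_measure (\<lambda>\<eta>. F \<eta> z) \<le> ennreal (max C1 C2)" .
  qed
  show ?thesis
  proof (rule exI[of _ "max C1 C2"], intro conjI exI[of _ K] ballI)
    show "pointwise_estimate m R (max C1 C2) (?K \<epsilon>)" "L1_estimate R (max C1 C2) (?K \<epsilon>)"
      if "\<epsilon> \<in> {0<..<1}" for \<epsilon>
      using that by (intro mono1 mono2 C1(2) L1_eps; simp)+
    show "strongly_measurable ?P (\<lambda>(\<eta>, z). K \<eta> z)" by (rule meas_K)
    show "AE (\<eta>, z) in ?P. ((\<lambda>\<epsilon>. ?K \<epsilon> \<eta> z) \<longlongrightarrow> K \<eta> z) (at_right 0)" by (rule AE_P)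
    show "AE \<eta> in torus_measure. ((\<lambda>\<epsilon>. ?K \<epsilon> \<eta> z) \<longlongrightarrow> K \<eta> z) (at_right 0)" if "z \<in> ?S" for z
      by (rule AE_z[OF that])
    show "pointwise_estimate m R (max C1 C2) K" by (rule mono1[OF est_K])
    show "L1_estimate R (max C1 C2) K" by (rule mono2[OF L1_K])
  qed
qed

end
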